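(* There exist a commutative ring $R$ of characteristic $2$ that is a G-GCD ring (and is in fact a unique factorization domain) and a finitely generated abelian group $G$ such that the group ring $RG$ is not a finite conductor ring. Consequently, the finite conductor property does not ascend from G-GCD rings $R$ to group rings $RG$ over finitely generated abelian groups $G$.
   Context: All rings are commutative with identity. For a ring $R$ and $c\in R$, write $(0:c)=\{r\in R: rc=0\}$. A ring $R$ is a finite conductor ring if $aR\cap bR$ and $(0:c)$ are finitely generated ideals of $R$ for all $a,b,c\in R$. A ring $R$ is a G-GCD ring if every principal ideal of $R$ is projective (as an $R$-module) and the intersection of any two finitely generated flat ideals of $R$ is again a finitely generated flat ideal. $RG$ denotes the group ring of $G$ with coefficients in $R$. *)

theory Defs
  imports "HOL-Algebra.Algebra"
begin

text \<open>The additive order of \<open>\<one>\<close>; \<open>group.ord\<close> of an element of infinite order is \<open>0\<close>, which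
  agrees with the usual convention for the characteristic.\<close>

definition characteristic :: "('a, 'x) ring_scheme \<Rightarrow> nat" where
  "characteristic R = group.ord (add_monoid R) \<one>\<^bsub>R\<^esub>"

definition fin_gen_ideal :: "('a, 'x) ring_scheme \<Rightarrow> 'a set \<Rightarrow> bool" where
  "fin_gen_ideal R I \<longleftrightarrow> (\<exists>A \<subseteq> carrier R. finite A \<and> I = Idl\<^bsub>R\<^esub> A)"

definition fin_gen_group :: "('g, 'y) monoid_scheme \<Rightarrow> bool" where
  "fin_gen_group G \<longleftrightarrow> group G \<and> (\<exists>S \<subseteq> carrier G. finite S \<and> carrier G = generate G S)"

definition finite_conductor_ring :: "('a, 'x) ring_scheme \<Rightarrow> bool" where
  "finite_conductor_ring R \<longleftrightarrow> cring R
     \<and> (\<forall>a\<in>carrier R. \<forall>b\<in>carrier R. fin_gen_ideal R (PIdl\<^bsub>R\<^esub> a \<inter> PIdl\<^bsub>R\<^esub> b))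
     \<and> (\<forall>c\<in>carrier R. fin_gen_ideal R {r \<in> carrier R. r \<otimes>\<^bsub>R\<^esub> c = \<zero>\<^bsub>R\<^esub>})"

text \<open>The record type for modules also carries a multiplication and a unit, which the locale
  \<open>module\<close> ignores; here they are filled in with those of \<open>R\<close>.\<close>

definition ideal_module :: "('a, 'x) ring_scheme \<Rightarrow> 'a set \<Rightarrow> ('a, 'a) module" where
  "ideal_module R I = \<lparr>carrier = I, monoid.mult = monoid.mult R, one = \<one>\<^bsub>R\<^esub>,
     ring.zero = \<zero>\<^bsub>R\<^esub>, add = add R, smult = monoid.mult R\<rparr>"

definition module_hom ::
  "('a, 'x) ring_scheme \<Rightarrow> ('a, 'm) module \<Rightarrow> ('a, 'n) module \<Rightarrow> ('m \<Rightarrow> 'n) set" where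
  "module_hom R M N = {f \<in> hom (add_monoid M) (add_monoid N).
     \<forall>r\<in>carrier R. \<forall>x\<in>carrier M. f (r \<odot>\<^bsub>M\<^esub> x) = r \<odot>\<^bsub>N\<^esub> f x}"

text \<open>The lifting property: every homomorphism \<open>M \<rightarrow> P\<close> factors through every surjection
  \<open>N \<rightarrow> P\<close>.  A definition cannot quantify over types, so the types of \<open>N\<close> and \<open>P\<close> have to be
  fixed.  This loses nothing: the case of \<open>P = M\<close> and \<open>N\<close> the free module on \<open>carrier M\<close>,
  realised as finitely supported functions, already makes \<open>M\<close> a direct summand of a free
  module and hence yields the lifting property for arbitrary \<open>N\<close> and \<open>P\<close>.\<close>

definition projective_module :: "('a, 'x) ring_scheme \<Rightarrow> ('a, 'm) module \<Rightarrow> bool" where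
  "projective_module R M \<longleftrightarrow> module R M \<and>
     (\<forall>(N :: ('a, 'm \<Rightarrow> 'a) module) (P :: ('a, 'm) module).
        module R N \<longrightarrow> module R P \<longrightarrow>
        (\<forall>p\<in>module_hom R N P. \<forall>g\<in>module_hom R M P. p ` carrier N = carrier P \<longrightarrow>
           (\<exists>h\<in>module_hom R M N. \<forall>x\<in>carrier M. p (h x) = g x)))"

text \<open>The tensor product \<open>M \<otimes>\<^sub>R N\<close> as an abelian group: the free abelian group on
  \<open>M \<times> N\<close> modulo the subgroup generated by the bilinearity relations.\<close>

definition tensor_rels ::
  "('a, 'x) ring_scheme \<Rightarrow> ('a, 'm) module \<Rightarrow> ('a, 'n) module \<Rightarrow> ('m \<times> 'n \<Rightarrow>\<^sub>0 int) set" where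
  "tensor_rels R M N =
     {frag_of (x \<oplus>\<^bsub>M\<^esub> x', y) - frag_of (x, y) - frag_of (x', y) | x x' y.
        x \<in> carrier M \<and> x' \<in> carrier M \<and> y \<in> carrier N} \<union>
     {frag_of (x, y \<oplus>\<^bsub>N\<^esub> y') - frag_of (x, y) - frag_of (x, y') | x y y'.
        x \<in> carrier M \<and> y \<in> carrier N \<and> y' \<in> carrier N} \<union>
     {frag_of (r \<odot>\<^bsub>M\<^esub> x, y) - frag_of (x, r \<odot>\<^bsub>N\<^esub> y) | r x y.
        r \<in> carrier R \<and> x \<in> carrier M \<and> y \<in> carrier N}"

abbreviation tensor_free ::
  "('a, 'm) module \<Rightarrow> ('a, 'n) module \<Rightarrow> ('m \<times> 'n \<Rightarrow>\<^sub>0 int) monoid" where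
  "tensor_free M N \<equiv> free_Abelian_group (carrier M \<times> carrier N)"

definition tensor_null ::
  "('a, 'x) ring_scheme \<Rightarrow> ('a, 'm) module \<Rightarrow> ('a, 'n) module \<Rightarrow> ('m \<times> 'n \<Rightarrow>\<^sub>0 int) set" where
  "tensor_null R M N = generate (tensor_free M N) (tensor_rels R M N)"

definition tensor_product ::
  "('a, 'x) ring_scheme \<Rightarrow> ('a, 'm) module \<Rightarrow> ('a, 'n) module \<Rightarrow> ('m \<times> 'n \<Rightarrow>\<^sub>0 int) set monoid" where
  "tensor_product R M N = tensor_free M N Mod tensor_null R M N"

text \<open>The map \<open>M \<otimes> N' \<rightarrow> M \<otimes> N\<close> induced by \<open>f : N' \<rightarrow> N\<close>, on cosets \<open>U\<close>.  For a module
  homomorphism \<open>f\<close> the cosets contributed by the members \<open>c\<close> of \<open>U\<close> all coincide.\<close>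

definition tensor_map ::
  "('a, 'x) ring_scheme \<Rightarrow> ('a, 'm) module \<Rightarrow> ('a, 'n) module \<Rightarrow> ('k \<Rightarrow> 'n)
     \<Rightarrow> ('m \<times> 'k \<Rightarrow>\<^sub>0 int) set \<Rightarrow> ('m \<times> 'n \<Rightarrow>\<^sub>0 int) set" where
  "tensor_map R M N f U =
     (\<Union>c\<in>U. tensor_null R M N #>\<^bsub>tensor_free M N\<^esub>
               frag_extend (\<lambda>(x, y). frag_of (x, f y)) c)"

text \<open>Tensoring with \<open>M\<close> preserves injectivity.  Again the carriers of \<open>N'\<close> and \<open>N\<close> must have
  a fixed type; taking that of \<open>R\<close> loses nothing, since the inclusions of ideals into
  \<open>R\<close> suffice to test flatness.\<close>

definition flat_module :: "('a, 'x) ring_scheme \<Rightarrow> ('a, 'm) module \<Rightarrow> bool" where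
  "flat_module R M \<longleftrightarrow> module R M \<and>
     (\<forall>(N' :: ('a, 'a) module) (N :: ('a, 'a) module).
        module R N' \<longrightarrow> module R N \<longrightarrow>
        (\<forall>f\<in>module_hom R N' N. inj_on f (carrier N') \<longrightarrow>
           inj_on (tensor_map R M N f) (carrier (tensor_product R M N'))))"

definition G_GCD_ring :: "('a, 'x) ring_scheme \<Rightarrow> bool" where
  "G_GCD_ring R \<longleftrightarrow> cring R
     \<and> (\<forall>a\<in>carrier R. projective_module R (ideal_module R (PIdl\<^bsub>R\<^esub> a)))
     \<and> (\<forall>I J. fin_gen_ideal R I \<and> flat_module R (ideal_module R I)
            \<and> fin_gen_ideal R J \<and> flat_module R (ideal_module R J)
          \<longrightarrow> fin_gen_ideal R (I \<inter> J) \<and> flat_module R (ideal_module R (I \<inter> J)))"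

text \<open>Elements are the finitely supported functions \<open>carrier G \<rightarrow> carrier R\<close>, extended by
  \<open>\<zero>\<close> outside \<open>carrier G\<close>; the multiplication is convolution.\<close>

definition group_ring ::
  "('a, 'x) ring_scheme \<Rightarrow> ('g, 'y) monoid_scheme \<Rightarrow> ('g \<Rightarrow> 'a) ring" where
  "group_ring R G = \<lparr>
     carrier = {f. (\<forall>x. f x \<in> carrier R) \<and> (\<forall>x. x \<notin> carrier G \<longrightarrow> f x = \<zero>\<^bsub>R\<^esub>)
                   \<and> finite {x. f x \<noteq> \<zero>\<^bsub>R\<^esub>}},
     monoid.mult = (\<lambda>f g x. if x \<in> carrier G
               then \<Oplus>\<^bsub>R\<^esub>y\<in>{y. f y \<noteq> \<zero>\<^bsub>R\<^esub>}. f y \<otimes>\<^bsub>R\<^esub> g (inv\<^bsub>G\<^esub> y \<otimes>\<^bsub>G\<^esub> x)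
               else \<zero>\<^bsub>R\<^esub>),
     one = (\<lambda>x. if x = \<one>\<^bsub>G\<^esub> then \<one>\<^bsub>R\<^esub> else \<zero>\<^bsub>R\<^esub>),
     ring.zero = (\<lambda>x. \<zero>\<^bsub>R\<^esub>),
     add = (\<lambda>f g x. f x \<oplus>\<^bsub>R\<^esub> g x)\<rparr>"

lemma ideal_module_module:
  assumes "cring R" "ideal I R"
  shows "module R (ideal_module R I)"
proof -
  interpret cring R by fact
  interpret I: ideal I R by fact
  have sub: "x \<in> I \<Longrightarrow> x \<in> carrier R" for x using I.a_subset by blast
  show ?thesis
  proof (rule moduleI)
    show "abelian_group (ideal_module R I)"
    proof (rule abelian_groupI)
      fix x assume "x \<in> carrier (ideal_module R I)"
      then show "\<exists>y\<in>carrier (ideal_module R I).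
          y \<oplus>\<^bsub>ideal_module R I\<^esub> x = \<zero>\<^bsub>ideal_module R I\<^esub>"
        by (intro bexI[of _ "\<ominus>\<^bsub>R\<^esub> x"]) (simp_all add: ideal_module_def sub l_neg)
    qed (simp_all add: ideal_module_def sub a_ac)
  qed (auto simp: ideal_module_def sub I.I_l_closed l_distr r_distr m_assoc is_cring)
qed

context
  fixes R (structure) and G :: "('g, 'y) monoid_scheme"
  assumes R: "cring R" and G: "comm_group G"
begin

interpretation R: cring R by (rule R)
interpretation G: comm_group G by (rule G)

abbreviation (input) RG where "RG \<equiv> group_ring R G"

lemma group_ring_mult_eq:
  assumes f: "f \<in> carrier RG" and g: "g \<in> carrier RG" and x: "x \<in> carrier G"
    and A: "finite A" "{y. f y \<noteq> \<zero>} \<subseteq> A" "A \<subseteq> carrier G"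
  shows "(f \<otimes>\<^bsub>RG\<^esub> g) x = (\<Oplus>y\<in>A. f y \<otimes> g (inv\<^bsub>G\<^esub> y \<otimes>\<^bsub>G\<^esub> x))"
proof -
  have "(\<Oplus>y\<in>{y. f y \<noteq> \<zero>}. f y \<otimes> g (inv\<^bsub>G\<^esub> y \<otimes>\<^bsub>G\<^esub> x)) = (\<Oplus>y\<in>A. f y \<otimes> g (inv\<^bsub>G\<^esub> y \<otimes>\<^bsub>G\<^esub> x))"
    by (rule R.add.finprod_mono_neutral_cong_left) (use f g A in \<open>auto simp: group_ring_def\<close>)
  then show ?thesis using x by (simp add: group_ring_def)
qed

lemma finsum_exchange:
  assumes "finite A" "finite B" "\<And>x y. x \<in> A \<Longrightarrow> y \<in> B \<Longrightarrow> h x y \<in> carrier R"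
  shows "(\<Oplus>x\<in>A. \<Oplus>y\<in>B. h x y) = (\<Oplus>y\<in>B. \<Oplus>x\<in>A. h x y)"
  using assms(1,3)
proof (induction A)
  case empty
  then show ?case by simp
next
  case (insert a A)
  have "(\<Oplus>x\<in>insert a A. \<Oplus>y\<in>B. h x y) = (\<Oplus>y\<in>B. h a y) \<oplus> (\<Oplus>y\<in>B. \<Oplus>x\<in>A. h x y)"
    using insert by (subst R.finsum_insert) auto
  also have "\<dots> = (\<Oplus>y\<in>B. h a y \<oplus> (\<Oplus>x\<in>A. h x y))"
    using insert by (subst R.finsum_addf) auto
  also have "\<dots> = (\<Oplus>y\<in>B. \<Oplus>x\<in>insert a A. h x y)"
    using insert by (intro R.finsum_cong') (auto simp: R.finsum_insert)
  finally show ?case .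
qed

lemma group_ring_carrierD:
  assumes "f \<in> carrier RG"
  shows "f x \<in> carrier R" "finite {x. f x \<noteq> \<zero>}" "{x. f x \<noteq> \<zero>} \<subseteq> carrier G"
    "x \<notin> carrier G \<Longrightarrow> f x = \<zero>"
  using assms by (auto simp: group_ring_def)

lemma group_ring_mult_closed:
  assumes f: "f \<in> carrier RG" and g: "g \<in> carrier RG"
  shows "f \<otimes>\<^bsub>RG\<^esub> g \<in> carrier RG"
proof -
  note fD = group_ring_carrierD[OF f] and gD = group_ring_carrierD[OF g]
  let ?S = "(\<lambda>(y, z). y \<otimes>\<^bsub>G\<^esub> z) ` ({y. f y \<noteq> \<zero>} \<times> {z. g z \<noteq> \<zero>})"
  have "(f \<otimes>\<^bsub>RG\<^esub> g) x \<in> carrier R" for x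
    using fD gD by (auto simp: group_ring_def)
  moreover have "(f \<otimes>\<^bsub>RG\<^esub> g) x = \<zero>" if "x \<notin> carrier G" for x
    using that by (simp add: group_ring_def)
  moreover have "{x. (f \<otimes>\<^bsub>RG\<^esub> g) x \<noteq> \<zero>} \<subseteq> ?S"
  proof (rule ccontr)
    assume "\<not> ?thesis"
    then obtain x where x: "(f \<otimes>\<^bsub>RG\<^esub> g) x \<noteq> \<zero>" "x \<notin> ?S" by blast
    then have xG: "x \<in> carrier G" by (auto simp: group_ring_def split: if_splits)
    have "f y \<otimes> g (inv\<^bsub>G\<^esub> y \<otimes>\<^bsub>G\<^esub> x) = \<zero>" if y: "f y \<noteq> \<zero>" for y
    proof (rule ccontr)
      assume n: "f y \<otimes> g (inv\<^bsub>G\<^esub> y \<otimes>\<^bsub>G\<^esub> x) \<noteq> \<zero>"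
      have yG: "y \<in> carrier G" using y fD by blast
      have "g (inv\<^bsub>G\<^esub> y \<otimes>\<^bsub>G\<^esub> x) \<noteq> \<zero>" using n fD by auto
      moreover have "x = y \<otimes>\<^bsub>G\<^esub> (inv\<^bsub>G\<^esub> y \<otimes>\<^bsub>G\<^esub> x)" using yG xG by (simp add: G.m_assoc[symmetric])
      ultimately have "x \<in> ?S" using y by force
      then show False using x by simp
    qed
    then have "(\<Oplus>y\<in>{y. f y \<noteq> \<zero>}. f y \<otimes> g (inv\<^bsub>G\<^esub> y \<otimes>\<^bsub>G\<^esub> x)) = \<zero>"
      by (intro R.add.finprod_one_eqI) auto
    then show False using x xG by (simp add: group_ring_def)
  qed
  then have "finite {x. (f \<otimes>\<^bsub>RG\<^esub> g) x \<noteq> \<zero>}"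
    by (rule finite_subset) (use fD gD in auto)
  ultimately show ?thesis by (simp add: group_ring_def)
qed

lemma group_ring_mult_comm:
  assumes f: "f \<in> carrier RG" and g: "g \<in> carrier RG"
  shows "f \<otimes>\<^bsub>RG\<^esub> g = g \<otimes>\<^bsub>RG\<^esub> f"
proof
  fix x
  note fD = group_ring_carrierD[OF f] and gD = group_ring_carrierD[OF g]
  show "(f \<otimes>\<^bsub>RG\<^esub> g) x = (g \<otimes>\<^bsub>RG\<^esub> f) x"
  proof (cases "x \<in> carrier G")
    case False
    then show ?thesis by (simp add: group_ring_def)
  next
    case x: True
    define t where "t = (\<lambda>z. inv\<^bsub>G\<^esub> z \<otimes>\<^bsub>G\<^esub> x)"
    have tt: "t (t z) = z" if "z \<in> carrier G" for z
    proof -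
      have "inv\<^bsub>G\<^esub> x \<otimes>\<^bsub>G\<^esub> z \<otimes>\<^bsub>G\<^esub> x = z"
        using that x by (simp add: G.m_comm[of "inv\<^bsub>G\<^esub> x" z] G.m_assoc)
      then show ?thesis
        using that x by (simp add: t_def G.inv_mult_group)
    qed
    have tc: "t z \<in> carrier G" if "z \<in> carrier G" for z using that x by (simp add: t_def)
    define B where "B = {z. g z \<noteq> \<zero>} \<union> t ` {y. f y \<noteq> \<zero>}"
    have B: "finite B" "{z. g z \<noteq> \<zero>} \<subseteq> B" "B \<subseteq> carrier G"
      using fD gD tc by (auto simp: B_def)
    have inj: "inj_on t B" using B tt by (intro inj_on_inverseI[of _ t]) auto
    have tB: "finite (t ` B)" "t ` B \<subseteq> carrier G" using B tc by auto
    have "{y. f y \<noteq> \<zero>} \<subseteq> t ` B"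
    proof
      fix y assume "y \<in> {y. f y \<noteq> \<zero>}"
      then have "t y \<in> B" "y = t (t y)" using tt fD by (auto simp: B_def)
      then show "y \<in> t ` B" by blast
    qed
    then have "(f \<otimes>\<^bsub>RG\<^esub> g) x = (\<Oplus>y\<in>t ` B. f y \<otimes> g (t y))"
      using group_ring_mult_eq[OF f g x tB(1) _ tB(2)] by (simp add: t_def)
    also have "\<dots> = (\<Oplus>z\<in>B. f (t z) \<otimes> g (t (t z)))"
      by (rule R.finsum_reindex) (use inj fD gD in auto)
    also have "\<dots> = (\<Oplus>z\<in>B. g z \<otimes> f (t z))"
    proof (rule R.finsum_cong')
      fix z assume "z \<in> B"
      then have "t (t z) = z" using B tt by blast
      then show "f (t z) \<otimes> g (t (t z)) = g z \<otimes> f (t z)" using fD gD by (simp add: R.m_comm)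
    qed (use fD gD in auto)
    also have "\<dots> = (g \<otimes>\<^bsub>RG\<^esub> f) x"
      using group_ring_mult_eq[OF g f x B] by (simp add: t_def)
    finally show ?thesis .
  qed
qed

lemma group_ring_mult_assoc:
  assumes f: "f \<in> carrier RG" and g: "g \<in> carrier RG" and h: "h \<in> carrier RG"
  shows "(f \<otimes>\<^bsub>RG\<^esub> g) \<otimes>\<^bsub>RG\<^esub> h = f \<otimes>\<^bsub>RG\<^esub> (g \<otimes>\<^bsub>RG\<^esub> h)"
proof
  fix x
  note fD = group_ring_carrierD[OF f] and gD = group_ring_carrierD[OF g]
    and hD = group_ring_carrierD[OF h]
  have fg: "f \<otimes>\<^bsub>RG\<^esub> g \<in> carrier RG" and gh: "g \<otimes>\<^bsub>RG\<^esub> h \<in> carrier RG"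
    using f g h group_ring_mult_closed by auto
  note fgD = group_ring_carrierD[OF fg] and ghD = group_ring_carrierD[OF gh]
  show "((f \<otimes>\<^bsub>RG\<^esub> g) \<otimes>\<^bsub>RG\<^esub> h) x = (f \<otimes>\<^bsub>RG\<^esub> (g \<otimes>\<^bsub>RG\<^esub> h)) x"
  proof (cases "x \<in> carrier G")
    case False
    then show ?thesis by (simp add: group_ring_def)
  next
    case x: True
    define A where "A = {y. f y \<noteq> \<zero>}"
    have A: "finite A" "{y. f y \<noteq> \<zero>} \<subseteq> A" "A \<subseteq> carrier G" using fD by (auto simp: A_def)
    define C where "C = {w. (f \<otimes>\<^bsub>RG\<^esub> g) w \<noteq> \<zero>} \<union>
      (\<lambda>(y, z). y \<otimes>\<^bsub>G\<^esub> z) ` (A \<times> {z. g z \<noteq> \<zero>})"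
    have "finite C" using A gD fgD by (auto simp: C_def)
    moreover have CG: "C \<subseteq> carrier G" using A gD fgD by (auto simp: C_def)
    ultimately have C: "finite C" "{w. (f \<otimes>\<^bsub>RG\<^esub> g) w \<noteq> \<zero>} \<subseteq> C" "C \<subseteq> carrier G"
      by (auto simp: C_def)
    have inner: "(\<Oplus>w\<in>C. g (inv\<^bsub>G\<^esub> y \<otimes>\<^bsub>G\<^esub> w) \<otimes> h (inv\<^bsub>G\<^esub> w \<otimes>\<^bsub>G\<^esub> x))
        = (g \<otimes>\<^bsub>RG\<^esub> h) (inv\<^bsub>G\<^esub> y \<otimes>\<^bsub>G\<^esub> x)" if yA: "y \<in> A" for y
    proof -
      have y: "y \<in> carrier G" using yA A by auto
      define m where "m = (\<lambda>w. inv\<^bsub>G\<^esub> y \<otimes>\<^bsub>G\<^esub> w)"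
      have inj: "inj_on m C" using C y by (auto simp: m_def inj_on_def subset_iff)
      have mC: "finite (m ` C)" "m ` C \<subseteq> carrier G" using C y by (auto simp: m_def)
      have supp: "{z. g z \<noteq> \<zero>} \<subseteq> m ` C"
      proof
        fix z assume z: "z \<in> {z. g z \<noteq> \<zero>}"
        then have zG: "z \<in> carrier G" using gD by auto
        have "y \<otimes>\<^bsub>G\<^esub> z \<in> C" using z yA by (force simp: C_def)
        moreover have "z = m (y \<otimes>\<^bsub>G\<^esub> z)" using zG y by (simp add: m_def G.m_assoc[symmetric])
        ultimately show "z \<in> m ` C" by blast
      qed
      have yx: "inv\<^bsub>G\<^esub> y \<otimes>\<^bsub>G\<^esub> x \<in> carrier G" using x y by simp
      have "(g \<otimes>\<^bsub>RG\<^esub> h) (inv\<^bsub>G\<^esub> y \<otimes>\<^bsub>G\<^esub> x)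
          = (\<Oplus>z\<in>m ` C. g z \<otimes> h (inv\<^bsub>G\<^esub> z \<otimes>\<^bsub>G\<^esub> (inv\<^bsub>G\<^esub> y \<otimes>\<^bsub>G\<^esub> x)))"
        by (rule group_ring_mult_eq[OF g h yx mC(1) supp mC(2)])
      also have "\<dots> = (\<Oplus>w\<in>C. g (m w) \<otimes> h (inv\<^bsub>G\<^esub> (m w) \<otimes>\<^bsub>G\<^esub> (inv\<^bsub>G\<^esub> y \<otimes>\<^bsub>G\<^esub> x)))"
        by (rule R.finsum_reindex) (use inj gD hD in auto)
      also have "\<dots> = (\<Oplus>w\<in>C. g (inv\<^bsub>G\<^esub> y \<otimes>\<^bsub>G\<^esub> w) \<otimes> h (inv\<^bsub>G\<^esub> w \<otimes>\<^bsub>G\<^esub> x))"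
      proof (rule R.finsum_cong')
        fix w assume "w \<in> C"
        then have w: "w \<in> carrier G" using C by auto
        have "y \<otimes>\<^bsub>G\<^esub> (inv\<^bsub>G\<^esub> y \<otimes>\<^bsub>G\<^esub> x) = x"
          using y x by (simp add: G.m_assoc[symmetric])
        then have "inv\<^bsub>G\<^esub> (m w) \<otimes>\<^bsub>G\<^esub> (inv\<^bsub>G\<^esub> y \<otimes>\<^bsub>G\<^esub> x) = inv\<^bsub>G\<^esub> w \<otimes>\<^bsub>G\<^esub> x"
          using w y x by (simp add: m_def G.inv_mult_group G.m_assoc)
        then show "g (m w) \<otimes> h (inv\<^bsub>G\<^esub> (m w) \<otimes>\<^bsub>G\<^esub> (inv\<^bsub>G\<^esub> y \<otimes>\<^bsub>G\<^esub> x))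
            = g (inv\<^bsub>G\<^esub> y \<otimes>\<^bsub>G\<^esub> w) \<otimes> h (inv\<^bsub>G\<^esub> w \<otimes>\<^bsub>G\<^esub> x)" by (simp add: m_def)
      qed (use gD hD in auto)
      finally show ?thesis by simp
    qed
    have "((f \<otimes>\<^bsub>RG\<^esub> g) \<otimes>\<^bsub>RG\<^esub> h) x
        = (\<Oplus>w\<in>C. (f \<otimes>\<^bsub>RG\<^esub> g) w \<otimes> h (inv\<^bsub>G\<^esub> w \<otimes>\<^bsub>G\<^esub> x))"
      by (rule group_ring_mult_eq[OF fg h x C])
    also have "\<dots> = (\<Oplus>w\<in>C. \<Oplus>y\<in>A. f y \<otimes> (g (inv\<^bsub>G\<^esub> y \<otimes>\<^bsub>G\<^esub> w) \<otimes> h (inv\<^bsub>G\<^esub> w \<otimes>\<^bsub>G\<^esub> x)))"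
    proof (rule R.finsum_cong')
      fix w assume "w \<in> C"
      then have w: "w \<in> carrier G" using C by auto
      have "(f \<otimes>\<^bsub>RG\<^esub> g) w \<otimes> h (inv\<^bsub>G\<^esub> w \<otimes>\<^bsub>G\<^esub> x)
          = (\<Oplus>y\<in>A. f y \<otimes> g (inv\<^bsub>G\<^esub> y \<otimes>\<^bsub>G\<^esub> w) \<otimes> h (inv\<^bsub>G\<^esub> w \<otimes>\<^bsub>G\<^esub> x))"
        unfolding group_ring_mult_eq[OF f g w A]
        by (rule R.finsum_ldistr) (use A fD gD hD in auto)
      also have "\<dots> = (\<Oplus>y\<in>A. f y \<otimes> (g (inv\<^bsub>G\<^esub> y \<otimes>\<^bsub>G\<^esub> w) \<otimes> h (inv\<^bsub>G\<^esub> w \<otimes>\<^bsub>G\<^esub> x)))"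
        by (rule R.finsum_cong') (use fD gD hD in \<open>auto simp: R.m_assoc\<close>)
      finally show "(f \<otimes>\<^bsub>RG\<^esub> g) w \<otimes> h (inv\<^bsub>G\<^esub> w \<otimes>\<^bsub>G\<^esub> x) = \<dots>" .
    qed (use fD gD hD in auto)
    also have "\<dots> = (\<Oplus>y\<in>A. \<Oplus>w\<in>C. f y \<otimes> (g (inv\<^bsub>G\<^esub> y \<otimes>\<^bsub>G\<^esub> w) \<otimes> h (inv\<^bsub>G\<^esub> w \<otimes>\<^bsub>G\<^esub> x)))"
      by (rule finsum_exchange) (use A C fD gD hD in auto)
    also have "\<dots> = (\<Oplus>y\<in>A. f y \<otimes> (g \<otimes>\<^bsub>RG\<^esub> h) (inv\<^bsub>G\<^esub> y \<otimes>\<^bsub>G\<^esub> x))"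
    proof (rule R.finsum_cong')
      fix y assume y: "y \<in> A"
      have "(\<Oplus>w\<in>C. f y \<otimes> (g (inv\<^bsub>G\<^esub> y \<otimes>\<^bsub>G\<^esub> w) \<otimes> h (inv\<^bsub>G\<^esub> w \<otimes>\<^bsub>G\<^esub> x)))
          = f y \<otimes> (\<Oplus>w\<in>C. g (inv\<^bsub>G\<^esub> y \<otimes>\<^bsub>G\<^esub> w) \<otimes> h (inv\<^bsub>G\<^esub> w \<otimes>\<^bsub>G\<^esub> x))"
        by (rule R.finsum_rdistr[symmetric]) (use C fD gD hD in auto)
      then show "(\<Oplus>w\<in>C. f y \<otimes> (g (inv\<^bsub>G\<^esub> y \<otimes>\<^bsub>G\<^esub> w) \<otimes> h (inv\<^bsub>G\<^esub> w \<otimes>\<^bsub>G\<^esub> x)))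
          = f y \<otimes> (g \<otimes>\<^bsub>RG\<^esub> h) (inv\<^bsub>G\<^esub> y \<otimes>\<^bsub>G\<^esub> x)" using inner[OF y] by simp
    qed (use fD ghD in auto)
    also have "\<dots> = (f \<otimes>\<^bsub>RG\<^esub> (g \<otimes>\<^bsub>RG\<^esub> h)) x"
      by (rule group_ring_mult_eq[OF f gh x A, symmetric])
    finally show ?thesis .
  qed
qed

lemma group_ring_cring: "cring (group_ring R G)"
proof (rule cringI)
  show "abelian_group RG"
  proof (rule abelian_groupI)
    fix f g assume f: "f \<in> carrier RG" and g: "g \<in> carrier RG"
    note fD = group_ring_carrierD[OF f] and gD = group_ring_carrierD[OF g]
    have "finite {x. f x \<oplus> g x \<noteq> \<zero>}"
      by (rule finite_subset[of _ "{x. f x \<noteq> \<zero>} \<union> {x. g x \<noteq> \<zero>}"]) (use fD gD in auto)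
    then show "f \<oplus>\<^bsub>RG\<^esub> g \<in> carrier RG"
      using fD gD by (auto simp: group_ring_def)
    show "f \<oplus>\<^bsub>RG\<^esub> g = g \<oplus>\<^bsub>RG\<^esub> f"
      using fD gD by (auto simp: group_ring_def R.a_comm)
    show "\<zero>\<^bsub>RG\<^esub> \<oplus>\<^bsub>RG\<^esub> f = f"
      using fD by (auto simp: group_ring_def)
    have "(\<lambda>x. \<ominus> f x) \<in> carrier RG"
      using fD by (auto simp: group_ring_def)
    moreover have "(\<lambda>x. \<ominus> f x) \<oplus>\<^bsub>RG\<^esub> f = \<zero>\<^bsub>RG\<^esub>"
      using fD by (auto simp: group_ring_def R.l_neg)
    ultimately show "\<exists>y\<in>carrier RG. y \<oplus>\<^bsub>RG\<^esub> f = \<zero>\<^bsub>RG\<^esub>" by blast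
    fix h assume h: "h \<in> carrier RG"
    show "f \<oplus>\<^bsub>RG\<^esub> g \<oplus>\<^bsub>RG\<^esub> h = f \<oplus>\<^bsub>RG\<^esub> (g \<oplus>\<^bsub>RG\<^esub> h)"
      using fD gD group_ring_carrierD[OF h] by (auto simp: group_ring_def R.a_assoc)
  qed (simp add: group_ring_def)
  have one: "\<one>\<^bsub>RG\<^esub> \<in> carrier RG"
    by (auto simp: group_ring_def)
  show "Group.comm_monoid RG"
  proof (rule comm_monoidI)
    fix f assume f: "f \<in> carrier RG"
    note fD = group_ring_carrierD[OF f]
    show "\<one>\<^bsub>RG\<^esub> \<otimes>\<^bsub>RG\<^esub> f = f"
    proof
      fix x
      show "(\<one>\<^bsub>RG\<^esub> \<otimes>\<^bsub>RG\<^esub> f) x = f x"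
      proof (cases "x \<in> carrier G")
        case False
        then show ?thesis using fD by (simp add: group_ring_def)
      next
        case True
        have "(\<one>\<^bsub>RG\<^esub> \<otimes>\<^bsub>RG\<^esub> f) x
            = (\<Oplus>y\<in>{\<one>\<^bsub>G\<^esub>}. \<one>\<^bsub>RG\<^esub> y \<otimes> f (inv\<^bsub>G\<^esub> y \<otimes>\<^bsub>G\<^esub> x))"
          by (rule group_ring_mult_eq[OF one f True]) (auto simp: group_ring_def)
        then show ?thesis using True fD by (simp add: group_ring_def)
      qed
    qed
  qed (use one group_ring_mult_closed group_ring_mult_assoc group_ring_mult_comm in auto)
  fix f g h assume f: "f \<in> carrier RG" and g: "g \<in> carrier RG" and h: "h \<in> carrier RG"
  note fD = group_ring_carrierD[OF f] and gD = group_ring_carrierD[OF g]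
    and hD = group_ring_carrierD[OF h]
  show "(f \<oplus>\<^bsub>RG\<^esub> g) \<otimes>\<^bsub>RG\<^esub> h = f \<otimes>\<^bsub>RG\<^esub> h \<oplus>\<^bsub>RG\<^esub> g \<otimes>\<^bsub>RG\<^esub> h"
  proof
    fix x
    define A where "A = {y. f y \<noteq> \<zero>} \<union> {y. g y \<noteq> \<zero>}"
    have A: "finite A" "A \<subseteq> carrier G" "{y. f y \<noteq> \<zero>} \<subseteq> A" "{y. g y \<noteq> \<zero>} \<subseteq> A"
      using fD gD by (auto simp: A_def)
    have sA: "{y. (f \<oplus>\<^bsub>RG\<^esub> g) y \<noteq> \<zero>} \<subseteq> A" using fD gD by (auto simp: group_ring_def A_def)
    have fg: "f \<oplus>\<^bsub>RG\<^esub> g \<in> carrier RG"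
      using sA A fD gD finite_subset[OF sA A(1)] by (auto simp: group_ring_def)
    show "((f \<oplus>\<^bsub>RG\<^esub> g) \<otimes>\<^bsub>RG\<^esub> h) x = (f \<otimes>\<^bsub>RG\<^esub> h \<oplus>\<^bsub>RG\<^esub> g \<otimes>\<^bsub>RG\<^esub> h) x"
    proof (cases "x \<in> carrier G")
      case False
      then show ?thesis by (simp add: group_ring_def)
    next
      case x: True
      have "((f \<oplus>\<^bsub>RG\<^esub> g) \<otimes>\<^bsub>RG\<^esub> h) x
          = (\<Oplus>y\<in>A. (f y \<oplus> g y) \<otimes> h (inv\<^bsub>G\<^esub> y \<otimes>\<^bsub>G\<^esub> x))"
        using group_ring_mult_eq[OF fg h x A(1) sA A(2)] by (simp add: group_ring_def)
      also have "\<dots> = (\<Oplus>y\<in>A. f y \<otimes> h (inv\<^bsub>G\<^esub> y \<otimes>\<^bsub>G\<^esub> x) \<oplus> g y \<otimes> h (inv\<^bsub>G\<^esub> y \<otimes>\<^bsub>G\<^esub> x))"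
        by (rule R.finsum_cong') (use fD gD hD in \<open>auto simp: R.l_distr\<close>)
      also have "\<dots> = (f \<otimes>\<^bsub>RG\<^esub> h) x \<oplus> (g \<otimes>\<^bsub>RG\<^esub> h) x"
        unfolding group_ring_mult_eq[OF f h x A(1,3,2)] group_ring_mult_eq[OF g h x A(1,4,2)]
        by (rule R.finsum_addf) (use fD gD hD in auto)
      finally show ?thesis by (simp add: group_ring_def)
    qed
  qed
qed

end

end

theory Submission
  imports Defs "HOL-Computational_Algebra.Polynomial" "HOL-Library.Multiset_Order" "HOL-Library.Z2"
begin

text \<open>
  The group is cyclic of order two and the ring \<open>R\<close> is the ring of invariants of an involution on
  a polynomial ring.  If \<open>R\<close> has characteristic two and \<open>g\<close> generates the group, then \<open>\<epsilon> = 1 + g\<close>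
  satisfies \<open>\<epsilon>\<^sup>2 = 0\<close>, and the group ring is the ring of dual numbers \<open>R[\<epsilon>]\<close>.  For nonzero \<open>a\<close>, \<open>c\<close>
  without common factor and any \<open>e\<close>, a computation in \<open>R[\<epsilon>]\<close> shows that the intersection of the ideals
  generated by \<open>a\<^sup>2\<close> and \<open>a c + e \<epsilon>\<close> consists of the elements \<open>a\<^sup>2 (c t + y \<epsilon>)\<close> where \<open>e t - a y\<close>
  is a multiple of \<open>c\<close>.  So \<open>t\<close> runs through the colon ideal \<open>(a, c) : e\<close>, and if the intersection
  is finitely generated over \<open>R[\<epsilon>]\<close>, then that ideal is finitely generated over \<open>R\<close>
  (\<open>colon_ideal_fin_gen\<close>).  It remains to find a factorial domain of characteristic two in which
  a colon ideal of this kind is not finitely generated.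

  Let \<open>R\<close> consist of the polynomials over the field with two elements in variables \<open>u\<^sub>i\<close>, \<open>v\<^sub>i\<close>
  (\<open>i = 0, 1, 2, \<dots>\<close>) that are fixed by the involution exchanging every \<open>u\<^sub>i\<close> with \<open>v\<^sub>i\<close>.  It
  contains \<open>c\<^sub>i = u\<^sub>i + v\<^sub>i\<close> and \<open>p\<^sub>i\<^sub>j = u\<^sub>i v\<^sub>j + v\<^sub>i u\<^sub>j\<close>, and the identity
  \<open>p\<^sub>0\<^sub>1 c\<^sub>k = c\<^sub>0 p\<^sub>1\<^sub>k + c\<^sub>1 p\<^sub>0\<^sub>k\<close> (\<open>plucker\<close>) puts every \<open>c\<^sub>k\<close> into \<open>(c\<^sub>0, c\<^sub>1) : p\<^sub>0\<^sub>1\<close>.  On the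
  other hand no member of this colon ideal has a constant term (\<open>colon_no_constant_term\<close>), so an
  invariant combination of finitely many members has linear terms only in the finitely many
  variables that occur in the linear terms of these members.  Hence the ideal is not finitely
  generated (\<open>colon_not_fin_gen\<close>).

  The ring \<open>R\<close> is factorial because the polynomial ring is and because \<open>1\<close> is the only unit of the
  latter: a prime \<open>p\<close> of the polynomial ring is either fixed by the involution or not associated
  to its image \<open>p'\<close>, and the primes of \<open>R\<close> are the fixed \<open>p\<close> and the products \<open>p p'\<close>
  (\<open>factorial_invariant_ring\<close>).  Unique factorization in infinitely many variables reduces to finitely
  many, where it follows by induction from a version of Gauss's lemma for the polynomials with
  coefficients in a subring (\<open>irreducible_poly_prime\<close>).

  Every factorial domain is a G-GCD ring (\<open>G_GCD\<close>): a flat ideal contains the greatest common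
  divisor of any two of its elements (\<open>flat_ideal_cofactor\<close>), so a finitely generated flat ideal
  is principal; conversely principal ideals are projective and flat, and the intersection of two
  principal ideals is generated by a least common multiple.
\<close>

section \<open>Divisibility in factorial domains\<close>

lemma (in cring) ideal_of_closed:
  assumes "I \<subseteq> carrier R" "\<zero> \<in> I" "\<And>x y. x \<in> I \<Longrightarrow> y \<in> I \<Longrightarrow> x \<oplus> y \<in> I"
    and mult: "\<And>r x. r \<in> carrier R \<Longrightarrow> x \<in> I \<Longrightarrow> r \<otimes> x \<in> I"
  shows "ideal I R"
proof (rule idealI[OF ring_axioms])
  have "\<ominus> x \<in> I" if "x \<in> I" for x
  proof -
    have "\<ominus> x = \<ominus> \<one> \<otimes> x" using that assms(1) by (auto simp: l_minus)
    then show ?thesis using mult[of "\<ominus> \<one>" x] that by simp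
  qed
  then show "subgroup I (add_monoid R)"
    using assms by (intro add.subgroupI) (auto simp: a_inv_def)
  show "a \<in> I \<Longrightarrow> x \<in> carrier R \<Longrightarrow> x \<otimes> a \<in> I" for a x by (rule mult)
  show "a \<in> I \<Longrightarrow> x \<in> carrier R \<Longrightarrow> a \<otimes> x \<in> I" for a x
    using mult[of x a] m_comm[of a x] assms(1) by auto
qed

lemma (in cring) PIdl_zero: "PIdl \<zero> = {\<zero>}"
  unfolding cgenideal_def by (auto intro!: exI[of _ "\<one>"])

text \<open>
  Common multiples of two nonzero elements are the multiples of their least common multiple; the
  latter comes from the monoid of nonzero elements, so a zero generator is treated apart.
\<close>

lemma (in factorial_domain) inter_principal:
  assumes "a \<in> carrier R" "b \<in> carrier R"
  shows "\<exists>m\<in>carrier R. PIdl a \<inter> PIdl b = PIdl m"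
proof (cases "a = \<zero> \<or> b = \<zero>")
  case True
  then have "PIdl a \<inter> PIdl b = PIdl \<zero>"
    using assms by (force simp: cgenideal_def)
  then show ?thesis by blast
next
  case False
  obtain m where m: "m \<in> carrier R" "m \<noteq> \<zero>" "m lcmof\<^bsub>mult_of R\<^esub> a b"
    using lcmof_exists[of a b] False assms by auto
  have "PIdl a \<inter> PIdl b = PIdl m"
  proof (intro subset_antisym subsetI)
    fix y assume y: "y \<in> PIdl a \<inter> PIdl b"
    show "y \<in> PIdl m"
    proof (cases "y = \<zero>")
      case True
      then show ?thesis using m(1) unfolding cgenideal_def by (auto intro!: exI[of _ \<zero>])
    next
      case y0: False
      have yR: "y \<in> carrier R" using y assms by (auto simp: cgenideal_def)
      have "a divides\<^bsub>R\<^esub> y" "b divides\<^bsub>R\<^esub> y"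
        using y assms by (auto simp: cgenideal_def factor_def m_comm)
      then have "a divides\<^bsub>mult_of R\<^esub> y" "b divides\<^bsub>mult_of R\<^esub> y"
        using yR y0 assms by auto
      then have "m divides\<^bsub>mult_of R\<^esub> y" using m yR y0 by (auto simp: islcm_def)
      then show ?thesis using m(1) by (auto simp: factor_def cgenideal_def m_comm)
    qed
  next
    fix y assume "y \<in> PIdl m"
    then obtain r where r: "r \<in> carrier R" "y = r \<otimes> m" by (auto simp: cgenideal_def)
    have "a divides\<^bsub>mult_of R\<^esub> m" "b divides\<^bsub>mult_of R\<^esub> m" using m(3) by (simp_all add: islcm_def)
    then obtain s t where "s \<in> carrier (mult_of R)" "t \<in> carrier (mult_of R)"
      and st: "m = a \<otimes> s" "m = b \<otimes> t"
      unfolding factor_def mult_mult_of by blast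
    then have stR: "s \<in> carrier R" "t \<in> carrier R" by simp_all
    then have "y = (r \<otimes> s) \<otimes> a" "y = (r \<otimes> t) \<otimes> b"
      using st r assms by (simp_all add: m_assoc m_comm[of a s] m_comm[of b t])
    then show "y \<in> PIdl a \<inter> PIdl b"
      unfolding cgenideal_def using r(1) stR by blast
  qed
  then show ?thesis using m by blast
qed

text \<open>
  The element \<open>d\<close> is a greatest common divisor of \<open>x\<close> and \<open>y\<close>.  The last clause says that the
  cofactors have no common factor, in the form of a property of their syzygies, which is the only
  form needed for flatness.  Everything is read off from a least common multiple
  \<open>m = a x = b y\<close>.
\<close>

lemma (in factorial_domain) coprime_cofactors:
  assumes "x \<in> carrier R" "y \<in> carrier R" "x \<noteq> \<zero>" "y \<noteq> \<zero>"
  shows "\<exists>d\<in>carrier R. \<exists>a\<in>carrier R. \<exists>b\<in>carrier R. x = d \<otimes> b \<and> y = d \<otimes> a \<and>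
    (\<forall>r\<in>carrier R. \<forall>s\<in>carrier R. a \<otimes> r = b \<otimes> s \<longrightarrow> (\<exists>t\<in>carrier R. r = b \<otimes> t))"
proof -
  obtain m where m: "m \<in> carrier R" "PIdl x \<inter> PIdl y = PIdl m"
    using inter_principal assms by blast
  have common: "\<exists>t\<in>carrier R. z = t \<otimes> m"
    if "r \<in> carrier R" "s \<in> carrier R" "z = r \<otimes> x" "z = s \<otimes> y" for z r s
  proof -
    have "z \<in> PIdl x" "z \<in> PIdl y" unfolding cgenideal_def using that by blast+
    then have "z \<in> PIdl m" using m by blast
    then show ?thesis using m by (auto simp: cgenideal_def)
  qed
  have "m \<in> PIdl x \<inter> PIdl y" using m cgenideal_self by blast
  then obtain a b where ab: "a \<in> carrier R" "b \<in> carrier R" "m = a \<otimes> x" "m = b \<otimes> y"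
    by (auto simp: cgenideal_def)
  \<comment> \<open>the product \<open>x y\<close> is a common multiple, and its quotient by \<open>m\<close> divides both factors\<close>
  obtain d where d: "d \<in> carrier R" "x \<otimes> y = d \<otimes> m"
    using common[of y x "x \<otimes> y"] assms by (auto simp: m_comm)
  have "y \<otimes> x = (d \<otimes> a) \<otimes> x" using d ab assms by (simp add: m_assoc m_comm[of y x])
  then have y: "y = d \<otimes> a" using assms ab d by (simp add: m_rcancel)
  have "x \<otimes> y = (d \<otimes> b) \<otimes> y" using d ab assms by (simp add: m_assoc)
  then have x: "x = d \<otimes> b" using assms ab d by (simp add: m_rcancel)
  have "\<exists>t\<in>carrier R. r = b \<otimes> t"
    if rs: "r \<in> carrier R" "s \<in> carrier R" "a \<otimes> r = b \<otimes> s" for r s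
  proof -
    \<comment> \<open>a relation between the cofactors is a common multiple of \<open>x\<close> and \<open>y\<close>\<close>
    have "r \<otimes> y = s \<otimes> x"
    proof -
      have "r \<otimes> y = d \<otimes> (a \<otimes> r)" unfolding y using d(1) ab(1,2) rs(1) by (simp add: m_ac)
      also have "\<dots> = d \<otimes> (b \<otimes> s)" by (simp only: rs(3))
      also have "\<dots> = s \<otimes> x" unfolding x using d(1) ab(1,2) rs(2) by (simp add: m_ac)
      finally show ?thesis .
    qed
    then obtain t where t: "t \<in> carrier R" "r \<otimes> y = t \<otimes> m"
      using common[of s r "r \<otimes> y"] rs by auto
    note t(2)
    also have "t \<otimes> m = (b \<otimes> t) \<otimes> y" unfolding ab(4) using t(1) ab(2) assms(2) by (simp add: m_ac)
    finally have "r \<otimes> y = (b \<otimes> t) \<otimes> y" .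
    then show ?thesis using t ab rs assms by (auto simp: m_rcancel)
  qed
  then show ?thesis using x y d ab by blast
qed

lemma (in cring) fin_gen_principal: "a \<in> carrier R \<Longrightarrow> fin_gen_ideal R (PIdl a)"
  unfolding fin_gen_ideal_def by (intro exI[of _ "{a}"]) (simp add: cgenideal_eq_genideal)

lemma (in factorial_domain) finite_conductor: "finite_conductor_ring R"
  unfolding finite_conductor_ring_def
proof (intro conjI ballI)
  fix a b assume "a \<in> carrier R" "b \<in> carrier R"
  then show "fin_gen_ideal R (PIdl a \<inter> PIdl b)"
    using inter_principal fin_gen_principal by metis
next
  fix c assume c: "c \<in> carrier R"
  show "fin_gen_ideal R {r \<in> carrier R. r \<otimes> c = \<zero>}"
  proof (cases "c = \<zero>")
    case True
    then have "{r \<in> carrier R. r \<otimes> c = \<zero>} = PIdl \<one>"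
      unfolding cgenideal_def by (auto intro: r_one[symmetric])
    then show ?thesis using fin_gen_principal by simp
  next
    case False
    then have "{r \<in> carrier R. r \<otimes> c = \<zero>} = PIdl \<zero>"
      using c by (auto simp: PIdl_zero integral_iff)
    then show ?thesis using fin_gen_principal by simp
  qed
qed (rule is_cring)


section \<open>Tensor products over a commutative ring\<close>

lemma ideal_module_simps [simp]:
  "carrier (ideal_module R I) = I"
  "x \<oplus>\<^bsub>ideal_module R I\<^esub> y = x \<oplus>\<^bsub>R\<^esub> y"
  "\<zero>\<^bsub>ideal_module R I\<^esub> = \<zero>\<^bsub>R\<^esub>"
  "r \<odot>\<^bsub>ideal_module R I\<^esub> y = r \<otimes>\<^bsub>R\<^esub> y"
  by (simp_all add: ideal_module_def)

lemma tensor_rels_carrier: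
  assumes "module R M" "module R N"
  shows "tensor_rels R M N \<subseteq> carrier (tensor_free M N)"
proof -
  interpret M: module R M by fact
  interpret N: module R N by fact
  have keys2: "Poly_Mapping.keys (frag_of p - frag_of q) \<subseteq> S" if "p \<in> S" "q \<in> S" for p q S
    using that keys_diff[of "frag_of p" "frag_of q"] by auto
  have keys3: "Poly_Mapping.keys (frag_of p - frag_of q - frag_of r) \<subseteq> S"
    if "p \<in> S" "q \<in> S" "r \<in> S" for p q r S
    using that keys_diff[of "frag_of p - frag_of q" "frag_of r"] keys2[of p S q] by auto
  show ?thesis
  proof
    fix z assume "z \<in> tensor_rels R M N"
    then consider
      x x' y where "x \<in> carrier M" "x' \<in> carrier M" "y \<in> carrier N"
        "z = frag_of (x \<oplus>\<^bsub>M\<^esub> x', y) - frag_of (x, y) - frag_of (x', y)" |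
      x y y' where "x \<in> carrier M" "y \<in> carrier N" "y' \<in> carrier N"
        "z = frag_of (x, y \<oplus>\<^bsub>N\<^esub> y') - frag_of (x, y) - frag_of (x, y')" |
      r x y where "r \<in> carrier R" "x \<in> carrier M" "y \<in> carrier N"
        "z = frag_of (r \<odot>\<^bsub>M\<^esub> x, y) - frag_of (x, r \<odot>\<^bsub>N\<^esub> y)"
      unfolding tensor_rels_def
      by (elim UnE CollectE exE conjE) (rule that; assumption)+
    then show "z \<in> carrier (tensor_free M N)"
      unfolding carrier_free_Abelian_group_iff
    proof cases
      case 1
      show "Poly_Mapping.keys z \<subseteq> carrier M \<times> carrier N"
        unfolding 1(4) by (rule keys3) (use 1 in auto)
    next
      case 2
      show "Poly_Mapping.keys z \<subseteq> carrier M \<times> carrier N"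
        unfolding 2(4) by (rule keys3) (use 2 in auto)
    next
      case 3
      show "Poly_Mapping.keys z \<subseteq> carrier M \<times> carrier N"
        unfolding 3(4) by (rule keys2) (use 3 in auto)
    qed
  qed
qed

lemma tensor_null_subgroup:
  assumes "module R M" "module R N"
  shows "subgroup (tensor_null R M N) (tensor_free M N)"
  unfolding tensor_null_def
  by (rule group.generate_is_subgroup[OF group_free_Abelian_group tensor_rels_carrier[OF assms]])

lemma tensor_null_zero:
  assumes "module R M" "module R N"
  shows "0 \<in> tensor_null R M N"
  using subgroup.one_closed[OF tensor_null_subgroup[OF assms]] by simp

lemma tensor_null_rel: "x \<in> tensor_rels R M N \<Longrightarrow> x \<in> tensor_null R M N"
  unfolding tensor_null_def by (rule generate.incl)

lemma tensor_null_closed: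
  assumes "module R M" "module R N" "x \<in> tensor_null R M N" "y \<in> tensor_null R M N"
  shows "x + y \<in> tensor_null R M N" "- x \<in> tensor_null R M N" "x - y \<in> tensor_null R M N"
proof -
  interpret subgroup "tensor_null R M N" "tensor_free M N"
    by (rule tensor_null_subgroup[OF assms(1,2)])
  have *: "a + b \<in> tensor_null R M N" if "a \<in> tensor_null R M N" "b \<in> tensor_null R M N" for a b
    using m_closed[OF that] by simp
  have "- a \<in> tensor_null R M N" if "a \<in> tensor_null R M N" for a
  proof -
    have keys: "Poly_Mapping.keys a \<subseteq> carrier M \<times> carrier N"
      using subsetD[OF subset that] unfolding carrier_free_Abelian_group_iff .
    show ?thesis using m_inv_closed[OF that] unfolding inv_free_Abelian_group[OF keys] .
  qed
  then show "- x \<in> tensor_null R M N" "x - y \<in> tensor_null R M N"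
    using assms *[of x "- y"] by simp_all
  show "x + y \<in> tensor_null R M N" using * assms by blast
qed

text \<open>
  The factor group is only ever used through differences lying in the subgroup of null elements.
\<close>

lemma tensor_coset_iff: "x \<in> tensor_null R M N #>\<^bsub>tensor_free M N\<^esub> c \<longleftrightarrow> x - c \<in> tensor_null R M N"
  unfolding r_coset_def by (auto simp: algebra_simps intro: bexI[of _ "x - c"])

lemma tensor_coset_eqI:
  assumes M: "module R M" "module R N" and c: "c - c' \<in> tensor_null R M N"
  shows "tensor_null R M N #>\<^bsub>tensor_free M N\<^esub> c = tensor_null R M N #>\<^bsub>tensor_free M N\<^esub> c'"
proof (rule Set.set_eqI)
  fix x
  have "x - c' = (x - c) + (c - c')" "x - c = (x - c') + - (c - c')" by simp_all
  then show "x \<in> tensor_null R M N #>\<^bsub>tensor_free M N\<^esub> c \<longleftrightarrow>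
      x \<in> tensor_null R M N #>\<^bsub>tensor_free M N\<^esub> c'"
    unfolding tensor_coset_iff using c tensor_null_closed[OF M] by metis
qed

lemma carrier_tensor_product:
  "carrier (tensor_product R M N) =
     {tensor_null R M N #>\<^bsub>tensor_free M N\<^esub> c | c. c \<in> carrier (tensor_free M N)}"
  by (auto simp: tensor_product_def FactGroup_def RCOSETS_def)

text \<open>
  This is the universal property of the tensor product in the form in which it is used below: an
  additive map on the free group that carries the bilinearity relations into \<open>K\<close> detects that an
  element is not null.
\<close>

lemma tensor_null_hom:
  assumes "group H" "subgroup K H" "h \<in> hom (tensor_free M N) H"
    and MN: "module R M" "module R N"
    and rels: "\<And>z. z \<in> tensor_rels R M N \<Longrightarrow> h z \<in> K" and z: "z \<in> tensor_null R M N"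
  shows "h z \<in> K"
proof -
  interpret h: group_hom "tensor_free M N" H h
    using assms by (intro group_hom.intro group_free_Abelian_group group_hom_axioms.intro)
  have "subgroup {z \<in> carrier (tensor_free M N). h z \<in> K} (tensor_free M N)"
  proof (rule group.subgroupI[OF group_free_Abelian_group])
    show "{z \<in> carrier (tensor_free M N). h z \<in> K} \<noteq> {}"
      using h.G.one_closed subgroup.one_closed[OF assms(2)] h.hom_one by force
  next
    fix x assume "x \<in> {z \<in> carrier (tensor_free M N). h z \<in> K}"
    then show "inv\<^bsub>tensor_free M N\<^esub> x \<in> {z \<in> carrier (tensor_free M N). h z \<in> K}"
      using subgroup.m_inv_closed[OF assms(2)] h.hom_inv[of x] h.G.inv_closed[of x] by simp
  next
    fix x y assume "x \<in> {z \<in> carrier (tensor_free M N). h z \<in> K}" "y \<in> {z \<in> carrier (tensor_free M N). h z \<in> K}"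
    then show "x \<otimes>\<^bsub>tensor_free M N\<^esub> y \<in> {z \<in> carrier (tensor_free M N). h z \<in> K}"
      using subgroup.m_closed[OF assms(2)] h.hom_mult[of x y] h.G.m_closed[of x y] by simp
  qed auto
  then have "tensor_null R M N \<subseteq> {z \<in> carrier (tensor_free M N). h z \<in> K}"
    unfolding tensor_null_def
    by (intro h.G.generate_subgroup_incl) (use rels tensor_rels_carrier[OF MN] in blast)+
  then show ?thesis using z by blast
qed

lemma tensor_null_rels:
  shows "x \<in> carrier M \<Longrightarrow> x' \<in> carrier M \<Longrightarrow> y \<in> carrier N \<Longrightarrow>
      frag_of (x \<oplus>\<^bsub>M\<^esub> x', y) - frag_of (x, y) - frag_of (x', y) \<in> tensor_null R M N"
    and "x \<in> carrier M \<Longrightarrow> y \<in> carrier N \<Longrightarrow> y' \<in> carrier N \<Longrightarrow>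
      frag_of (x, y \<oplus>\<^bsub>N\<^esub> y') - frag_of (x, y) - frag_of (x, y') \<in> tensor_null R M N"
    and "r \<in> carrier R \<Longrightarrow> x \<in> carrier M \<Longrightarrow> y \<in> carrier N \<Longrightarrow>
      frag_of (r \<odot>\<^bsub>M\<^esub> x, y) - frag_of (x, r \<odot>\<^bsub>N\<^esub> y) \<in> tensor_null R M N"
  by (rule tensor_null_rel, unfold tensor_rels_def, blast)+

text \<open>
  The map on generators sends relations to relations, hence null elements to null elements; so the
  union defining \<open>tensor_map\<close> is over equal cosets.
\<close>

lemma tensor_map_coset:
  assumes MN: "module R M" "module R N'" "module R N" and f: "f \<in> module_hom R N' N"
    and c: "c \<in> carrier (tensor_free M N')"
  shows "tensor_map R M N f (tensor_null R M N' #>\<^bsub>tensor_free M N'\<^esub> c)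
    = tensor_null R M N #>\<^bsub>tensor_free M N\<^esub> frag_extend (\<lambda>(x, y). frag_of (x, f y)) c"
proof -
  let ?F = "frag_extend (\<lambda>(x, y). frag_of (x, f y))"
  let ?P = "\<lambda>z. ?F z \<in> tensor_null R M N"
  have fc: "f y \<in> carrier N" if "y \<in> carrier N'" for y
    using f that by (auto simp: module_hom_def hom_def)
  have fadd: "f (y \<oplus>\<^bsub>N'\<^esub> y') = f y \<oplus>\<^bsub>N\<^esub> f y'" if "y \<in> carrier N'" "y' \<in> carrier N'" for y y'
    using f that by (auto simp: module_hom_def hom_def)
  have fsm: "f (r \<odot>\<^bsub>N'\<^esub> y) = r \<odot>\<^bsub>N\<^esub> f y" if "y \<in> carrier N'" "r \<in> carrier R" for r y
    using f that by (auto simp: module_hom_def)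
  have rels: "?F z \<in> tensor_rels R M N" if "z \<in> tensor_rels R M N'" for z
    using that unfolding tensor_rels_def
    by (elim UnE CollectE exE conjE; simp add: frag_extend_diff fadd fsm; use fc in blast)
  have null: "?F z \<in> tensor_null R M N" if "z \<in> tensor_null R M N'" for z
  proof -
    have "z \<in> generate (tensor_free M N') (tensor_rels R M N')" using that by (simp add: tensor_null_def)
    then show ?thesis
    proof induction
      case one
      have "0 \<in> tensor_null R M N"
      by (rule tensor_null_zero[OF MN(1,3)])
      then show ?case by simp
    next
      case (incl h)
      then show ?case using rels tensor_null_rel by blast
    next
      case (inv h)
      have "h \<in> carrier (tensor_free M N')" using tensor_rels_carrier[OF MN(1,2)] inv by blast
      then have "inv\<^bsub>tensor_free M N'\<^esub> h = - h"
        unfolding carrier_free_Abelian_group_iff by (rule inv_free_Abelian_group)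
      then show ?case
        using tensor_null_closed(2)[OF MN(1,3)] rels[OF inv] tensor_null_rel
        by (simp add: frag_extend_minus) blast
    next
      case (eng h1 h2)
      then show ?case using tensor_null_closed(1)[OF MN(1,3)] by (simp add: frag_extend_add)
    qed
  qed
  have self: "c \<in> tensor_null R M N' #>\<^bsub>tensor_free M N'\<^esub> c"
    using tensor_null_zero[OF MN(1,2)] by (simp add: tensor_coset_iff)
  have eq: "tensor_null R M N #>\<^bsub>tensor_free M N\<^esub> ?F c' = tensor_null R M N #>\<^bsub>tensor_free M N\<^esub> ?F c"
    if "c' \<in> tensor_null R M N' #>\<^bsub>tensor_free M N'\<^esub> c" for c'
    using that null[of "c' - c"] unfolding tensor_coset_iff
    by (intro tensor_coset_eqI[OF MN(1,3)]) (simp add: frag_extend_diff)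
  show ?thesis unfolding tensor_map_def using eq self by blast
qed

lemma free_Abelian_group_hom_diff:
  assumes "group H" "h \<in> hom (free_Abelian_group S) H"
    and "x \<in> carrier (free_Abelian_group S)" "y \<in> carrier (free_Abelian_group S)"
  shows "h (x - y) = h x \<otimes>\<^bsub>H\<^esub> inv\<^bsub>H\<^esub> h y"
proof -
  interpret h: group_hom "free_Abelian_group S" H h
    using assms by (intro group_hom.intro group_free_Abelian_group group_hom_axioms.intro)
  have y: "inv\<^bsub>free_Abelian_group S\<^esub> y = - y"
    using assms(4) unfolding carrier_free_Abelian_group_iff by (rule inv_free_Abelian_group)
  show ?thesis
    using h.hom_mult[OF assms(3) h.G.inv_closed[OF assms(4)]] h.hom_inv[OF assms(4)] by (simp add: y)
qed


section \<open>Factorial domains are G-GCD rings\<close>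

text \<open>
  A principal ideal of a domain is either zero or free of rank one, and \<open>\<kappa>\<close> is its coordinate.  For \<open>a = 0\<close> the zero
  coordinate makes the same linearity laws true, so that later arguments need no case distinction.
\<close>

lemma (in domain) principal_coordinate:
  assumes a: "a \<in> carrier R"
  shows "\<exists>\<kappa>. (\<forall>x\<in>PIdl a. \<kappa> x \<in> carrier R \<and> x = \<kappa> x \<otimes> a)
    \<and> (\<forall>x\<in>PIdl a. \<forall>y\<in>PIdl a. \<kappa> (x \<oplus> y) = \<kappa> x \<oplus> \<kappa> y)
    \<and> (\<forall>r\<in>carrier R. \<forall>x\<in>PIdl a. \<kappa> (r \<otimes> x) = r \<otimes> \<kappa> x)"
proof (cases "a = \<zero>")
  case True
  then show ?thesis by (intro exI[of _ "\<lambda>_. \<zero>"]) (simp add: PIdl_zero)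
next
  case False
  define \<kappa> where "\<kappa> x = (THE r. r \<in> carrier R \<and> x = r \<otimes> a)" for x
  have \<kappa>: "\<kappa> (r \<otimes> a) = r" if "r \<in> carrier R" for r
    unfolding \<kappa>_def by (rule the_equality) (use that a False m_rcancel in auto)
  have "\<kappa> (r \<otimes> a \<oplus> s \<otimes> a) = r \<oplus> s" if "r \<in> carrier R" "s \<in> carrier R" for r s
    using \<kappa>[of "r \<oplus> s"] that a by (simp add: l_distr)
  moreover have "\<kappa> (s \<otimes> (r \<otimes> a)) = s \<otimes> r" if "r \<in> carrier R" "s \<in> carrier R" for r s
    using \<kappa>[of "s \<otimes> r"] that a by (simp add: m_assoc)
  ultimately show ?thesis
    using \<kappa> by (intro exI[of _ \<kappa>]) (auto simp: cgenideal_def)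
qed

text \<open>
  The generator is lifted along the surjection, and the coordinate extends this choice linearly.
\<close>

lemma (in domain) projective_principal:
  assumes a: "a \<in> carrier R"
  shows "projective_module R (ideal_module R (PIdl a))"
  unfolding projective_module_def
proof (intro conjI allI impI ballI)
  show "module R (ideal_module R (PIdl a))"
    by (intro ideal_module_module is_cring cgenideal_ideal a)
  fix N :: "('a, 'a \<Rightarrow> 'a) module" and P :: "('a, 'a) module" and p g
  assume N: "module R N" and P: "module R P" and p: "p \<in> module_hom R N P"
    and g: "g \<in> module_hom R (ideal_module R (PIdl a)) P" and surj: "p ` carrier N = carrier P"
  interpret N: module R N by fact
  obtain \<kappa> where \<kappa>: "\<And>x. x \<in> PIdl a \<Longrightarrow> \<kappa> x \<in> carrier R" "\<And>x. x \<in> PIdl a \<Longrightarrow> x = \<kappa> x \<otimes> a"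
    "\<And>x y. x \<in> PIdl a \<Longrightarrow> y \<in> PIdl a \<Longrightarrow> \<kappa> (x \<oplus> y) = \<kappa> x \<oplus> \<kappa> y"
    "\<And>r x. r \<in> carrier R \<Longrightarrow> x \<in> PIdl a \<Longrightarrow> \<kappa> (r \<otimes> x) = r \<otimes> \<kappa> x"
    using principal_coordinate[OF a] by metis
  have aI: "a \<in> PIdl a" by (rule cgenideal_self[OF a])
  have "g a \<in> carrier P" using g aI by (auto simp: module_hom_def hom_def)
  then obtain n where n: "n \<in> carrier N" "p n = g a" using surj by (metis imageE)
  show "\<exists>h\<in>module_hom R (ideal_module R (PIdl a)) N. \<forall>x\<in>carrier (ideal_module R (PIdl a)). p (h x) = g x"
  proof (intro bexI ballI)
    fix x assume "x \<in> carrier (ideal_module R (PIdl a))"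
    then have x: "x \<in> PIdl a" by simp
    have "p (\<kappa> x \<odot>\<^bsub>N\<^esub> n) = \<kappa> x \<odot>\<^bsub>P\<^esub> g a" using p n \<kappa>(1)[OF x] by (auto simp: module_hom_def)
    also have "\<dots> = g (\<kappa> x \<otimes> a)" using g \<kappa>(1)[OF x] aI by (simp add: module_hom_def)
    finally show "p (\<kappa> x \<odot>\<^bsub>N\<^esub> n) = g x" using \<kappa>(2)[OF x] by simp
  next
    show "(\<lambda>x. \<kappa> x \<odot>\<^bsub>N\<^esub> n) \<in> module_hom R (ideal_module R (PIdl a)) N"
      using \<kappa>(1) n by (auto simp: module_hom_def hom_def \<kappa>(3,4) N.smult_l_distr N.smult_assoc1)
  qed
qed

text \<open>
  Let \<open>\<Psi>\<close> be the additive map \<open>aR \<otimes> L \<rightarrow> L\<close> with \<open>x \<otimes> y \<mapsto> \<kappa> x \<cdot> y\<close>.  Every \<open>z\<close> in \<open>aR \<otimes> L\<close> equals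
  \<open>a \<otimes> \<Psi> z\<close>, so \<open>\<Psi>\<close> is injective.  As it is natural in \<open>L\<close>, an injection \<open>N' \<rightarrow> N\<close> stays injective
  after tensoring with \<open>aR\<close>.
\<close>

lemma (in domain) flat_principal:
  assumes a: "a \<in> carrier R"
  shows "flat_module R (ideal_module R (PIdl a))"
  unfolding flat_module_def
proof (intro conjI allI impI ballI)
  let ?M = "ideal_module R (PIdl a)"
  show M: "module R ?M" by (intro ideal_module_module is_cring cgenideal_ideal a)
  fix N' N :: "('a, 'a) module" and f
  assume N': "module R N'" and N: "module R N" and f: "f \<in> module_hom R N' N"
    and inj: "inj_on f (carrier N')"
  interpret N': module R N' by fact
  interpret N: module R N by fact
  have fc: "f y \<in> carrier N" if "y \<in> carrier N'" for y
    using f that by (auto simp: module_hom_def hom_def)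
  have fhom: "f \<in> hom (add_monoid N') (add_monoid N)" using f by (simp add: module_hom_def)
  have aI: "a \<in> PIdl a" by (rule cgenideal_self[OF a])
  obtain \<kappa> where \<kappa>: "\<And>x. x \<in> PIdl a \<Longrightarrow> \<kappa> x \<in> carrier R" "\<And>x. x \<in> PIdl a \<Longrightarrow> x = \<kappa> x \<otimes> a"
    "\<And>x y. x \<in> PIdl a \<Longrightarrow> y \<in> PIdl a \<Longrightarrow> \<kappa> (x \<oplus> y) = \<kappa> x \<oplus> \<kappa> y"
    "\<And>r x. r \<in> carrier R \<Longrightarrow> x \<in> PIdl a \<Longrightarrow> \<kappa> (r \<otimes> x) = r \<otimes> \<kappa> x"
    using principal_coordinate[OF a] by metis
  let ?F = "frag_extend (\<lambda>(x, y). frag_of (x, f y))"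
  have ex: "\<exists>\<Psi>. \<Psi> \<in> hom (tensor_free ?M L) (add_monoid L) \<and>
      (\<forall>x\<in>PIdl a. \<forall>y\<in>carrier L. \<Psi> (frag_of (x, y)) = \<kappa> x \<odot>\<^bsub>L\<^esub> y)"
    if "module R L" for L :: "('a, 'a) module"
  proof -
    interpret L: module R L by fact
    have "(\<lambda>(x, y). \<kappa> x \<odot>\<^bsub>L\<^esub> y) ` (carrier ?M \<times> carrier L) \<subseteq> carrier (add_monoid L)"
      using \<kappa>(1) by auto
    then obtain \<Psi> where "\<Psi> \<in> hom (tensor_free ?M L) (add_monoid L)"
      "\<And>z. z \<in> carrier ?M \<times> carrier L \<Longrightarrow> \<Psi> (frag_of z) = (\<lambda>(x, y). \<kappa> x \<odot>\<^bsub>L\<^esub> y) z"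
      using comm_group.free_Abelian_group_universal[OF L.a_comm_group] by metis
    then show ?thesis by (intro exI[of _ \<Psi>]) auto
  qed
  obtain \<Psi>' where \<Psi>': "\<Psi>' \<in> hom (tensor_free ?M N') (add_monoid N')"
      "\<And>x y. x \<in> PIdl a \<Longrightarrow> y \<in> carrier N' \<Longrightarrow> \<Psi>' (frag_of (x, y)) = \<kappa> x \<odot>\<^bsub>N'\<^esub> y"
    using ex[OF N'] by blast
  obtain \<Psi> where \<Psi>: "\<Psi> \<in> hom (tensor_free ?M N) (add_monoid N)"
      "\<And>x y. x \<in> PIdl a \<Longrightarrow> y \<in> carrier N \<Longrightarrow> \<Psi> (frag_of (x, y)) = \<kappa> x \<odot>\<^bsub>N\<^esub> y"
    using ex[OF N] by blast
  have \<Psi>'_diff: "\<Psi>' (x - y) = \<Psi>' x \<ominus>\<^bsub>N'\<^esub> \<Psi>' y"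
    if "x \<in> carrier (tensor_free ?M N')" "y \<in> carrier (tensor_free ?M N')" for x y
    using free_Abelian_group_hom_diff[OF N'.a_group \<Psi>'(1) that] by (simp add: a_minus_def a_inv_def)
  have \<Psi>_diff: "\<Psi> (x - y) = \<Psi> x \<ominus>\<^bsub>N\<^esub> \<Psi> y"
    if "x \<in> carrier (tensor_free ?M N)" "y \<in> carrier (tensor_free ?M N)" for x y
    using free_Abelian_group_hom_diff[OF N.a_group \<Psi>(1) that] by (simp add: a_minus_def a_inv_def)
  have \<Psi>'_0: "\<Psi>' 0 = \<zero>\<^bsub>N'\<^esub>"
    using hom_one[OF \<Psi>'(1) group_free_Abelian_group N'.a_group] by simp
  have \<Psi>_0: "\<Psi> 0 = \<zero>\<^bsub>N\<^esub>"
    using hom_one[OF \<Psi>(1) group_free_Abelian_group N.a_group] by simp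
  have \<Psi>'_closed: "\<Psi>' x \<in> carrier N'" if "x \<in> carrier (tensor_free ?M N')" for x
    using \<Psi>'(1) that by (auto simp: hom_def)
  have f_0: "f \<zero>\<^bsub>N'\<^esub> = \<zero>\<^bsub>N\<^esub>"
    using hom_one[OF fhom N'.a_group N.a_group] by simp
  have f_diff: "f (x \<ominus>\<^bsub>N'\<^esub> y) = f x \<ominus>\<^bsub>N\<^esub> f y" if "x \<in> carrier N'" "y \<in> carrier N'" for x y
  proof -
    have "f (x \<ominus>\<^bsub>N'\<^esub> y) \<oplus>\<^bsub>N\<^esub> f y = f (x \<ominus>\<^bsub>N'\<^esub> y \<oplus>\<^bsub>N'\<^esub> y)"
      using f that by (auto simp: module_hom_def hom_def)
    also have "x \<ominus>\<^bsub>N'\<^esub> y \<oplus>\<^bsub>N'\<^esub> y = x"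
      using that by (simp add: a_minus_def N'.a_assoc N'.l_neg)
    finally show ?thesis using that fc by (metis N'.minus_closed N.add.inv_solve_right a_minus_def)
  qed
  \<comment> \<open>naturality of the coordinate map with respect to \<open>f\<close>\<close>
  have F: "?F z \<in> carrier (tensor_free ?M N) \<and> \<Psi> (?F z) = f (\<Psi>' z)"
    if z: "z \<in> carrier (tensor_free ?M N')" for z
    using z unfolding carrier_free_Abelian_group_iff
  proof (induction z rule: free_Abelian_group_induct[consumes 1, case_names zero diff one])
    case zero
    show ?case by (simp add: \<Psi>_0 \<Psi>'_0 f_0)
  next
    case (diff x y)
    have xy: "x \<in> carrier (tensor_free ?M N')" "y \<in> carrier (tensor_free ?M N')"
      unfolding carrier_free_Abelian_group_iff by (rule diff)+
    have "?F x - ?F y \<in> carrier (tensor_free ?M N)"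
      using diff keys_diff[of "?F x" "?F y"] unfolding carrier_free_Abelian_group_iff by blast
    then show ?case
      using diff \<Psi>_diff[of "?F x" "?F y"] \<Psi>'_diff[OF xy] f_diff[OF \<Psi>'_closed[OF xy(1)] \<Psi>'_closed[OF xy(2)]]
      unfolding frag_extend_diff carrier_free_Abelian_group_iff by simp
  next
    case (one p)
    then obtain x y where p: "p = (x, y)" "x \<in> PIdl a" "y \<in> carrier N'" by auto
    have "f (\<kappa> x \<odot>\<^bsub>N'\<^esub> y) = \<kappa> x \<odot>\<^bsub>N\<^esub> f y"
      using f p \<kappa>(1) by (simp add: module_hom_def)
    then show ?case using p fc by (simp add: \<Psi>(2) \<Psi>'(2))
  qed
  \<comment> \<open>modulo relations every element is a pure tensor with the generator as its first entry\<close>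
  have reduce: "z - frag_of (a, \<Psi>' z) \<in> tensor_null R ?M N'"
    if z: "z \<in> carrier (tensor_free ?M N')" for z
    using z unfolding carrier_free_Abelian_group_iff
  proof (induction z rule: free_Abelian_group_induct[consumes 1, case_names zero diff one])
    case zero
    have "frag_of (a, \<zero>\<^bsub>N'\<^esub> \<oplus>\<^bsub>N'\<^esub> \<zero>\<^bsub>N'\<^esub>) - frag_of (a, \<zero>\<^bsub>N'\<^esub>) - frag_of (a, \<zero>\<^bsub>N'\<^esub>)
        \<in> tensor_null R ?M N'"
      by (rule tensor_null_rels(2)) (simp_all add: aI)
    then show ?case by (simp add: \<Psi>'_0)
  next
    case (diff x y)
    have xy: "x \<in> carrier (tensor_free ?M N')" "y \<in> carrier (tensor_free ?M N')"
      unfolding carrier_free_Abelian_group_iff by (rule diff)+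
    define u v where "u = \<Psi>' x \<ominus>\<^bsub>N'\<^esub> \<Psi>' y" and "v = \<Psi>' y"
    have uv: "u \<in> carrier N'" "v \<in> carrier N'" using \<Psi>'_closed xy by (auto simp: u_def v_def)
    have u: "\<Psi>' (x - y) = u" unfolding u_def by (rule \<Psi>'_diff[OF xy])
    have x: "\<Psi>' x = u \<oplus>\<^bsub>N'\<^esub> v"
      using \<Psi>'_closed[OF xy(1)] \<Psi>'_closed[OF xy(2)] by (simp add: u_def v_def a_minus_def N'.a_assoc N'.l_neg)
    have "frag_of (a, u \<oplus>\<^bsub>N'\<^esub> v) - frag_of (a, u) - frag_of (a, v) \<in> tensor_null R ?M N'"
      by (rule tensor_null_rels(2)) (simp_all add: aI uv)
    note rel = this
    have "((x - frag_of (a, \<Psi>' x)) - (y - frag_of (a, \<Psi>' y)))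
        + (frag_of (a, u \<oplus>\<^bsub>N'\<^esub> v) - frag_of (a, u) - frag_of (a, v)) \<in> tensor_null R ?M N'"
      by (intro tensor_null_closed(1)[OF M N'] tensor_null_closed(3)[OF M N'] diff.IH rel)
    also have "((x - frag_of (a, \<Psi>' x)) - (y - frag_of (a, \<Psi>' y)))
        + (frag_of (a, u \<oplus>\<^bsub>N'\<^esub> v) - frag_of (a, u) - frag_of (a, v)) = (x - y) - frag_of (a, \<Psi>' (x - y))"
      unfolding u x v_def[symmetric] by simp
    finally show ?case .
  next
    case (one p)
    then obtain x y where p: "p = (x, y)" "x \<in> PIdl a" "y \<in> carrier N'" by auto
    have "frag_of (\<kappa> x \<odot>\<^bsub>?M\<^esub> a, y) - frag_of (a, \<kappa> x \<odot>\<^bsub>N'\<^esub> y) \<in> tensor_null R ?M N'"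
      by (rule tensor_null_rels(3)) (simp_all add: aI p \<kappa>(1))
    then show ?case using p \<kappa>(2)[OF p(2)] by (simp add: \<Psi>'(2))
  qed
  \<comment> \<open>the coordinate map is bilinear, hence vanishes on null elements\<close>
  have \<Psi>_null: "\<Psi> z = \<zero>\<^bsub>N\<^esub>" if z: "z \<in> tensor_null R ?M N" for z
  proof -
    have car: "frag_of (x, y) \<in> carrier (tensor_free ?M N)" if "x \<in> PIdl a" "y \<in> carrier N" for x y
      using that by simp
    have car2: "frag_of p - frag_of q \<in> carrier (tensor_free ?M N)"
      if "frag_of p \<in> carrier (tensor_free ?M N)" "frag_of q \<in> carrier (tensor_free ?M N)" for p q
      using that keys_diff[of "frag_of p" "frag_of q"] unfolding carrier_free_Abelian_group_iff by blast
    interpret cg: ideal "PIdl a" R by (rule cgenideal_ideal[OF a])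
    have "\<Psi> z \<in> {\<zero>\<^bsub>N\<^esub>}"
    proof (rule tensor_null_hom[OF N.a_group _ \<Psi>(1) M N _ z])
      show "subgroup {\<zero>\<^bsub>N\<^esub>} (add_monoid N)" using group.triv_subgroup[OF N.a_group] by simp
      fix w assume "w \<in> tensor_rels R ?M N"
      then consider
        x x' y where "x \<in> PIdl a" "x' \<in> PIdl a" "y \<in> carrier N"
          "w = frag_of (x \<oplus> x', y) - frag_of (x, y) - frag_of (x', y)" |
        x y y' where "x \<in> PIdl a" "y \<in> carrier N" "y' \<in> carrier N"
          "w = frag_of (x, y \<oplus>\<^bsub>N\<^esub> y') - frag_of (x, y) - frag_of (x, y')" |
        r x y where "r \<in> carrier R" "x \<in> PIdl a" "y \<in> carrier N"
          "w = frag_of (r \<otimes> x, y) - frag_of (x, r \<odot>\<^bsub>N\<^esub> y)"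
        unfolding tensor_rels_def ideal_module_simps
        by (elim UnE CollectE exE conjE) (rule that; assumption)+
      then have "\<Psi> w = \<zero>\<^bsub>N\<^esub>"
      proof cases
        case 1
        have "\<Psi> w = (\<kappa> x \<oplus> \<kappa> x') \<odot>\<^bsub>N\<^esub> y \<ominus>\<^bsub>N\<^esub> \<kappa> x \<odot>\<^bsub>N\<^esub> y \<ominus>\<^bsub>N\<^esub> \<kappa> x' \<odot>\<^bsub>N\<^esub> y"
          unfolding 1(4) using 1 by (simp only: \<Psi>_diff car car2 \<Psi>(2) \<kappa>(3) cg.a_closed)
        then show ?thesis using 1 \<kappa>(1) by (simp add: N.smult_l_distr a_minus_def N.a_ac N.r_neg N.r_neg1)
      next
        case 2
        have "\<Psi> w = \<kappa> x \<odot>\<^bsub>N\<^esub> (y \<oplus>\<^bsub>N\<^esub> y') \<ominus>\<^bsub>N\<^esub> \<kappa> x \<odot>\<^bsub>N\<^esub> y \<ominus>\<^bsub>N\<^esub> \<kappa> x \<odot>\<^bsub>N\<^esub> y'"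
          unfolding 2(4) using 2 by (simp only: \<Psi>_diff car car2 \<Psi>(2) N.a_closed)
        then show ?thesis using 2 \<kappa>(1) by (simp add: N.smult_r_distr a_minus_def N.a_ac N.r_neg N.r_neg1)
      next
        case 3
        have "\<Psi> w = (r \<otimes> \<kappa> x) \<odot>\<^bsub>N\<^esub> y \<ominus>\<^bsub>N\<^esub> \<kappa> x \<odot>\<^bsub>N\<^esub> (r \<odot>\<^bsub>N\<^esub> y)"
          unfolding 3(4) using 3 by (simp only: \<Psi>_diff car car2 \<Psi>(2) \<kappa>(4) cg.I_l_closed N.smult_closed)
        also have "\<kappa> x \<odot>\<^bsub>N\<^esub> (r \<odot>\<^bsub>N\<^esub> y) = (r \<otimes> \<kappa> x) \<odot>\<^bsub>N\<^esub> y"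
          using 3 \<kappa>(1) by (simp add: m_comm[of r] N.smult_assoc1)
        finally show ?thesis using 3 \<kappa>(1) by (simp add: a_minus_def N.r_neg)
      qed
      then show "\<Psi> w \<in> {\<zero>\<^bsub>N\<^esub>}" by simp
    qed
    then show ?thesis by simp
  qed
  show "inj_on (tensor_map R ?M N f) (carrier (tensor_product R ?M N'))"
  proof (rule inj_onI)
    fix U U' assume U: "U \<in> carrier (tensor_product R ?M N')" "U' \<in> carrier (tensor_product R ?M N')"
      and eq: "tensor_map R ?M N f U = tensor_map R ?M N f U'"
    obtain c c' where c: "c \<in> carrier (tensor_free ?M N')" "c' \<in> carrier (tensor_free ?M N')"
      and Uc: "U = tensor_null R ?M N' #>\<^bsub>tensor_free ?M N'\<^esub> c"
        "U' = tensor_null R ?M N' #>\<^bsub>tensor_free ?M N'\<^esub> c'"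
      using U unfolding carrier_tensor_product by blast
    have "0 \<in> tensor_null R ?M N"
      by (rule tensor_null_zero[OF M N])
    then have "?F c \<in> tensor_null R ?M N #>\<^bsub>tensor_free ?M N\<^esub> ?F c"
      unfolding tensor_coset_iff diff_self .
    then have "?F c \<in> tensor_null R ?M N #>\<^bsub>tensor_free ?M N\<^esub> ?F c'"
      using eq unfolding Uc tensor_map_coset[OF M N' N f c(1)] tensor_map_coset[OF M N' N f c(2)]
      by (rule back_subst[where P = "\<lambda>V. ?F c \<in> V"])
    then have "?F c - ?F c' \<in> tensor_null R ?M N"
      unfolding tensor_coset_iff .
    then have "\<Psi> (?F c) \<ominus>\<^bsub>N\<^esub> \<Psi> (?F c') = \<zero>\<^bsub>N\<^esub>"
      using \<Psi>_null \<Psi>_diff F[OF c(1)] F[OF c(2)] by metis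
    then have "f (\<Psi>' c) = f (\<Psi>' c')"
      using F[OF c(1)] F[OF c(2)] fc[OF \<Psi>'_closed[OF c(1)]] fc[OF \<Psi>'_closed[OF c(2)]]
        N.minus_equality[of "f (\<Psi>' c)" "\<ominus>\<^bsub>N\<^esub> f (\<Psi>' c')"] by (simp add: a_minus_def)
    then have "\<Psi>' c = \<Psi>' c'" using inj \<Psi>'_closed c by (metis inj_onD)
    then have "c - c' = (c - frag_of (a, \<Psi>' c)) - (c' - frag_of (a, \<Psi>' c'))" by simp
    also have "\<dots> \<in> tensor_null R ?M N'" by (intro tensor_null_closed(3)[OF M N'] reduce c)
    finally show "U = U'" unfolding Uc by (intro tensor_coset_eqI M N')
  qed
qed

text \<open>
  The injection tested is the inclusion of \<open>J = aR + bR\<close> into \<open>R\<close>.  In \<open>I \<otimes> R\<close> the element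
  \<open>x\<^sub>1 \<otimes> a - x\<^sub>2 \<otimes> b\<close> is \<open>(a x\<^sub>1 - b x\<^sub>2) \<otimes> 1 = 0\<close>, so by flatness it already vanishes in \<open>I \<otimes> J\<close>.
  Now \<open>i \<otimes> (r a + s b) \<mapsto> i r\<close> is a well-defined map \<open>I \<otimes> J \<rightarrow> I/bI\<close>, because the coefficient \<open>r\<close> is
  determined modulo \<open>b\<close> when \<open>a\<close> and \<open>b\<close> have no common factor, and it sends that element to the
  class of \<open>x\<^sub>1\<close>.
\<close>

lemma (in domain) flat_ideal_cofactor:
  assumes I: "ideal I R" and flat: "flat_module R (ideal_module R I)"
    and a: "a \<in> carrier R" and b: "b \<in> carrier R"
    and coprime: "\<And>r s. r \<in> carrier R \<Longrightarrow> s \<in> carrier R \<Longrightarrow> a \<otimes> r = b \<otimes> s \<Longrightarrow> \<exists>t\<in>carrier R. r = b \<otimes> t"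
    and x: "x1 \<in> I" "x2 \<in> I" "a \<otimes> x1 = b \<otimes> x2"
  shows "\<exists>j\<in>I. x1 = b \<otimes> j"
proof -
  interpret I: ideal I R by fact
  have IR: "i \<in> carrier R" if "i \<in> I" for i using that I.a_subset by blast
  define J where "J = {r \<otimes> a \<oplus> s \<otimes> b | r s. r \<in> carrier R \<and> s \<in> carrier R}"
  define K where "K = {b \<otimes> j | j. j \<in> I}"
  define rep where "rep r w \<longleftrightarrow> r \<in> carrier R \<and> (\<exists>s\<in>carrier R. w = r \<otimes> a \<oplus> s \<otimes> b)" for r w
  have rep_add: "rep (r \<oplus> r') (w \<oplus> w')" if rr: "rep r w" "rep r' w'" for r r' w w'
  proof -
    obtain s s' where "s \<in> carrier R" "s' \<in> carrier R" "w = r \<otimes> a \<oplus> s \<otimes> b" "w' = r' \<otimes> a \<oplus> s' \<otimes> b"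
      using rr by (auto simp: rep_def)
    then show ?thesis
      using rr a b unfolding rep_def by (intro conjI bexI[of _ "s \<oplus> s'"]) (auto simp: l_distr a_ac)
  qed
  have rep_mult: "rep (q \<otimes> r) (q \<otimes> w)" if rr: "rep r w" "q \<in> carrier R" for q r w
  proof -
    obtain s where "s \<in> carrier R" "w = r \<otimes> a \<oplus> s \<otimes> b" using rr by (auto simp: rep_def)
    then show ?thesis
      using rr a b unfolding rep_def by (intro conjI bexI[of _ "q \<otimes> s"]) (auto simp: r_distr m_assoc)
  qed
  have rep_J: "w \<in> J \<longleftrightarrow> (\<exists>r. rep r w)" for w unfolding J_def rep_def by blast
  have rep_0: "rep \<zero> \<zero>" unfolding rep_def using a b by (intro conjI bexI[of _ "\<zero>"]) auto
  have rep_a: "rep \<one> a" unfolding rep_def using a b by (intro conjI bexI[of _ "\<zero>"]) auto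
  have rep_b: "rep \<zero> b" unfolding rep_def using a b by (intro conjI bexI[of _ "\<one>"]) auto
  have J: "ideal J R"
  proof (rule ideal_of_closed)
    show "J \<subseteq> carrier R" unfolding J_def using a b by auto
    show "\<zero> \<in> J" using rep_0 rep_J by blast
    show "x \<oplus> y \<in> J" if "x \<in> J" "y \<in> J" for x y
      using that rep_add unfolding rep_J by blast
    show "r \<otimes> x \<in> J" if "r \<in> carrier R" "x \<in> J" for r x
      using that rep_mult unfolding rep_J by blast
  qed
  have K: "ideal K R"
  proof (rule ideal_of_closed)
    show "K \<subseteq> carrier R" unfolding K_def using b IR by auto
    show "\<zero> \<in> K" unfolding K_def using b by (intro CollectI exI[of _ "\<zero>"]) auto
    fix u v assume "u \<in> K" "v \<in> K"
    then obtain i j where "i \<in> I" "j \<in> I" "u = b \<otimes> i" "v = b \<otimes> j" by (auto simp: K_def)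
    then show "u \<oplus> v \<in> K" unfolding K_def using b IR
      by (intro CollectI exI[of _ "i \<oplus> j"]) (auto simp: r_distr)
  next
    fix r u assume "r \<in> carrier R" "u \<in> K"
    then obtain i where "i \<in> I" "u = b \<otimes> i" by (auto simp: K_def)
    then show "r \<otimes> u \<in> K" unfolding K_def using b IR \<open>r \<in> carrier R\<close> I.I_l_closed[of i r]
      by (intro CollectI exI[of _ "r \<otimes> i"]) (auto simp: m_lcomm)
  qed
  interpret K: ideal K R by fact
  \<comment> \<open>the coefficient of \<open>a\<close> is unique up to multiples of \<open>b\<close>\<close>
  have rep_unique: "i \<otimes> r \<ominus> i \<otimes> r' \<in> K" if i: "i \<in> I" and rr: "rep r w" "rep r' w" for i r r' w
  proof -
    obtain s s' where s: "s \<in> carrier R" "s' \<in> carrier R" "w = r \<otimes> a \<oplus> s \<otimes> b" "w = r' \<otimes> a \<oplus> s' \<otimes> b"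
      and r: "r \<in> carrier R" "r' \<in> carrier R"
      using rr by (auto simp: rep_def)
    have "a \<otimes> (r \<ominus> r') = (r \<otimes> a \<oplus> s \<otimes> b) \<ominus> (r' \<otimes> a \<oplus> s' \<otimes> b) \<oplus> b \<otimes> (s' \<ominus> s)"
      using s(1,2) r a b by algebra
    also have "(r \<otimes> a \<oplus> s \<otimes> b) \<ominus> (r' \<otimes> a \<oplus> s' \<otimes> b) = \<zero>"
      unfolding s(3)[symmetric] s(4)[symmetric] using s r a b by (simp add: a_minus_def r_neg)
    finally have "a \<otimes> (r \<ominus> r') = b \<otimes> (s' \<ominus> s)" using s(1,2) b by simp
    then obtain t where t: "t \<in> carrier R" "r \<ominus> r' = b \<otimes> t"
      using coprime[of "r \<ominus> r'" "s' \<ominus> s"] r s by auto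
    have "i \<otimes> r \<ominus> i \<otimes> r' = i \<otimes> (r \<ominus> r')" using IR[OF i] r by algebra
    also have "\<dots> = b \<otimes> (t \<otimes> i)" unfolding t(2) using IR[OF i] t(1) b by (simp add: m_ac)
    finally show ?thesis using I.I_l_closed[OF i t(1)] by (auto simp: K_def)
  qed
  \<comment> \<open>an arbitrary choice of coefficients; it is linear modulo \<open>b\<close> only, which is why values are compared modulo \<open>K = bI\<close>\<close>
  define \<rho> where "\<rho> w = (SOME r. rep r w)" for w
  have \<rho>: "rep (\<rho> w) w" if "w \<in> J" for w
    using that unfolding rep_J \<rho>_def by (rule someI_ex)
  have \<rho>R: "\<rho> w \<in> carrier R" if "w \<in> J" for w using \<rho>[OF that] by (simp add: rep_def)
  have aJ: "a \<in> J" and bJ: "b \<in> J" using rep_J rep_a rep_b by blast+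
  let ?M = "ideal_module R I" and ?N' = "ideal_module R J" and ?N = "ideal_module R (carrier R)"
  have M: "module R ?M" and N': "module R ?N'" and N: "module R ?N"
    by (intro ideal_module_module is_cring I J oneideal)+
  have f: "(\<lambda>w. w) \<in> module_hom R ?N' ?N"
    using ideal.axioms(1)[OF J] additive_subgroup.a_subset[of J R] by (auto simp: module_hom_def hom_def)
  define c where "c = frag_of (x1, a) - frag_of (x2, b)"
  have cN': "c \<in> carrier (tensor_free ?M ?N')"
    unfolding c_def carrier_free_Abelian_group_iff
    using keys_diff[of "frag_of (x1, a)" "frag_of (x2, b)"] x aJ bJ by auto
  have "frag_of (b \<odot>\<^bsub>?M\<^esub> x2, \<one>) - frag_of (x2, b \<odot>\<^bsub>?N\<^esub> \<one>) \<in> tensor_null R ?M ?N"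
    "frag_of (a \<odot>\<^bsub>?M\<^esub> x1, \<one>) - frag_of (x1, a \<odot>\<^bsub>?N\<^esub> \<one>) \<in> tensor_null R ?M ?N"
    by (rule tensor_null_rels(3); simp add: a b x)+
  then have "frag_of (b \<otimes> x2, \<one>) - frag_of (x2, b) \<in> tensor_null R ?M ?N"
    "frag_of (b \<otimes> x2, \<one>) - frag_of (x1, a) \<in> tensor_null R ?M ?N"
    using a b x by simp_all
  from tensor_null_closed(3)[OF M N this]
  have "(frag_of (b \<otimes> x2, \<one>) - frag_of (x2, b)) - (frag_of (b \<otimes> x2, \<one>) - frag_of (x1, a)) \<in> tensor_null R ?M ?N" .
  \<comment> \<open>both terms equal the same tensor with second entry \<open>1\<close>\<close>
  then have cnull: "c \<in> tensor_null R ?M ?N" by (simp add: c_def)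
  let ?F = "frag_extend (\<lambda>(x, y). frag_of (x, y))"
  have "?F c - ?F 0 = c" by (simp add: c_def frag_extend_diff)
  have 0: "0 \<in> carrier (tensor_free ?M ?N')" by simp
  have "tensor_map R ?M ?N (\<lambda>w. w) (tensor_null R ?M ?N' #>\<^bsub>tensor_free ?M ?N'\<^esub> c)
      = tensor_map R ?M ?N (\<lambda>w. w) (tensor_null R ?M ?N' #>\<^bsub>tensor_free ?M ?N'\<^esub> 0)"
    unfolding tensor_map_coset[OF M N' N f cN'] tensor_map_coset[OF M N' N f 0]
    by (rule tensor_coset_eqI[OF M N]) (simp only: \<open>?F c - ?F 0 = c\<close> cnull)
  moreover have "inj_on (tensor_map R ?M ?N (\<lambda>w. w)) (carrier (tensor_product R ?M ?N'))"
    using flat N' N f by (auto simp: flat_module_def)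
  ultimately have "tensor_null R ?M ?N' #>\<^bsub>tensor_free ?M ?N'\<^esub> c = tensor_null R ?M ?N' #>\<^bsub>tensor_free ?M ?N'\<^esub> 0"
    using cN' 0 unfolding carrier_tensor_product by (blast dest: inj_onD)
  moreover have "0 \<in> tensor_null R ?M ?N'"
      by (rule tensor_null_zero[OF M N'])
  then have "c \<in> tensor_null R ?M ?N' #>\<^bsub>tensor_free ?M ?N'\<^esub> c"
    unfolding tensor_coset_iff diff_self .
  ultimately have "c \<in> tensor_null R ?M ?N' #>\<^bsub>tensor_free ?M ?N'\<^esub> 0" by simp
  then have c: "c \<in> tensor_null R ?M ?N'" unfolding tensor_coset_iff by simp
  have "(\<lambda>(i, w). i \<otimes> \<rho> w) ` (carrier ?M \<times> carrier ?N') \<subseteq> carrier (add_monoid R)"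
    using IR \<rho>R by auto
  then obtain \<Phi> where \<Phi>: "\<Phi> \<in> hom (tensor_free ?M ?N') (add_monoid R)"
    "\<And>z. z \<in> carrier ?M \<times> carrier ?N' \<Longrightarrow> \<Phi> (frag_of z) = (\<lambda>(i, w). i \<otimes> \<rho> w) z"
    using comm_group.free_Abelian_group_universal[OF a_comm_group] by metis
  have \<Phi>_of: "\<Phi> (frag_of (i, w)) = i \<otimes> \<rho> w" if "i \<in> I" "w \<in> J" for i w
    using \<Phi>(2)[of "(i, w)"] that by simp
  have \<Phi>_diff: "\<Phi> (u - v) = \<Phi> u \<ominus> \<Phi> v"
    if "u \<in> carrier (tensor_free ?M ?N')" "v \<in> carrier (tensor_free ?M ?N')" for u v
    using free_Abelian_group_hom_diff[OF a_group \<Phi>(1) that] by (simp add: a_minus_def a_inv_def)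
  have car: "frag_of (i, w) \<in> carrier (tensor_free ?M ?N')" if "i \<in> I" "w \<in> J" for i w
    using that by simp
  have car2: "frag_of p - frag_of q \<in> carrier (tensor_free ?M ?N')"
    if "frag_of p \<in> carrier (tensor_free ?M ?N')" "frag_of q \<in> carrier (tensor_free ?M ?N')" for p q
    using that keys_diff[of "frag_of p" "frag_of q"] unfolding carrier_free_Abelian_group_iff by blast
  interpret J: ideal J R by fact
  have "\<Phi> c \<in> K"
  proof (rule tensor_null_hom[OF a_group _ \<Phi>(1) M N' _ c])
    show "subgroup K (add_monoid R)" by (rule K.a_subgroup)
    fix z assume "z \<in> tensor_rels R ?M ?N'"
    then consider
      i i' w where "i \<in> I" "i' \<in> I" "w \<in> J"
        "z = frag_of (i \<oplus> i', w) - frag_of (i, w) - frag_of (i', w)" |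
      i w w' where "i \<in> I" "w \<in> J" "w' \<in> J"
        "z = frag_of (i, w \<oplus> w') - frag_of (i, w) - frag_of (i, w')" |
      r i w where "r \<in> carrier R" "i \<in> I" "w \<in> J"
        "z = frag_of (r \<otimes> i, w) - frag_of (i, r \<otimes> w)"
      unfolding tensor_rels_def ideal_module_simps
      by (elim UnE CollectE exE conjE) (rule that; assumption)+
    then show "\<Phi> z \<in> K"
    proof cases
      case 1
      have "\<Phi> z = (i \<oplus> i') \<otimes> \<rho> w \<ominus> i \<otimes> \<rho> w \<ominus> i' \<otimes> \<rho> w"
        unfolding 1(4) using 1 by (simp only: \<Phi>_diff car car2 \<Phi>_of I.a_closed)
      also have "\<dots> = \<zero>" using IR[OF 1(1)] IR[OF 1(2)] \<rho>R[OF 1(3)] by algebra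
      finally show ?thesis by simp
    next
      case 2
      have "\<Phi> z = i \<otimes> \<rho> (w \<oplus> w') \<ominus> i \<otimes> \<rho> w \<ominus> i \<otimes> \<rho> w'"
        unfolding 2(4) using 2 by (simp only: \<Phi>_diff car car2 \<Phi>_of J.a_closed)
      also have "\<dots> = i \<otimes> \<rho> (w \<oplus> w') \<ominus> i \<otimes> (\<rho> w \<oplus> \<rho> w')"
        using IR[OF 2(1)] \<rho>R[OF 2(2)] \<rho>R[OF 2(3)] \<rho>R[OF J.a_closed[OF 2(2,3)]] by algebra
      also have "\<dots> \<in> K"
        using rep_unique[OF 2(1) \<rho>[OF J.a_closed[OF 2(2,3)]] rep_add[OF \<rho>[OF 2(2)] \<rho>[OF 2(3)]]] .
      finally show ?thesis .
    next
      case 3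
      have rw: "r \<otimes> w \<in> J" using J.I_l_closed 3 by blast
      have "\<Phi> z = (r \<otimes> i) \<otimes> \<rho> w \<ominus> i \<otimes> \<rho> (r \<otimes> w)"
        unfolding 3(4) using 3 rw by (simp only: \<Phi>_diff car car2 \<Phi>_of I.I_l_closed)
      also have "(r \<otimes> i) \<otimes> \<rho> w = i \<otimes> (r \<otimes> \<rho> w)"
        using IR[OF 3(2)] \<rho>R[OF 3(3)] 3(1) by (simp add: m_ac)
      also have "i \<otimes> (r \<otimes> \<rho> w) \<ominus> i \<otimes> \<rho> (r \<otimes> w) \<in> K"
        by (rule rep_unique[OF 3(2) rep_mult[OF \<rho>[OF 3(3)] 3(1)] \<rho>[OF rw]])
      finally show ?thesis .
    qed
  qed
  moreover have "\<Phi> c = x1 \<otimes> \<rho> a \<ominus> x2 \<otimes> \<rho> b"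
    unfolding c_def using x aJ bJ by (simp only: \<Phi>_diff car \<Phi>_of)
  moreover have "x1 \<otimes> \<one> \<ominus> x1 \<otimes> \<rho> a \<in> K" by (rule rep_unique[OF x(1) rep_a \<rho>[OF aJ]])
  moreover have "x2 \<otimes> \<rho> b \<ominus> x2 \<otimes> \<zero> \<in> K" by (rule rep_unique[OF x(2) \<rho>[OF bJ] rep_b])
  \<comment> \<open>the chosen coefficients of \<open>a\<close> and \<open>b\<close> may be replaced by the obvious ones, \<open>1\<close> and \<open>0\<close>\<close>
  ultimately have "(x1 \<otimes> \<rho> a \<ominus> x2 \<otimes> \<rho> b) \<oplus> ((x1 \<otimes> \<one> \<ominus> x1 \<otimes> \<rho> a) \<oplus> (x2 \<otimes> \<rho> b \<ominus> x2 \<otimes> \<zero>)) \<in> K"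
    by (metis K.a_closed)
  also have "(x1 \<otimes> \<rho> a \<ominus> x2 \<otimes> \<rho> b) \<oplus> ((x1 \<otimes> \<one> \<ominus> x1 \<otimes> \<rho> a) \<oplus> (x2 \<otimes> \<rho> b \<ominus> x2 \<otimes> \<zero>)) = x1"
    using IR[OF x(1)] IR[OF x(2)] \<rho>R[OF aJ] \<rho>R[OF bJ] by algebra
  finally show ?thesis by (auto simp: K_def)
qed

text \<open>
  Writing two nonzero elements as \<open>d b\<close> and \<open>d a\<close> with cofactors \<open>a\<close>, \<open>b\<close> as above, flatness yields
  \<open>d b = b j\<close> with \<open>j\<close> in the ideal, so \<open>d = j\<close> lies in it.  Hence any finite set of elements of the
  ideal has a common divisor inside the ideal.
\<close>

lemma (in factorial_domain) flat_fin_gen_principal: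
  assumes fg: "fin_gen_ideal R I" and flat: "flat_module R (ideal_module R I)"
  shows "\<exists>g\<in>carrier R. I = PIdl g"
proof -
  obtain A where A: "A \<subseteq> carrier R" "finite A" "I = Idl A" using fg by (auto simp: fin_gen_ideal_def)
  have I: "ideal I R" unfolding A(3) by (rule genideal_ideal[OF A(1)])
  interpret I: ideal I R by fact
  have AI: "A \<subseteq> I" unfolding A(3) by (rule genideal_self[OF A(1)])
  have pair: "\<exists>d\<in>I. x \<in> PIdl d \<and> y \<in> PIdl d" if xy: "x \<in> I" "y \<in> I" for x y
  proof -
    have R: "x \<in> carrier R" "y \<in> carrier R" using xy I.a_subset by blast+
    consider "x = \<zero>" | "y = \<zero>" | "x \<noteq> \<zero>" "y \<noteq> \<zero>" by blast
    then show ?thesis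
    proof cases
      case 1
      then show ?thesis using xy R cgenideal_self cgenideal_ideal[THEN ideal.axioms(1)]
        by (metis additive_subgroup.zero_closed)
    next
      case 2
      then show ?thesis using xy R cgenideal_self cgenideal_ideal[THEN ideal.axioms(1)]
        by (metis additive_subgroup.zero_closed)
    next
      case 3
      obtain d a b where d: "d \<in> carrier R" and ab: "a \<in> carrier R" "b \<in> carrier R"
        and eq: "x = d \<otimes> b" "y = d \<otimes> a"
        and cop: "\<And>r s. r \<in> carrier R \<Longrightarrow> s \<in> carrier R \<Longrightarrow> a \<otimes> r = b \<otimes> s \<Longrightarrow> \<exists>t\<in>carrier R. r = b \<otimes> t"
        using coprime_cofactors[OF R 3] by metis
      have axby: "a \<otimes> x = b \<otimes> y" unfolding eq using d ab by (simp add: m_ac)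
      have "\<exists>j\<in>I. x = b \<otimes> j"
        by (rule flat_ideal_cofactor[OF I flat ab _ xy axby]) (rule cop)
      then obtain j where j: "j \<in> I" "x = b \<otimes> j" by blast
      have "b \<noteq> \<zero>" using 3 eq d by auto
      moreover have "b \<otimes> d = b \<otimes> j" using eq j d ab by (simp add: m_comm)
      ultimately have "d = j" using d ab j I.a_subset m_lcancel[of b d j] by blast
      then have "d \<in> I" using j by simp
      moreover have "x = b \<otimes> d" "y = a \<otimes> d" using eq d ab by (simp_all add: m_comm)
      ultimately show ?thesis using ab unfolding cgenideal_def by blast
    qed
  qed
  have trans: "x \<in> PIdl d" if "x \<in> PIdl g" "g \<in> PIdl d" "d \<in> carrier R" for x g d
    using that cgenideal_minimal[OF cgenideal_ideal[OF that(3)] that(2)] by blast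
  have "\<exists>g\<in>I. B \<subseteq> PIdl g" if "finite B" "B \<subseteq> I" for B
    using that
  proof (induction rule: finite_induct)
    case empty
    then show ?case using I.zero_closed by blast
  next
    case (insert x B)
    then obtain g where g: "g \<in> I" "B \<subseteq> PIdl g" by blast
    obtain d where d: "d \<in> I" "x \<in> PIdl d" "g \<in> PIdl d" using pair[OF _ g(1), of x] insert.prems by blast
    have dR: "d \<in> carrier R" using d(1) I.a_subset by blast
    have "B \<subseteq> PIdl d" using trans[OF _ d(3) dR] g(2) by blast
    then show ?case using d by blast
  qed
  then obtain g where g: "g \<in> I" "A \<subseteq> PIdl g" using A AI by blast
  have gR: "g \<in> carrier R" using g I.a_subset by blast
  have "I \<subseteq> PIdl g" unfolding A(3) by (rule genideal_minimal[OF cgenideal_ideal[OF gR] g(2)])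
  moreover have "PIdl g \<subseteq> I" by (rule cgenideal_minimal[OF I g(1)])
  ultimately show ?thesis using gR by blast
qed

theorem (in factorial_domain) G_GCD: "G_GCD_ring R"
  unfolding G_GCD_ring_def
proof (intro conjI allI impI ballI is_cring projective_principal)
  fix I J
  assume IJ: "fin_gen_ideal R I \<and> flat_module R (ideal_module R I)
    \<and> fin_gen_ideal R J \<and> flat_module R (ideal_module R J)"
  obtain g h where "g \<in> carrier R" "I = PIdl g" "h \<in> carrier R" "J = PIdl h"
    using flat_fin_gen_principal IJ by metis
  then obtain m where "m \<in> carrier R" "I \<inter> J = PIdl m" using inter_principal by metis
  then show "fin_gen_ideal R (I \<inter> J)" "flat_module R (ideal_module R (I \<inter> J))"
    by (simp_all add: fin_gen_principal flat_principal)
qed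

section \<open>The group ring of the cyclic group of order two\<close>

abbreviation C2 :: "int monoid" where
  "C2 \<equiv> integer_mod_group 2"

lemma carrier_C2: "carrier C2 = {0, 1}"
  by (auto simp: carrier_integer_mod_group)

lemma fin_gen_C2: "fin_gen_group C2"
proof -
  have "carrier C2 \<subseteq> generate C2 (carrier C2)" by (auto intro: generate.incl)
  moreover have "generate C2 (carrier C2) \<subseteq> carrier C2"
    by (rule group.generate_incl) auto
  ultimately show ?thesis
    unfolding fin_gen_group_def by (intro conjI exI[of _ "carrier C2"]) (auto simp: carrier_C2)
qed

text \<open>
  With \<open>g\<close> the generator of the group, this is \<open>p + q g\<close>.  The value outside \<open>{0, 1}\<close> is the one
  required of members of the group ring.
\<close>

definition C2_elem :: "('a, 'x) ring_scheme \<Rightarrow> 'a \<Rightarrow> 'a \<Rightarrow> int \<Rightarrow> 'a" where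
  "C2_elem R p q x = (if x = 0 then p else if x = 1 then q else \<zero>\<^bsub>R\<^esub>)"

context cring
begin

abbreviation RC2 where "RC2 \<equiv> group_ring R C2"

lemma RC2_cring: "cring RC2"
  by (rule group_ring_cring[OF is_cring abelian_integer_mod_group])

lemma C2_elem_closed: "p \<in> carrier R \<Longrightarrow> q \<in> carrier R \<Longrightarrow> C2_elem R p q \<in> carrier RC2"
proof -
  assume "p \<in> carrier R" "q \<in> carrier R"
  moreover have "finite {x. C2_elem R p q x \<noteq> \<zero>}"
    by (rule finite_subset[of _ "{0, 1}"]) (auto simp: C2_elem_def)
  ultimately show ?thesis by (auto simp: group_ring_def carrier_C2 C2_elem_def)
qed

lemma RC2_elem:
  assumes "f \<in> carrier RC2"
  shows "\<exists>p\<in>carrier R. \<exists>q\<in>carrier R. f = C2_elem R p q"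
  using assms by (intro bexI[of _ "f 0"] bexI[of _ "f 1"]) (auto simp: group_ring_def carrier_C2 C2_elem_def)

lemma C2_elem_mult:
  assumes "p \<in> carrier R" "q \<in> carrier R" "r \<in> carrier R" "s \<in> carrier R"
  shows "C2_elem R p q \<otimes>\<^bsub>RC2\<^esub> C2_elem R r s = C2_elem R (p \<otimes> r \<oplus> q \<otimes> s) (p \<otimes> s \<oplus> q \<otimes> r)"
proof
  fix x :: int
  let ?f = "C2_elem R p q" and ?g = "C2_elem R r s"
  consider "x = 0" | "x = 1" | "x \<notin> carrier C2" by (auto simp: carrier_C2)
  then show "(?f \<otimes>\<^bsub>RC2\<^esub> ?g) x = C2_elem R (p \<otimes> r \<oplus> q \<otimes> s) (p \<otimes> s \<oplus> q \<otimes> r) x"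
  proof cases
    case 3
    then show ?thesis by (auto simp: group_ring_def C2_elem_def carrier_C2)
  next
    case 1
    have "(?f \<otimes>\<^bsub>RC2\<^esub> ?g) x = (\<Oplus>y\<in>{0, 1}. ?f y \<otimes> ?g (inv\<^bsub>C2\<^esub> y \<otimes>\<^bsub>C2\<^esub> x))"
      by (rule group_ring_mult_eq[OF is_cring abelian_integer_mod_group])
        (use assms 1 in \<open>auto simp: C2_elem_closed carrier_C2 C2_elem_def\<close>)
    also have "\<dots> = ?f 0 \<otimes> ?g (inv\<^bsub>C2\<^esub> 0 \<otimes>\<^bsub>C2\<^esub> x) \<oplus> ?f 1 \<otimes> ?g (inv\<^bsub>C2\<^esub> 1 \<otimes>\<^bsub>C2\<^esub> x)"
      by (subst finsum_insert) (use assms in \<open>auto simp: C2_elem_def\<close>)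
    finally show ?thesis using assms 1 by (simp add: carrier_C2 C2_elem_def)
  next
    case 2
    have "(?f \<otimes>\<^bsub>RC2\<^esub> ?g) x = (\<Oplus>y\<in>{0, 1}. ?f y \<otimes> ?g (inv\<^bsub>C2\<^esub> y \<otimes>\<^bsub>C2\<^esub> x))"
      by (rule group_ring_mult_eq[OF is_cring abelian_integer_mod_group])
        (use assms 2 in \<open>auto simp: C2_elem_closed carrier_C2 C2_elem_def\<close>)
    also have "\<dots> = ?f 0 \<otimes> ?g (inv\<^bsub>C2\<^esub> 0 \<otimes>\<^bsub>C2\<^esub> x) \<oplus> ?f 1 \<otimes> ?g (inv\<^bsub>C2\<^esub> 1 \<otimes>\<^bsub>C2\<^esub> x)"
      by (subst finsum_insert) (use assms in \<open>auto simp: C2_elem_def\<close>)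
    finally show ?thesis using assms 2 by (simp add: carrier_C2 C2_elem_def)
  qed
qed

text \<open>
  The ring homomorphism to \<open>R\<close> that maps the group to \<open>1\<close>; on \<open>x + y \<epsilon>\<close> with \<open>\<epsilon> = 1 + g\<close> it takes the
  value \<open>x\<close> in characteristic two.
\<close>

definition augmentation :: "(int \<Rightarrow> 'a) \<Rightarrow> 'a" where
  "augmentation f = f 0 \<oplus> f 1"

lemma augmentation_C2_elem [simp]: "augmentation (C2_elem R p q) = p \<oplus> q"
  by (simp add: augmentation_def C2_elem_def)

lemma augmentation_closed: "f \<in> carrier RC2 \<Longrightarrow> augmentation f \<in> carrier R"
  by (simp add: augmentation_def group_ring_def)

lemma augmentation_add:
  assumes "f \<in> carrier RC2" "g \<in> carrier RC2"
  shows "augmentation (f \<oplus>\<^bsub>RC2\<^esub> g) = augmentation f \<oplus> augmentation g"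
proof -
  have "f 0 \<in> carrier R" "f 1 \<in> carrier R" "g 0 \<in> carrier R" "g 1 \<in> carrier R"
    using assms by (simp_all add: group_ring_def)
  then show ?thesis by (simp add: augmentation_def group_ring_def a_ac)
qed

lemma augmentation_mult:
  assumes "f \<in> carrier RC2" "g \<in> carrier RC2"
  shows "augmentation (f \<otimes>\<^bsub>RC2\<^esub> g) = augmentation f \<otimes> augmentation g"
proof -
  obtain p q r s where pqrs: "p \<in> carrier R" "q \<in> carrier R" "r \<in> carrier R" "s \<in> carrier R"
    and fg: "f = C2_elem R p q" "g = C2_elem R r s"
    using RC2_elem assms by metis
  have "p \<otimes> r \<oplus> q \<otimes> s \<oplus> (p \<otimes> s \<oplus> q \<otimes> r) = (p \<oplus> q) \<otimes> (r \<oplus> s)"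
    using pqrs by algebra
  then show ?thesis using pqrs by (simp add: fg C2_elem_mult)
qed

lemma augmentation_zero: "augmentation \<zero>\<^bsub>RC2\<^esub> = \<zero>"
  by (simp add: augmentation_def group_ring_def)

end

text \<open>
  In dual number notation the two principal ideals are generated by \<open>\<alpha> = a\<^sup>2\<close> and \<open>\<beta> = a c + e \<epsilon>\<close>.
  Since \<open>a\<close> and \<open>c\<close> have no common factor, the augmentation of an element of the intersection is
  \<open>a\<^sup>2 c t\<close> for some \<open>t\<close>, and comparing the coefficients of \<open>\<epsilon>\<close> shows that exactly the \<open>t\<close> in the
  colon ideal occur.  As the augmentation is a ring homomorphism, generators of the intersection
  yield generators of the colon ideal.
\<close>

lemma (in domain) colon_ideal_fin_gen:
  assumes char2: "\<one> \<oplus> \<one> = \<zero>"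
    and R: "a \<in> carrier R" "c \<in> carrier R" "e \<in> carrier R" and nz: "a \<noteq> \<zero>" "c \<noteq> \<zero>"
    and coprime: "\<And>x z. x \<in> carrier R \<Longrightarrow> z \<in> carrier R \<Longrightarrow> c \<otimes> x = a \<otimes> z \<Longrightarrow> \<exists>u\<in>carrier R. x = a \<otimes> u"
    and fc: "finite_conductor_ring (group_ring R C2)"
  shows "fin_gen_ideal R {t \<in> carrier R. \<exists>y\<in>carrier R. \<exists>w\<in>carrier R. e \<otimes> t = a \<otimes> y \<oplus> c \<otimes> w}"
    (is "fin_gen_ideal R ?J")
proof -
  interpret RG: cring RC2 by (rule RC2_cring)
  have double: "x \<oplus> x = \<zero>" if "x \<in> carrier R" for x
  proof -
    have "x \<oplus> x = (\<one> \<oplus> \<one>) \<otimes> x" using that by (simp add: l_distr)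
    then show ?thesis using that by (simp add: char2)
  qed
  define k where "k = a \<otimes> c \<otimes> a"
  have k: "k \<in> carrier R" "k \<noteq> \<zero>" using R nz by (auto simp: k_def integral_iff)
  define \<alpha> \<beta> where "\<alpha> = C2_elem R (a \<otimes> a) \<zero>" and "\<beta> = C2_elem R (a \<otimes> c \<oplus> e) e"
  have \<alpha>\<beta>: "\<alpha> \<in> carrier RC2" "\<beta> \<in> carrier RC2"
    using R by (auto simp: \<alpha>_def \<beta>_def intro!: C2_elem_closed)
  have aug: "augmentation \<alpha> = a \<otimes> a" "augmentation \<beta> = a \<otimes> c"
    using R by (simp_all add: \<alpha>_def \<beta>_def a_assoc double)
  have "fin_gen_ideal RC2 (PIdl\<^bsub>RC2\<^esub> \<alpha> \<inter> PIdl\<^bsub>RC2\<^esub> \<beta>)"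
    using fc \<alpha>\<beta> by (simp add: finite_conductor_ring_def)
  then obtain S where S: "S \<subseteq> carrier RC2" "finite S" "PIdl\<^bsub>RC2\<^esub> \<alpha> \<inter> PIdl\<^bsub>RC2\<^esub> \<beta> = Idl\<^bsub>RC2\<^esub> S"
    unfolding fin_gen_ideal_def by blast
  \<comment> \<open>the elements \<open>t\<close> belonging to the given generators of the intersection\<close>
  define T where "T = {t \<in> carrier R. \<exists>s\<in>S. augmentation s = k \<otimes> t}"
  have TR: "T \<subseteq> carrier R" by (auto simp: T_def)
  have inj: "inj_on (\<lambda>t. k \<otimes> t) T"
  proof (rule inj_onI)
    fix t u assume "t \<in> T" "u \<in> T" "k \<otimes> t = k \<otimes> u"
    then show "t = u" using k TR m_lcancel[of k t u] by blast
  qed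
  have "(\<lambda>t. k \<otimes> t) ` T \<subseteq> augmentation ` S"
  proof
    fix v assume "v \<in> (\<lambda>t. k \<otimes> t) ` T"
    then obtain t s where "v = k \<otimes> t" "s \<in> S" "augmentation s = k \<otimes> t" unfolding T_def by blast
    then show "v \<in> augmentation ` S" by (metis imageI)
  qed
  then have "finite ((\<lambda>t. k \<otimes> t) ` T)" using S(2) by (rule finite_subset[OF _ finite_imageI])
  then have T_fin: "finite T" using inj by (rule finite_imageD)
  have S_mem: "\<exists>g\<in>carrier RC2. \<exists>h\<in>carrier RC2. s = g \<otimes>\<^bsub>RC2\<^esub> \<beta> \<and> s = h \<otimes>\<^bsub>RC2\<^esub> \<alpha>" if "s \<in> S" for s
  proof -
    have "s \<in> PIdl\<^bsub>RC2\<^esub> \<alpha> \<inter> PIdl\<^bsub>RC2\<^esub> \<beta>"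
      unfolding S(3) using RG.genideal_self[OF S(1)] that by blast
    then show ?thesis unfolding cgenideal_def by blast
  qed
  have J: "ideal ?J R"
  proof (rule ideal_of_closed)
    show "\<zero> \<in> ?J" using R by (auto intro!: bexI[of _ "\<zero>"])
  next
    fix t t' assume "t \<in> ?J" "t' \<in> ?J"
    then obtain y w y' w' where t: "t \<in> carrier R" "t' \<in> carrier R"
      and yw: "y \<in> carrier R" "w \<in> carrier R" "y' \<in> carrier R" "w' \<in> carrier R"
      and eq: "e \<otimes> t = a \<otimes> y \<oplus> c \<otimes> w" "e \<otimes> t' = a \<otimes> y' \<oplus> c \<otimes> w'" by blast
    have "e \<otimes> (t \<oplus> t') = a \<otimes> (y \<oplus> y') \<oplus> c \<otimes> (w \<oplus> w')"
      using t yw R by (simp add: r_distr eq a_ac)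
    then show "t \<oplus> t' \<in> ?J" using t yw by blast
  next
    fix r t assume r: "r \<in> carrier R" and "t \<in> ?J"
    then obtain y w where t: "t \<in> carrier R"
      and yw: "y \<in> carrier R" "w \<in> carrier R" and eq: "e \<otimes> t = a \<otimes> y \<oplus> c \<otimes> w" by blast
    have "e \<otimes> (r \<otimes> t) = r \<otimes> (e \<otimes> t)" using r t R by (simp add: m_ac)
    also have "\<dots> = a \<otimes> (r \<otimes> y) \<oplus> c \<otimes> (r \<otimes> w)"
      unfolding eq using r yw R by (simp add: r_distr m_ac)
    finally show "r \<otimes> t \<in> ?J" using r t yw by blast
  qed auto
  have "T \<subseteq> ?J"
  proof
    fix t assume "t \<in> T"
    then obtain s where t: "t \<in> carrier R" and s: "s \<in> S" "augmentation s = k \<otimes> t" by (auto simp: T_def)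
    obtain g h where gh: "g \<in> carrier RC2" "h \<in> carrier RC2" "s = g \<otimes>\<^bsub>RC2\<^esub> \<beta>" "s = h \<otimes>\<^bsub>RC2\<^esub> \<alpha>"
      using S_mem[OF s(1)] by blast
    obtain g0 g1 h0 h1 where c: "g0 \<in> carrier R" "g1 \<in> carrier R" "h0 \<in> carrier R" "h1 \<in> carrier R"
      and gh': "g = C2_elem R g0 g1" "h = C2_elem R h0 h1" using RC2_elem gh by metis
    have "(a \<otimes> c) \<otimes> (g0 \<oplus> g1) = (a \<otimes> c) \<otimes> (a \<otimes> t)"
    proof -
      have "(g0 \<oplus> g1) \<otimes> (a \<otimes> c) = k \<otimes> t"
        using s(2) augmentation_mult[OF gh(1) \<alpha>\<beta>(2)] gh(3) by (simp add: gh' aug)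
      then show ?thesis using R c t by (simp add: k_def m_ac)
    qed
    then have g: "g0 \<oplus> g1 = a \<otimes> t"
      using R c t nz by (subst (asm) m_lcancel) (auto simp: integral_iff)
    have "C2_elem R (g0 \<otimes> (a \<otimes> c \<oplus> e) \<oplus> g1 \<otimes> e) (g0 \<otimes> e \<oplus> g1 \<otimes> (a \<otimes> c \<oplus> e)) 1
        = C2_elem R (h0 \<otimes> (a \<otimes> a) \<oplus> h1 \<otimes> \<zero>) (h0 \<otimes> \<zero> \<oplus> h1 \<otimes> (a \<otimes> a)) 1"
      using gh(3,4) c R unfolding gh' \<alpha>_def \<beta>_def by (simp add: C2_elem_mult)
    then have eq: "g0 \<otimes> e \<oplus> g1 \<otimes> (a \<otimes> c \<oplus> e) = h1 \<otimes> (a \<otimes> a)"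
      using c R by (simp add: C2_elem_def)
    have "a \<otimes> (e \<otimes> t) = (g0 \<oplus> g1) \<otimes> e"
      unfolding g using R t by (simp add: m_ac)
    also have "\<dots> = (g0 \<otimes> e \<oplus> g1 \<otimes> (a \<otimes> c \<oplus> e)) \<oplus> a \<otimes> (c \<otimes> (\<ominus> g1))"
      using c R by algebra
    also have "\<dots> = a \<otimes> (a \<otimes> h1 \<oplus> c \<otimes> (\<ominus> g1))"
      unfolding eq using c R by algebra
    finally have "e \<otimes> t = a \<otimes> h1 \<oplus> c \<otimes> (\<ominus> g1)"
      using c R t nz by (subst (asm) m_lcancel) auto
    then show "t \<in> ?J" using t c by (intro CollectI conjI bexI[of _ h1] bexI[of _ "\<ominus> g1"]) auto
  qed
  then have 1: "Idl T \<subseteq> ?J" by (rule genideal_minimal[OF J])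
  interpret T: ideal "Idl T" R by (rule genideal_ideal[OF TR])
  \<comment> \<open>an ideal of the group ring that contains the generators, hence the whole intersection\<close>
  define K where "K = {h \<in> carrier RC2. \<exists>t\<in>Idl T. augmentation h = k \<otimes> t}"
  have K: "ideal K RC2"
  proof (rule RG.ideal_of_closed)
    show "\<zero>\<^bsub>RC2\<^esub> \<in> K" using k T.zero_closed by (auto simp: K_def augmentation_zero intro!: bexI[of _ "\<zero>"])
  next
    fix f g assume "f \<in> K" "g \<in> K"
    then obtain t u where "t \<in> Idl T" "u \<in> Idl T" "f \<in> carrier RC2" "g \<in> carrier RC2"
      "augmentation f = k \<otimes> t" "augmentation g = k \<otimes> u" by (auto simp: K_def)
    then show "f \<oplus>\<^bsub>RC2\<^esub> g \<in> K" unfolding K_def using k T.Icarr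
      by (intro CollectI conjI bexI[of _ "t \<oplus> u"]) (auto simp: augmentation_add r_distr)
  next
    fix r g assume r: "r \<in> carrier RC2" and "g \<in> K"
    then obtain u where u: "u \<in> Idl T" "g \<in> carrier RC2" "augmentation g = k \<otimes> u" by (auto simp: K_def)
    then show "r \<otimes>\<^bsub>RC2\<^esub> g \<in> K" unfolding K_def using k T.Icarr r augmentation_closed[OF r] T.I_l_closed
      by (intro CollectI conjI bexI[of _ "augmentation r \<otimes> u"]) (auto simp: augmentation_mult m_lcomm)
  qed (auto simp: K_def)
  have "S \<subseteq> K"
  proof
    fix s assume s: "s \<in> S"
    obtain g h where gh: "g \<in> carrier RC2" "h \<in> carrier RC2" "s = g \<otimes>\<^bsub>RC2\<^esub> \<beta>" "s = h \<otimes>\<^bsub>RC2\<^esub> \<alpha>"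
      using S_mem[OF s] by blast
    have c: "augmentation g \<in> carrier R" "augmentation h \<in> carrier R" using gh augmentation_closed by auto
    have "augmentation g \<otimes> (a \<otimes> c) = augmentation h \<otimes> (a \<otimes> a)"
      using gh augmentation_mult \<alpha>\<beta> aug by metis
    then have "a \<otimes> (c \<otimes> augmentation g) = a \<otimes> (a \<otimes> augmentation h)"
      using c R by (simp add: m_ac)
    then have "c \<otimes> augmentation g = a \<otimes> augmentation h"
      using c R nz by (subst (asm) m_lcancel) auto
    then obtain u where u: "u \<in> carrier R" "augmentation g = a \<otimes> u" using coprime c by blast
    have s_aug: "augmentation s = k \<otimes> u"
      using gh(3) augmentation_mult[OF gh(1) \<alpha>\<beta>(2)] u R by (simp add: aug k_def m_ac)
    then have "u \<in> T" using s u by (auto simp: T_def)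
    then have "u \<in> Idl T" using genideal_self[OF TR] by blast
    then show "s \<in> K" using s S(1) s_aug by (auto simp: K_def)
  qed
  then have SK: "Idl\<^bsub>RC2\<^esub> S \<subseteq> K" by (rule RG.genideal_minimal[OF K])
  have 2: "?J \<subseteq> Idl T"
  proof
    fix t assume "t \<in> ?J"
    then obtain y w where t: "t \<in> carrier R"
      and yw: "y \<in> carrier R" "w \<in> carrier R" and eq: "e \<otimes> t = a \<otimes> y \<oplus> c \<otimes> w" by blast
    \<comment> \<open>the cofactors witnessing that \<open>a\<^sup>2 (c t + y \<epsilon>)\<close> lies in both principal ideals\<close>
    define g h where "g = C2_elem R (a \<otimes> t \<oplus> w) (\<ominus> w)" and "h = C2_elem R (c \<otimes> t \<ominus> y) y"
    have gh: "g \<in> carrier RC2" "h \<in> carrier RC2"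
      using R t yw by (auto simp: g_def h_def intro!: C2_elem_closed)
    define s1 s0 where "s1 = (a \<otimes> t \<oplus> w) \<otimes> e \<oplus> (\<ominus> w) \<otimes> (a \<otimes> c \<oplus> e)"
      and "s0 = (a \<otimes> t \<oplus> w) \<otimes> (a \<otimes> c \<oplus> e) \<oplus> (\<ominus> w) \<otimes> e"
    have sR: "s0 \<in> carrier R" "s1 \<in> carrier R" using R t yw by (auto simp: s0_def s1_def)
    have gb: "g \<otimes>\<^bsub>RC2\<^esub> \<beta> = C2_elem R s0 s1"
      unfolding g_def \<beta>_def s0_def s1_def using R t yw by (intro C2_elem_mult) auto
    have ha: "h \<otimes>\<^bsub>RC2\<^esub> \<alpha> = C2_elem R ((c \<otimes> t \<ominus> y) \<otimes> (a \<otimes> a)) (y \<otimes> (a \<otimes> a))"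
      unfolding h_def \<alpha>_def using R t yw by (simp add: C2_elem_mult)
    have "s1 = a \<otimes> (e \<otimes> t) \<ominus> a \<otimes> (c \<otimes> w)"
      unfolding s1_def using R t yw by algebra
    also have "\<dots> = y \<otimes> (a \<otimes> a)" unfolding eq using R yw by algebra
    finally have s1: "s1 = y \<otimes> (a \<otimes> a)" .
    have sum: "s0 \<oplus> s1 = (a \<otimes> c) \<otimes> (a \<otimes> t)"
    proof -
      have "s0 \<oplus> s1 = (a \<otimes> c) \<otimes> (a \<otimes> t) \<oplus> (e \<otimes> (a \<otimes> t) \<oplus> e \<otimes> (a \<otimes> t))"
        unfolding s0_def s1_def using R t yw by algebra
      then show ?thesis using R t by (simp add: double)
    qed
    have "s0 = (s0 \<oplus> s1) \<ominus> s1" using sR by algebra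
    also have "\<dots> = (a \<otimes> c) \<otimes> (a \<otimes> t) \<ominus> s1" by (simp only: sum)
    also have "\<dots> = (c \<otimes> t \<ominus> y) \<otimes> (a \<otimes> a)" unfolding s1 using R t yw by algebra
    finally have "g \<otimes>\<^bsub>RC2\<^esub> \<beta> = h \<otimes>\<^bsub>RC2\<^esub> \<alpha>" unfolding gb ha s1 by simp
    then have "g \<otimes>\<^bsub>RC2\<^esub> \<beta> \<in> PIdl\<^bsub>RC2\<^esub> \<alpha> \<inter> PIdl\<^bsub>RC2\<^esub> \<beta>"
      unfolding cgenideal_def using gh by blast
    then have "g \<otimes>\<^bsub>RC2\<^esub> \<beta> \<in> K" using SK S(3) by blast
    then obtain u where u: "u \<in> Idl T" "augmentation (g \<otimes>\<^bsub>RC2\<^esub> \<beta>) = k \<otimes> u" by (auto simp: K_def)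
    have "k \<otimes> u = k \<otimes> t" using u(2) R t by (simp add: gb sum k_def m_ac)
    then have "u = t" using k t T.Icarr[OF u(1)] by (subst (asm) m_lcancel) auto
    then show "t \<in> Idl T" using u by simp
  qed
  show ?thesis unfolding fin_gen_ideal_def using 1 2 T_fin TR by blast
qed

section \<open>Gauss's lemma over a factor-closed subring\<close>

text \<open>
  The unqualified constant \<open>irreducible\<close> refers to the carrier-based notion for monoids.
\<close>

abbreviation irreducible_elem :: "'a::comm_semiring_1 \<Rightarrow> bool" where
  "irreducible_elem \<equiv> comm_semiring_1_class.irreducible"

text \<open>
  Polynomials with coefficients in a subring are treated inside the polynomial ring over the whole
  type, because the subrings to which this is applied, polynomials in the first \<open>N\<close> variables, depend
  on a number.  Closure under factors ensures that divisibility, units and irreducibility in the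
  subring agree with those of the surrounding ring.
\<close>

locale factor_closed_subring =
  fixes S :: "'a::idom set"
  assumes zero_mem [simp]: "0 \<in> S" and one_mem [simp]: "1 \<in> S"
    and add_mem: "x \<in> S \<Longrightarrow> y \<in> S \<Longrightarrow> x + y \<in> S"
    and uminus_mem: "x \<in> S \<Longrightarrow> - x \<in> S"
    and mult_mem: "x \<in> S \<Longrightarrow> y \<in> S \<Longrightarrow> x * y \<in> S"
    and factor_mem: "x * y \<in> S \<Longrightarrow> x * y \<noteq> 0 \<Longrightarrow> x \<in> S"
begin

definition coeffs_in :: "'a poly \<Rightarrow> bool" where
  "coeffs_in f \<longleftrightarrow> (\<forall>k. coeff f k \<in> S)"

lemma sum_mem: "(\<And>i. i \<in> I \<Longrightarrow> h i \<in> S) \<Longrightarrow> sum h I \<in> S"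
  by (induction I rule: infinite_finite_induct) (auto intro: add_mem)

lemma coeffs_in_0 [simp]: "coeffs_in 0"
  by (simp add: coeffs_in_def)

lemma coeffs_in_add: "coeffs_in f \<Longrightarrow> coeffs_in g \<Longrightarrow> coeffs_in (f + g)"
  by (simp add: coeffs_in_def add_mem)

lemma coeffs_in_diff: "coeffs_in f \<Longrightarrow> coeffs_in g \<Longrightarrow> coeffs_in (f - g)"
  using add_mem uminus_mem by (simp add: coeffs_in_def) (metis add_uminus_conv_diff)

lemma coeffs_in_mult: "coeffs_in f \<Longrightarrow> coeffs_in g \<Longrightarrow> coeffs_in (f * g)"
  by (auto simp: coeffs_in_def coeff_mult intro!: sum_mem mult_mem)

lemma coeffs_in_monom: "c \<in> S \<Longrightarrow> coeffs_in (monom c n)"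
  by (simp add: coeffs_in_def)

lemma coeffs_in_const: "c \<in> S \<Longrightarrow> coeffs_in [:c:]"
  using coeffs_in_monom[of c 0] by (simp add: monom_0)

lemma coeffs_in_smult: "c \<in> S \<Longrightarrow> coeffs_in f \<Longrightarrow> coeffs_in (smult c f)"
  by (simp add: coeffs_in_def mult_mem)

lemma coeffs_in_smult_cancel: "coeffs_in (smult c f) \<Longrightarrow> c \<noteq> 0 \<Longrightarrow> coeffs_in f"
  unfolding coeffs_in_def coeff_smult
  by (metis factor_mem mult.commute no_zero_divisors zero_mem)

lemma pseudo_division:
  assumes "coeffs_in p" "coeffs_in r" "r \<noteq> 0"
  shows "\<exists>b q s. b \<in> S \<and> b \<noteq> 0 \<and> coeffs_in q \<and> coeffs_in s \<and> smult b p = q * r + s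
           \<and> (s = 0 \<or> degree s < degree r)"
  using assms(1)
proof (induction "if p = 0 then 0 else Suc (degree p)" arbitrary: p rule: less_induct)
  case less
  let ?l = "coeff r (degree r)"
  have l: "?l \<in> S" "?l \<noteq> 0" using assms by (auto simp: coeffs_in_def)
  show ?case
  proof (cases "p = 0 \<or> degree p < degree r")
    case True
    then show ?thesis
      by (intro exI[of _ 1] exI[of _ 0] exI[of _ p]) (use less.prems in auto)
  next
    case False
    \<comment> \<open>one step of the division: the leading terms cancel after multiplication by the leading coefficient of \<open>r\<close>\<close>
    define m where "m = monom (coeff p (degree p)) (degree p - degree r)"
    define p' where "p' = smult ?l p - m * r"
    have m: "coeffs_in m" using less.prems by (auto simp: m_def coeffs_in_def)
    have p': "coeffs_in p'" unfolding p'_def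
      by (intro coeffs_in_diff coeffs_in_smult coeffs_in_mult m l assms less.prems)
    have "degree (m * r) \<le> degree p"
      using degree_mult_le[of m r] degree_monom_le[of "coeff p (degree p)" "degree p - degree r"] False
      unfolding m_def by linarith
    then have "degree p' \<le> degree p"
      unfolding p'_def by (intro degree_diff_le) auto
    moreover have "coeff p' (degree p) = 0"
    proof -
      have "coeff (m * r) (degree p) = coeff p (degree p) * ?l"
        using coeff_monom_mult[of "coeff p (degree p)" "degree p - degree r" r "degree p"] False
        by (simp add: m_def)
      then show ?thesis by (simp add: p'_def)
    qed
    ultimately have "p' = 0 \<or> degree p' < degree p"
      by (metis leading_coeff_0_iff le_neq_implies_less)
    then have "(if p' = 0 then 0 else Suc (degree p')) < (if p = 0 then 0 else Suc (degree p))"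
      using False by auto
    from less.hyps[OF this p'] obtain b q s where
      bqs: "b \<in> S" "b \<noteq> 0" "coeffs_in q" "coeffs_in s" "smult b p' = q * r + s" "s = 0 \<or> degree s < degree r"
      by blast
    have "smult (b * ?l) p = smult b p' + smult b (m * r)"
      by (simp add: p'_def smult_diff_right)
    also have "\<dots> = (q + smult b m) * r + s"
      by (simp add: bqs(5) algebra_simps)
    finally have "smult (b * ?l) p = (q + smult b m) * r + s" .
    moreover have "coeffs_in (q + smult b m)" by (intro coeffs_in_add coeffs_in_smult bqs m)
    ultimately show ?thesis
      using bqs l mult_mem by (intro exI[of _ "b * ?l"] exI[of _ "q + smult b m"] exI[of _ s]) auto
  qed
qed

end

locale factorial_subring = factor_closed_subring +
  assumes factorization: "b \<in> S \<Longrightarrow> b \<noteq> 0 \<Longrightarrow>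
      \<exists>A u. u dvd 1 \<and> (\<forall>x\<in>#A. irreducible_elem x) \<and> b = u * prod_mset A"
    and irreducible_prime: "c \<in> S \<Longrightarrow> irreducible_elem c \<Longrightarrow> x \<in> S \<Longrightarrow> y \<in> S \<Longrightarrow> c dvd x * y
      \<Longrightarrow> c dvd x \<or> c dvd y"
begin

text \<open>
  If \<open>c\<close> divided neither factor, consider the lowest coefficients not divisible by \<open>c\<close>, say with
  indices \<open>i\<close> and \<open>j\<close>: every other summand of the coefficient of degree \<open>i + j\<close> of the product is
  divisible by \<open>c\<close>.
\<close>

lemma const_dvd_mult:
  assumes c: "c \<in> S" "irreducible_elem c" and f: "coeffs_in f" and g: "coeffs_in g" and dvd: "[:c:] dvd f * g"
  shows "[:c:] dvd f \<or> [:c:] dvd g"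
proof (rule ccontr)
  assume "\<not> ?thesis"
  then obtain i0 j0 where ij0: "\<not> c dvd coeff f i0" "\<not> c dvd coeff g j0"
    by (auto simp: const_poly_dvd_iff)
  define i where "i = (LEAST i. \<not> c dvd coeff f i)"
  define j where "j = (LEAST j. \<not> c dvd coeff g j)"
  have i: "\<not> c dvd coeff f i" "\<And>k. k < i \<Longrightarrow> c dvd coeff f k"
    using LeastI[of "\<lambda>i. \<not> c dvd coeff f i", OF ij0(1)] not_less_Least unfolding i_def by blast+
  have j: "\<not> c dvd coeff g j" "\<And>k. k < j \<Longrightarrow> c dvd coeff g k"
    using LeastI[of "\<lambda>i. \<not> c dvd coeff g i", OF ij0(2)] not_less_Least unfolding j_def by blast+
  have "c dvd coeff f k * coeff g (i + j - k)" if "k \<in> {..i + j} - {i}" for k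
  proof (cases "k < i")
    case False
    then have "i + j - k < j" using that by auto
    then show ?thesis using j by auto
  qed (use i in auto)
  then have "c dvd (\<Sum>k\<in>{..i + j} - {i}. coeff f k * coeff g (i + j - k))"
    by (rule dvd_sum)
  moreover have "coeff (f * g) (i + j) = coeff f i * coeff g j +
      (\<Sum>k\<in>{..i + j} - {i}. coeff f k * coeff g (i + j - k))"
    by (subst coeff_mult, subst sum.remove[of _ i]) auto
  moreover have "c dvd coeff (f * g) (i + j)"
    using dvd by (auto simp: const_poly_dvd_iff)
  ultimately have "c dvd coeff f i * coeff g j"
    by (simp add: dvd_add_left_iff)
  then show False
    using irreducible_prime[OF c, of "coeff f i" "coeff g j"] f g i j by (auto simp: coeffs_in_def)
qed

text \<open>
  The irreducible factors of \<open>b\<close> are distributed one by one among \<open>q\<close> and \<open>r\<close>.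
\<close>

lemma split_constant:
  assumes "b \<in> S" "b \<noteq> 0" "coeffs_in h" "coeffs_in q" "coeffs_in r" "smult b h = q * r"
  shows "\<exists>b1 b2 q' r'. q = smult b1 q' \<and> r = smult b2 r' \<and> h = q' * r'"
proof -
  obtain A u where "u dvd 1" "\<forall>x\<in>#A. irreducible_elem x" "b = u * prod_mset A"
    using factorization assms by blast
  then show ?thesis using assms
  proof (induction A arbitrary: b q r)
    case empty
    then obtain v where v: "u * v = 1" by (metis dvdE)
    have "smult u (smult v q) = q" using v by simp
    moreover have "h = smult (v * b) h" using v empty by (simp add: mult.commute)
    then have "h = smult v q * r" using empty.prems by (metis mult_smult_left smult_smult)
    ultimately show ?case
      by (intro exI[of _ u] exI[of _ 1] exI[of _ "smult v q"] exI[of _ r]) auto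
  next
    case (add c A)
    define b' where "b' = u * prod_mset A"
    have b: "b = c * b'" using add.prems by (simp add: b'_def mult_ac)
    have cS: "c \<in> S" "b' \<in> S" using add.prems factor_mem[of c b'] factor_mem[of b' c] b
      by (auto simp: mult.commute)
    have c0: "c \<noteq> 0" "b' \<noteq> 0" using add.prems b by auto
    have c: "irreducible_elem c" using add.prems by auto
    have "q * r = [:c:] * smult b' h" using add.prems(9) b by (simp add: mult.commute)
    then have "[:c:] dvd q * r" by (metis dvd_triv_left)
    then have "[:c:] dvd q \<or> [:c:] dvd r"
      using const_dvd_mult[OF cS(1) c add.prems(7,8)] by simp
    then consider q1 where "q = smult c q1" | r1 where "r = smult c r1"
      by (auto elim!: dvdE)
    then show ?case
    proof cases
      case 1
      have q1: "coeffs_in q1" using coeffs_in_smult_cancel add.prems 1 c0 by blast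
      have "smult c (smult b' h) = smult c (q1 * r)" using add.prems(9) b 1 by simp
      then have "smult b' h = q1 * r" using c0 smult_cancel by blast
      then obtain b1 b2 q' r' where "q1 = smult b1 q'" "r = smult b2 r'" "h = q' * r'"
        using add.IH[OF add.prems(1) _ b'_def cS(2) c0(2) add.prems(6) q1 add.prems(8)] add.prems(2)
        by auto
      then show ?thesis using 1 by (metis smult_smult)
    next
      case 2
      have r1: "coeffs_in r1" using coeffs_in_smult_cancel add.prems 2 c0 by blast
      have "smult c (smult b' h) = smult c (q * r1)" using add.prems(9) b 2 by simp
      then have "smult b' h = q * r1" using c0 smult_cancel by blast
      then obtain b1 b2 q' r' where "q = smult b1 q'" "r1 = smult b2 r'" "h = q' * r'"
        using add.IH[OF add.prems(1) _ b'_def cS(2) c0(2) add.prems(6) add.prems(7) r1] add.prems(2)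
        by auto
      then show ?thesis using 2 by (metis smult_smult)
    qed
  qed
qed

text \<open>
  When the constant \<open>b\<close> is split between \<open>p\<close> and \<open>w\<close>, the part taken from \<open>p\<close> is a unit, because \<open>p\<close>
  is irreducible of positive degree.
\<close>

lemma dvd_of_smult:
  assumes p: "irreducible_elem p" "degree p > 0" "coeffs_in p" and w: "coeffs_in w" and g: "coeffs_in g"
    and b: "b \<in> S" "b \<noteq> 0" "smult b g = p * w"
  shows "p dvd g"
proof -
  obtain b1 b2 q r where qr: "p = smult b1 q" "w = smult b2 r" "g = q * r"
    using split_constant[OF b(1,2) g p(3) w b(3)] by blast
  have "b1 \<noteq> 0" using p qr by auto
  then have "\<not> q dvd 1" using p(2) qr(1) by (auto simp: is_unit_poly_iff)
  have "p = [:b1:] * q" using qr by simp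
  then have "[:b1:] dvd 1" using comm_semiring_1_class.irreducibleD[OF p(1)] \<open>\<not> q dvd 1\<close> by blast
  then obtain v where "1 = [:b1:] * v" by (elim dvdE)
  then have "q = p * v" unfolding \<open>p = [:b1:] * q\<close> by (metis mult.assoc mult.commute mult_1)
  then have "p dvd q" by simp
  then show ?thesis using qr by simp
qed

text \<open>
  Gauss's lemma, without a field of fractions.  The cofactor \<open>h\<close> is required to have coefficients in
  \<open>S\<close> as well, so that divisibility is meant in \<open>S[X]\<close>.  In the ideal of \<open>S[X]\<close> generated by \<open>p\<close> and
  \<open>f\<close>, choose \<open>r \<noteq> 0\<close> of least degree.  By pseudo-division it divides a constant multiple of every
  member, so \<open>p = q' r'\<close> with \<open>r\<close> a constant times \<open>r'\<close>.  If \<open>r'\<close> is a unit, then \<open>r\<close> is a constant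
  and \<open>r g\<close> is a multiple of \<open>p\<close>, hence so is \<open>g\<close>; otherwise \<open>r'\<close> is associated to \<open>p\<close> and divides
  \<open>f\<close>.
\<close>

theorem irreducible_poly_prime:
  assumes p: "irreducible_elem p" "coeffs_in p" and f: "coeffs_in f" and g: "coeffs_in g" and h: "coeffs_in h"
    and eq: "f * g = p * h"
  shows "p dvd f \<or> p dvd g"
proof (cases "degree p = 0")
  case True
  then obtain c where c: "p = [:c:]" by (metis degree_eq_zeroE)
  have "c \<in> S" using p(2) by (auto simp: c coeffs_in_def coeff_pCons split: nat.splits)
  then show ?thesis
    using const_dvd_mult[of c f g] p(1) f g eq c
    by (metis dvd_triv_left irreducible_const_poly_iff)
next
  case False
  then have deg: "degree p > 0" by simp
  show ?thesis
  proof (rule disjCI)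
    assume ng: "\<not> p dvd g"
    define I where "I = {u * f + v * p | u v. coeffs_in u \<and> coeffs_in v}"
    have coeffs_in_1: "coeffs_in 1" using coeffs_in_const[of 1] by (simp add: one_pCons)
    have pI: "p \<in> I" unfolding I_def using coeffs_in_1 by (intro CollectI exI[of _ 0] exI[of _ 1]) auto
    have fI: "f \<in> I" unfolding I_def using coeffs_in_1 by (intro CollectI exI[of _ 0] exI[of _ 1]) auto
    have coeffs_inI: "coeffs_in x" if "x \<in> I" for x
      using that p f coeffs_in_add coeffs_in_mult by (auto simp: I_def)
    have p0: "p \<noteq> 0" using p by auto
    obtain r where r: "r \<in> I" "r \<noteq> 0" and rmin: "\<And>s. s \<in> I \<Longrightarrow> s \<noteq> 0 \<Longrightarrow> degree r \<le> degree s"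
      using ex_has_least_nat[of "\<lambda>x. x \<in> I \<and> x \<noteq> 0" p degree] pI p0 by blast
    obtain u v where uv: "coeffs_in u" "coeffs_in v" "r = u * f + v * p" using r by (auto simp: I_def)
    \<comment> \<open>the remainder lies in the ideal, so it vanishes by minimality of the degree\<close>
    have r_divides: "\<exists>b q. b \<in> S \<and> b \<noteq> 0 \<and> coeffs_in q \<and> smult b x = q * r" if x: "x \<in> I" for x
    proof -
      obtain b q s where bqs: "b \<in> S" "b \<noteq> 0" "coeffs_in q" "coeffs_in s" "smult b x = q * r + s"
        "s = 0 \<or> degree s < degree r"
        using pseudo_division[OF coeffs_inI[OF x] coeffs_inI[OF r(1)] r(2)] by blast
      obtain u' v' where uv': "coeffs_in u'" "coeffs_in v'" "x = u' * f + v' * p" using x by (auto simp: I_def)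
      have "s = smult b x - q * r" using bqs(5) by simp
      also have "\<dots> = (smult b u' - q * u) * f + (smult b v' - q * v) * p"
        unfolding uv(3) uv'(3) by (simp add: algebra_simps smult_add_right)
      finally have "s = (smult b u' - q * u) * f + (smult b v' - q * v) * p" .
      moreover have "coeffs_in (smult b u' - q * u)" "coeffs_in (smult b v' - q * v)"
        by (intro coeffs_in_diff coeffs_in_smult coeffs_in_mult uv uv' bqs)+
      ultimately have "s \<in> I" unfolding I_def by blast
      then have "s = 0" using rmin bqs(6) by force
      then show ?thesis using bqs by auto
    qed
    obtain b q where b: "b \<in> S" "b \<noteq> 0" "coeffs_in q" "smult b p = q * r" using r_divides[OF pI] by blast
    obtain b1 b2 q' r' where split: "q = smult b1 q'" "r = smult b2 r'" "p = q' * r'"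
      using split_constant[OF b(1,2) p(2) b(3) coeffs_inI[OF r(1)] b(4)] by blast
    have "\<not> r' dvd 1"
    proof
      assume "r' dvd 1"
      then have "degree r' = 0" by (auto simp: is_unit_poly_iff)
      then have "degree r = 0" using split(2) by simp
      then obtain c where c: "r = [:c:]" by (metis degree_eq_zeroE)
      have cS: "c \<in> S" "c \<noteq> 0" using coeffs_inI[OF r(1)] r(2)
        by (auto simp: c coeffs_in_def coeff_pCons split: nat.splits)
      have "smult c g = r * g" by (simp add: c)
      also have "\<dots> = p * (u * h + v * g)"
        using eq by (simp add: uv(3) algebra_simps)
      finally have "p dvd g"
        using dvd_of_smult[OF p(1) deg p(2) _ g cS, of "u * h + v * g"] coeffs_in_add coeffs_in_mult uv h g by blast
      then show False using ng by simp
    qed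
    then have "q' dvd 1" using comm_semiring_1_class.irreducibleD[OF p(1) split(3)] by blast
    then obtain v where "1 = q' * v" by (elim dvdE)
    then have "r' = p * v" unfolding split(3) by (metis mult.assoc mult.commute mult_1)
    then have pr: "p dvd r'" "r' dvd p" using split(3) dvd_triv_left dvd_triv_right by metis+
    have r0: "b2 \<noteq> 0" using r split by auto
    obtain b' q'' where b': "b' \<in> S" "b' \<noteq> 0" "coeffs_in q''" "smult b' f = q'' * r"
      using r_divides[OF fI] by blast
    have r': "coeffs_in r'" using coeffs_in_smult_cancel[of b2 r'] coeffs_inI[OF r(1)] split(2) r0 by simp
    have irr: "irreducible_elem r'"
      using irreducible_mono[OF p(1) pr(2)] \<open>\<not> r' dvd 1\<close> by blast
    have degr: "degree r' > 0"
      using deg dvd_imp_degree_le[OF pr(1)] irr by (cases "r' = 0") simp_all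
    have "b2 * coeff r' (degree r') \<in> S"
      using coeffs_inI[OF r(1)] split(2) by (simp add: coeffs_in_def)
    then have "b2 \<in> S" using factor_mem r0 irr by fastforce
    then have "coeffs_in (smult b2 q'')" using coeffs_in_smult b'(3) by blast
    then have "r' dvd f"
      using dvd_of_smult[OF irr degr r' _ f b'(1,2), of "smult b2 q''"] b'(4) split(2)
      by (simp add: mult.commute)
    then show "p dvd f" using pr dvd_trans by blast
  qed
qed

end

section \<open>Unique factorization in countably many variables\<close>

lemma poly_mapping_single_induct:
  assumes "P 0" and "\<And>p m c. P p \<Longrightarrow> P (p + Poly_Mapping.single m c)"
  shows "P (p :: 'm \<Rightarrow>\<^sub>0 'k::comm_monoid_add)"
proof -
  have sum: "P (\<Sum>m\<in>A. Poly_Mapping.single m (Poly_Mapping.lookup p m))" if "finite A" for A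
    using that
  proof induction
    case (insert m A)
    then show ?case using assms(2)[OF insert.IH] by (simp add: add.commute)
  qed (simp add: assms)
  have "p = (\<Sum>m\<in>Poly_Mapping.keys p. Poly_Mapping.single m (Poly_Mapping.lookup p m))"
    by (rule poly_mapping_eqI) (simp add: lookup_sum lookup_single when_def sum.delta in_keys_iff)
  then show ?thesis using sum[of "Poly_Mapping.keys p"] by simp
qed

text \<open>
  Substituting \<open>\<tau> m \<cdot> Z ^ w m\<close> for each monomial \<open>m\<close>, where \<open>Z\<close> is the variable of the polynomial
  ring in which the result lives.  When \<open>\<tau>\<close> and \<open>w\<close> are additive this is a ring homomorphism, and
  suitable choices give partial degrees, the separation of one variable, and permutations of
  variables.
\<close>

definition graded ::
    "('m \<Rightarrow> 'n::comm_monoid_add) \<Rightarrow> ('m \<Rightarrow> nat) \<Rightarrow> ('m \<Rightarrow>\<^sub>0 'k::comm_ring_1) \<Rightarrow> ('n \<Rightarrow>\<^sub>0 'k) poly" where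
  "graded \<tau> w p = (\<Sum>m\<in>Poly_Mapping.keys p. monom (Poly_Mapping.single (\<tau> m) (Poly_Mapping.lookup p m)) (w m))"

lemma graded_superset:
  assumes "finite A" "Poly_Mapping.keys p \<subseteq> A"
  shows "graded \<tau> w p = (\<Sum>m\<in>A. monom (Poly_Mapping.single (\<tau> m) (Poly_Mapping.lookup p m)) (w m))"
  unfolding graded_def by (rule sum.mono_neutral_left) (use assms in \<open>auto simp: in_keys_iff\<close>)

lemma graded_0 [simp]: "graded \<tau> w 0 = 0"
  by (simp add: graded_def)

lemma graded_single [simp]:
  "graded \<tau> w (Poly_Mapping.single m c) = monom (Poly_Mapping.single (\<tau> m) c) (w m)"
  by (subst graded_superset[of "{m}"]) auto

lemma graded_add: "graded \<tau> w (p + q) = graded \<tau> w p + graded \<tau> w q"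
proof -
  let ?A = "Poly_Mapping.keys p \<union> Poly_Mapping.keys q"
  have "Poly_Mapping.keys (p + q) \<subseteq> ?A" by (rule keys_add)
  then show ?thesis
    by (simp add: graded_superset[of ?A] lookup_add single_add add_monom[symmetric] sum.distrib)
qed

lemma coeff_graded:
  "coeff (graded \<tau> w p) k = (\<Sum>m\<in>Poly_Mapping.keys p. if w m = k then Poly_Mapping.single (\<tau> m) (Poly_Mapping.lookup p m) else 0)"
  by (simp add: graded_def coeff_sum)

lemma lookup_coeff_graded:
  assumes "inj (\<lambda>m. (\<tau> m, w m))"
  shows "Poly_Mapping.lookup (coeff (graded \<tau> w p) (w m)) (\<tau> m) = Poly_Mapping.lookup p m"
proof -
  have "Poly_Mapping.lookup (coeff (graded \<tau> w p) (w m)) (\<tau> m)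
      = (\<Sum>m'\<in>Poly_Mapping.keys p. if m' = m then Poly_Mapping.lookup p m' else 0)"
    unfolding coeff_graded lookup_sum
    by (rule sum.cong) (use assms in \<open>auto simp: lookup_single when_def inj_def\<close>)
  then show ?thesis by (simp add: in_keys_iff)
qed

lemma keys_coeff_graded: "Poly_Mapping.keys (coeff (graded \<tau> w p) k) \<subseteq> \<tau> ` Poly_Mapping.keys p"
proof
  fix n assume "n \<in> Poly_Mapping.keys (coeff (graded \<tau> w p) k)"
  then have "(\<Sum>m\<in>Poly_Mapping.keys p. Poly_Mapping.lookup (if w m = k then Poly_Mapping.single (\<tau> m) (Poly_Mapping.lookup p m) else 0) n) \<noteq> 0"
    by (simp add: in_keys_iff coeff_graded lookup_sum)
  then obtain m where "m \<in> Poly_Mapping.keys p" "Poly_Mapping.lookup (if w m = k then Poly_Mapping.single (\<tau> m) (Poly_Mapping.lookup p m) else 0) n \<noteq> 0"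
    by (meson sum.neutral)
  then show "n \<in> \<tau> ` Poly_Mapping.keys p" by (auto simp: lookup_single when_def split: if_splits)
qed

lemma inj_graded:
  assumes "inj (\<lambda>m. (\<tau> m, w m))"
  shows "inj (graded \<tau> w)"
  by (rule injI, rule poly_mapping_eqI) (metis lookup_coeff_graded[OF assms])

lemma graded_mult:
  fixes p :: "'m::comm_monoid_add \<Rightarrow>\<^sub>0 'k::comm_ring_1"
  assumes \<tau>: "\<And>a b. \<tau> (a + b) = \<tau> a + \<tau> b" and w: "\<And>a b. w (a + b) = w a + w b"
  shows "graded \<tau> w (p * q) = graded \<tau> w p * graded \<tau> w q"
proof -
  have 1: "graded \<tau> w (Poly_Mapping.single m c * q) = graded \<tau> w (Poly_Mapping.single m c) * graded \<tau> w q"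
    for m c
    by (induction q rule: poly_mapping_single_induct)
      (simp_all add: graded_add distrib_left mult_single mult_monom \<tau> w)
  show ?thesis
    by (induction p rule: poly_mapping_single_induct) (simp_all add: graded_add distrib_right 1)
qed

text \<open>
  Monomials are multisets of variable indices, so their sum is the product of monomials.
  The multiset order on them makes the polynomials an integral domain.
\<close>

definition vars_below :: "nat \<Rightarrow> (nat multiset \<Rightarrow>\<^sub>0 'k::zero) set" where
  "vars_below N = {p. \<forall>m\<in>Poly_Mapping.keys p. \<forall>i\<in>#m. i < N}"

text \<open>
  The total degree in the variables with index at least \<open>N\<close>.  Defining it as a degree in a polynomial
  ring over an integral domain makes it additive at once.
\<close>

definition tail_degree :: "nat \<Rightarrow> (nat multiset \<Rightarrow>\<^sub>0 'k::field) \<Rightarrow> nat" where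
  "tail_degree N p = degree (graded id (\<lambda>m. size (filter_mset (\<lambda>i. N \<le> i) m)) p)"

lemma tail_degree_mult:
  "p \<noteq> 0 \<Longrightarrow> q \<noteq> 0 \<Longrightarrow> tail_degree N (p * q) = tail_degree N p + tail_degree N q"
proof -
  have i: "inj (graded id (\<lambda>m. size (filter_mset (\<lambda>i. N \<le> i) m)))"
    by (rule inj_graded) (auto simp: inj_def)
  assume "p \<noteq> 0" "q \<noteq> 0"
  then show ?thesis unfolding tail_degree_def
    by (subst graded_mult) (use injD[OF i, of _ 0] in \<open>auto intro!: degree_mult_eq\<close>)
qed

lemma vars_below_iff: "p \<in> vars_below N \<longleftrightarrow> tail_degree N p = 0"
proof
  assume p: "p \<in> vars_below N"
  then have "filter_mset (\<lambda>i. N \<le> i) m = {#}" if "m \<in> Poly_Mapping.keys p" for m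
    using that unfolding vars_below_def filter_mset_eq_mempty_iff by (auto simp: not_le)
  then have "graded id (\<lambda>m. size (filter_mset (\<lambda>i. N \<le> i) m)) p
      = (\<Sum>m\<in>Poly_Mapping.keys p. [:Poly_Mapping.single m (Poly_Mapping.lookup p m):])"
    unfolding graded_def by (intro sum.cong refl) (simp only: id_apply size_empty monom_0)
  also have "degree \<dots> = 0"
    using degree_sum_le[of "Poly_Mapping.keys p" "\<lambda>m. [:Poly_Mapping.single m (Poly_Mapping.lookup p m):]" 0] by simp
  finally show "tail_degree N p = 0" by (simp add: tail_degree_def)
next
  let ?w = "\<lambda>m. size (filter_mset (\<lambda>i. N \<le> i) m)"
  assume d: "tail_degree N p = 0"
  have "filter_mset (\<lambda>i. N \<le> i) m = {#}" if "m \<in> Poly_Mapping.keys p" for m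
  proof -
    have "Poly_Mapping.lookup (coeff (graded id ?w p) (?w m)) (id m) = Poly_Mapping.lookup p m"
      by (rule lookup_coeff_graded) (auto simp: inj_def)
    then have "coeff (graded id ?w p) (?w m) \<noteq> 0" using that by (auto simp: in_keys_iff)
    then have "?w m \<le> 0" using le_degree d unfolding tail_degree_def by metis
    then show ?thesis by simp
  qed
  then show "p \<in> vars_below N"
    by (force simp: vars_below_def filter_mset_eq_mempty_iff)
qed

lemma factor_closed_vars_below:
  "factor_closed_subring (vars_below N :: (nat multiset \<Rightarrow>\<^sub>0 'k::field) set)"
proof
  fix p q :: "nat multiset \<Rightarrow>\<^sub>0 'k"
  show "0 \<in> vars_below N" "1 \<in> vars_below N" by (auto simp: vars_below_def)
  show "p \<in> vars_below N \<Longrightarrow> q \<in> vars_below N \<Longrightarrow> p + q \<in> vars_below N"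
    using keys_add[of p q] by (auto simp: vars_below_def)
  show "p \<in> vars_below N \<Longrightarrow> - p \<in> vars_below N"
    by (auto simp: vars_below_def in_keys_iff)
  show "p \<in> vars_below N \<Longrightarrow> q \<in> vars_below N \<Longrightarrow> p * q \<in> vars_below N"
    using keys_mult[of p q] by (fastforce simp: vars_below_def)
  show "p * q \<in> vars_below N \<Longrightarrow> p * q \<noteq> 0 \<Longrightarrow> p \<in> vars_below N"
    by (simp add: vars_below_iff tail_degree_mult)
qed

text \<open>
  Without variables only constants remain, and those are units in a polynomial ring over a field.
\<close>

lemma vars_below_0_unit:
  fixes p :: "nat multiset \<Rightarrow>\<^sub>0 'k::field"
  assumes "p \<in> vars_below 0" "p \<noteq> 0"
  shows "p dvd 1" "p = Poly_Mapping.single 0 (Poly_Mapping.lookup p 0)"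
proof -
  have k: "Poly_Mapping.keys p \<subseteq> {0}" using assms by (auto simp: vars_below_def)
  show p: "p = Poly_Mapping.single 0 (Poly_Mapping.lookup p 0)"
    by (rule poly_mapping_eqI) (use k in \<open>auto simp: lookup_single when_def in_keys_iff\<close>)
  then have "Poly_Mapping.lookup p 0 \<noteq> 0" using assms by force
  then have "p * Poly_Mapping.single 0 (inverse (Poly_Mapping.lookup p 0)) = 1"
    by (subst p) (simp add: mult_single)
  then show "p dvd 1" by (metis dvd_triv_left)
qed

lemma irreducible_factorization:
  fixes p :: "nat multiset \<Rightarrow>\<^sub>0 'k::field"
  assumes "p \<noteq> 0"
  shows "\<exists>A u. u dvd 1 \<and> (\<forall>x\<in>#A. irreducible_elem x) \<and> p = u * prod_mset A"
  using assms
proof (induction "tail_degree 0 p" arbitrary: p rule: less_induct)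
  case less
  consider "p dvd 1" | "irreducible_elem p" | "\<not> p dvd 1" "\<not> irreducible_elem p" by blast
  then show ?case
  proof cases
    case 1
    then show ?thesis by (intro exI[of _ "{#}"] exI[of _ p]) auto
  next
    case 2
    then show ?thesis by (intro exI[of _ "{#p#}"] exI[of _ 1]) auto
  next
    case 3
    then obtain a b where ab: "p = a * b" "\<not> a dvd 1" "\<not> b dvd 1"
      using less.prems by (auto simp: comm_semiring_1_class.irreducible_def)
    have 0: "a \<noteq> 0" "b \<noteq> 0" using ab less.prems by auto
    have "tail_degree 0 a > 0" "tail_degree 0 b > 0"
      using vars_below_0_unit 0 ab vars_below_iff by blast+
    then have "tail_degree 0 a < tail_degree 0 p" "tail_degree 0 b < tail_degree 0 p"
      by (simp_all add: ab 0 tail_degree_mult)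
    then obtain A u B v where "u dvd 1" "\<forall>x\<in>#A. irreducible_elem x" "a = u * prod_mset A"
      "v dvd 1" "\<forall>x\<in>#B. irreducible_elem x" "b = v * prod_mset B"
      using less.hyps 0 by metis
    then show ?thesis
      using mult_dvd_mono[of u 1 v 1]
      by (intro exI[of _ "A + B"] exI[of _ "u * v"]) (auto simp: ab mult_ac)
  qed
qed

text \<open>
  The first variable becomes the variable of a univariate polynomial ring, and the indices of the
  others are shifted down by one.  Since there are infinitely many variables, this is an isomorphism
  onto the polynomials over the same ring.
\<close>

definition split_var :: "(nat multiset \<Rightarrow>\<^sub>0 'k::field) \<Rightarrow> (nat multiset \<Rightarrow>\<^sub>0 'k) poly" where
  "split_var = graded (\<lambda>m. image_mset (\<lambda>i. i - 1) (filter_mset (\<lambda>i. i \<noteq> 0) m)) (\<lambda>m. count m 0)"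

lemma split_var_add: "split_var (p + q) = split_var p + split_var q"
  by (simp add: split_var_def graded_add)

lemma split_var_mult: "split_var (p * q) = split_var p * split_var q"
  unfolding split_var_def by (rule graded_mult) auto

lemma split_var_1: "split_var 1 = 1"
proof -
  have "split_var (Poly_Mapping.single 0 (1::'a)) = monom (Poly_Mapping.single 0 1) 0"
    by (simp only: split_var_def graded_single) simp
  then show ?thesis by (simp add: monom_0 one_pCons)
qed

lemma inj_split_var: "inj split_var"
  unfolding split_var_def
proof (rule inj_graded, rule injI)
  have *: "m = image_mset Suc (image_mset (\<lambda>i. i - 1) (filter_mset (\<lambda>i. i \<noteq> 0) m))
      + replicate_mset (count m 0) 0" for m :: "nat multiset"
    by (induction m) auto
  fix m n :: "nat multiset"
  assume "(image_mset (\<lambda>i. i - 1) (filter_mset (\<lambda>i. i \<noteq> 0) m), count m 0)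
      = (image_mset (\<lambda>i. i - 1) (filter_mset (\<lambda>i. i \<noteq> 0) n), count n 0)"
  then show "m = n" using *[of m] *[of n] by (metis prod.inject)
qed

lemma surj_split_var: "surj split_var"
proof -
  have monom: "q \<in> range split_var" if "q = monom c k" for q :: "(nat multiset \<Rightarrow>\<^sub>0 'a) poly" and c k
    unfolding that
  proof (induction c rule: poly_mapping_single_induct)
    case 1
    have "split_var 0 = 0" by (simp add: split_var_def)
    then show ?case by (metis monom_eq_0 rangeI)
  next
    case (2 c m a)
    let ?m = "image_mset Suc m + replicate_mset k 0"
    have "image_mset (\<lambda>i. i - 1) (filter_mset (\<lambda>i. i \<noteq> 0) (image_mset Suc m)) = m"
      by (induction m) auto
    moreover have "filter_mset (\<lambda>i. i \<noteq> 0) (replicate_mset k (0::nat)) = {#}"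
      unfolding filter_mset_eq_mempty_iff by (simp split: if_splits)
    ultimately have "image_mset (\<lambda>i. i - 1) (filter_mset (\<lambda>i. i \<noteq> 0) ?m) = m"
      by (simp only: filter_union_mset image_mset_union image_mset_empty add_0_right)
    moreover have "count (image_mset Suc m) 0 = 0"
      by (simp add: count_eq_zero_iff)
    then have "count ?m 0 = k" by simp
    ultimately have "split_var (Poly_Mapping.single ?m a) = monom (Poly_Mapping.single m a) k"
      by (simp only: split_var_def graded_single)
    moreover obtain q where "monom c k = split_var q" using 2 by blast
    ultimately have "monom (c + Poly_Mapping.single m a) k = split_var (q + Poly_Mapping.single ?m a)"
      by (simp only: split_var_add flip: add_monom)
    then show ?case by blast
  qed
  have "(\<Sum>k\<in>A. monom (coeff q k) k) \<in> range split_var" if "finite A"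
    for q :: "(nat multiset \<Rightarrow>\<^sub>0 'a) poly" and A
    using that
  proof (induction A rule: finite_induct)
    case empty
    have "split_var 0 = 0" by (simp add: split_var_def)
    then show ?case by (metis rangeI sum.empty)
  next
    case (insert k A)
    obtain r where r: "monom (coeff q k) k = split_var r" using monom[OF refl] by blast
    obtain s where s: "(\<Sum>k\<in>A. monom (coeff q k) k) = split_var s" using insert.IH by blast
    have "(\<Sum>k\<in>insert k A. monom (coeff q k) k) = split_var (r + s)"
      using insert.hyps by (simp add: r s split_var_add)
    then show ?case by blast
  qed
  then have "q \<in> range split_var" for q :: "(nat multiset \<Rightarrow>\<^sub>0 'a) poly"
    using poly_as_sum_of_monoms[of q] by (metis finite_atMost)
  then show ?thesis by blast
qed

lemma split_var_dvd: "split_var p dvd split_var q \<longleftrightarrow> p dvd q"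
proof
  assume "split_var p dvd split_var q"
  then obtain r where "split_var q = split_var p * r" by (elim dvdE)
  moreover obtain r' where "r = split_var r'" using surj_split_var by blast
  ultimately have "q = p * r'" using injD[OF inj_split_var] by (simp flip: split_var_mult)
  then show "p dvd q" by simp
qed (auto simp: split_var_mult elim!: dvdE)

lemma split_var_irreducible:
  assumes "irreducible_elem p"
  shows "irreducible_elem (split_var p)"
proof (rule comm_semiring_1_class.irreducibleI)
  have "split_var 0 = 0" by (simp add: split_var_def)
  then show "split_var p \<noteq> 0" using assms injD[OF inj_split_var, of p 0]
    by (auto simp: comm_semiring_1_class.irreducible_def)
  show "\<not> split_var p dvd 1"
    using assms split_var_dvd[of p 1] by (auto simp: split_var_1 comm_semiring_1_class.irreducible_def)
  fix a b assume ab: "split_var p = a * b"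
  obtain a' b' where "a = split_var a'" "b = split_var b'" using surj_split_var by blast
  with ab have "p = a' * b'" using injD[OF inj_split_var] by (simp flip: split_var_mult)
  then show "a dvd 1 \<or> b dvd 1"
    using assms split_var_dvd[of _ 1] \<open>a = _\<close> \<open>b = _\<close>
    by (auto simp: split_var_1 comm_semiring_1_class.irreducible_def)
qed

text \<open>
  Induction on the number of variables: separating the first one turns polynomials in \<open>N + 1\<close>
  variables into polynomials with coefficients in the first \<open>N\<close> variables, and Gauss's lemma
  applies.  Bounding the variables of \<open>f\<close> and \<open>g\<close> too is essential, because the induction hypothesis
  only speaks about coefficients in finitely many variables.
\<close>

lemma irreducible_prime_below:
  fixes p f g :: "nat multiset \<Rightarrow>\<^sub>0 'k::field"
  assumes "irreducible_elem p" "p \<in> vars_below N" "f \<in> vars_below N" "g \<in> vars_below N" "p dvd f * g"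
  shows "p dvd f \<or> p dvd g"
  using assms
proof (induction N arbitrary: p f g)
  case 0
  then show ?case using vars_below_0_unit(1) by (auto simp: comm_semiring_1_class.irreducible_def)
next
  case (Suc N)
  interpret sub: factor_closed_subring "vars_below N :: (nat multiset \<Rightarrow>\<^sub>0 'k) set"
    by (rule factor_closed_vars_below)
  interpret sub: factorial_subring "vars_below N :: (nat multiset \<Rightarrow>\<^sub>0 'k) set"
    by unfold_locales (use irreducible_factorization Suc.IH in blast)+
  interpret sub': factor_closed_subring "vars_below (Suc N) :: (nat multiset \<Rightarrow>\<^sub>0 'k) set"
    by (rule factor_closed_vars_below)
  have in_sub: "sub.coeffs_in (split_var q)" if "q \<in> vars_below (Suc N)" for q
    unfolding sub.coeffs_in_def
  proof
    fix k
    have "i < N" if "m \<in> Poly_Mapping.keys (coeff (split_var q) k)" "i \<in># m" for m i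
      using that keys_coeff_graded \<open>q \<in> _\<close> unfolding split_var_def vars_below_def by fastforce
    then show "coeff (split_var q) k \<in> vars_below N" by (auto simp: vars_below_def)
  qed
  obtain h where h: "f * g = p * h" using Suc.prems(5) by (elim dvdE)
  show ?case
  proof (cases "f * g = 0")
    case False
    then have "h \<in> vars_below (Suc N)"
      using sub'.factor_mem[of h p] sub'.mult_mem Suc.prems h by (metis mult.commute)
    then have "split_var p dvd split_var f \<or> split_var p dvd split_var g"
      using Suc.prems h
      by (intro sub.irreducible_poly_prime[of _ _ _ "split_var h"])
        (auto simp: in_sub split_var_irreducible simp flip: split_var_mult)
    then show ?thesis by (simp add: split_var_dvd)
  qed auto
qed

text \<open>
  Any three polynomials involve only finitely many variables.
\<close>

theorem irreducible_imp_prime_elem: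
  fixes p :: "nat multiset \<Rightarrow>\<^sub>0 'k::field"
  assumes "irreducible_elem p"
  shows "prime_elem p"
proof -
  have mono: "q \<in> vars_below N'" if "q \<in> vars_below N" "N \<le> N'" for q :: "nat multiset \<Rightarrow>\<^sub>0 'k" and N N'
    using that by (fastforce simp: vars_below_def)
  have ex: "\<exists>N. q \<in> vars_below N" for q :: "nat multiset \<Rightarrow>\<^sub>0 'k"
  proof -
    have "finite (\<Union>m\<in>Poly_Mapping.keys q. set_mset m)" by auto
    then obtain N where "\<forall>i\<in>(\<Union>m\<in>Poly_Mapping.keys q. set_mset m). i < N"
      using finite_nat_set_iff_bounded by blast
    then show ?thesis by (auto simp: vars_below_def)
  qed
  have "p dvd f \<or> p dvd g" if "p dvd f * g" for f g
  proof -
    obtain N1 N2 N3 where "p \<in> vars_below N1" "f \<in> vars_below N2" "g \<in> vars_below N3"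
      using ex by meson
    then have "p \<in> vars_below (N1 + N2 + N3)" "f \<in> vars_below (N1 + N2 + N3)" "g \<in> vars_below (N1 + N2 + N3)"
      using mono by (meson le_add1 le_add2 trans_le_add1)+
    then show ?thesis using irreducible_prime_below[OF assms] that by blast
  qed
  then show ?thesis using assms
    by (auto simp: prime_elem_def comm_semiring_1_class.irreducible_def)
qed

section \<open>Invariants of an involution of the variables in characteristic two\<close>

text \<open>
  The subset \<open>S\<close> of a ring, with its operations carried along an injective map \<open>e\<close> to another type;
  here it turns polynomials into sets of natural numbers.
\<close>

definition image_ring :: "('a::comm_ring_1 \<Rightarrow> 'b) \<Rightarrow> 'a set \<Rightarrow> 'b ring" where
  "image_ring e S = \<lparr>carrier = e ` S,
     monoid.mult = (\<lambda>x y. e (inv_into UNIV e x * inv_into UNIV e y)), one = e 1,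
     ring.zero = e 0, add = (\<lambda>x y. e (inv_into UNIV e x + inv_into UNIV e y))\<rparr>"

lemma image_ring_simps [simp]:
  "carrier (image_ring e S) = e ` S"
  "\<one>\<^bsub>image_ring e S\<^esub> = e 1"
  "\<zero>\<^bsub>image_ring e S\<^esub> = e 0"
  "inj e \<Longrightarrow> e x \<otimes>\<^bsub>image_ring e S\<^esub> e y = e (x * y)"
  "inj e \<Longrightarrow> e x \<oplus>\<^bsub>image_ring e S\<^esub> e y = e (x + y)"
  by (simp_all add: image_ring_def)

lemma image_ring_domain:
  fixes S :: "'a::idom set"
  assumes e: "inj e" and "0 \<in> S" "1 \<in> S" and add: "\<And>x y. x \<in> S \<Longrightarrow> y \<in> S \<Longrightarrow> x + y \<in> S"
    and minus: "\<And>x. x \<in> S \<Longrightarrow> - x \<in> S" and mult: "\<And>x y. x \<in> S \<Longrightarrow> y \<in> S \<Longrightarrow> x * y \<in> S"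
  shows "domain (image_ring e S)"
proof (rule domain.intro)
  show "cring (image_ring e S)"
  proof (rule cringI)
    show "abelian_group (image_ring e S)"
    proof (rule abelian_groupI)
      fix x assume "x \<in> carrier (image_ring e S)"
      then obtain a where "x = e a" "a \<in> S" by auto
      then show "\<exists>y\<in>carrier (image_ring e S). y \<oplus>\<^bsub>image_ring e S\<^esub> x = \<zero>\<^bsub>image_ring e S\<^esub>"
        using minus e by (intro bexI[of _ "e (- a)"]) auto
    qed (use assms in \<open>auto simp: ac_simps\<close>)
    show "Group.comm_monoid (image_ring e S)"
      by (rule comm_monoidI) (use assms in \<open>auto simp: ac_simps\<close>)
  qed (use e in \<open>auto simp: distrib_right\<close>)
  show "domain_axioms (image_ring e S)"
    by unfold_locales (use e in \<open>auto simp: inj_eq\<close>)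
qed

text \<open>
  A polynomial over the field with two elements is determined by its set of monomials, so encoding
  monomials as numbers embeds the polynomial ring into the sets of natural numbers.
\<close>

type_synonym F2_poly = "nat multiset \<Rightarrow>\<^sub>0 bit"

definition encode :: "F2_poly \<Rightarrow> nat set" where
  "encode p = (\<lambda>m. to_nat (sorted_list_of_multiset m)) ` Poly_Mapping.keys p"

lemma inj_encode: "inj encode"
proof (rule injI)
  fix p q :: F2_poly
  assume "encode p = encode q"
  then have "Poly_Mapping.keys p = Poly_Mapping.keys q"
    unfolding encode_def by (subst (asm) inj_image_eq_iff) (auto intro!: injI, metis mset_sorted_list_of_multiset)
  then have "Poly_Mapping.lookup p m = 0 \<longleftrightarrow> Poly_Mapping.lookup q m = 0" for m
    by (metis in_keys_iff)
  then have "Poly_Mapping.lookup p m = Poly_Mapping.lookup q m" for m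
    by (metis bit_not_zero_iff)
  then show "p = q" by (rule poly_mapping_eqI)
qed

lemma encode_eq_iff [simp]: "encode p = encode q \<longleftrightarrow> p = q"
  using inj_encode by (rule inj_eq)

text \<open>
  A unit has degree zero, and the only nonzero constant is \<open>1\<close>.  Hence associated polynomials are
  equal, which keeps the involution below from mapping a prime to a different associate.
\<close>

lemma F2_poly_unit: "p dvd 1 \<Longrightarrow> p = (1 :: F2_poly)"
proof -
  assume "p dvd 1"
  then obtain q where pq: "1 = p * q" by (elim dvdE)
  then have 0: "p \<noteq> 0" "q \<noteq> 0" by auto
  have "(1::F2_poly) \<in> vars_below 0" by (simp add: vars_below_def)
  then have "tail_degree 0 p = 0"
    using tail_degree_mult[OF 0, of 0] pq by (simp add: vars_below_iff)
  then have "p \<in> vars_below 0" by (simp add: vars_below_iff)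
  from vars_below_0_unit(2)[OF this 0(1)] have p: "p = Poly_Mapping.single 0 (Poly_Mapping.lookup p 0)" .
  then have "Poly_Mapping.lookup p 0 \<noteq> 0" using 0 by force
  then have "Poly_Mapping.lookup p 0 = 1" by (simp add: bit_not_zero_iff)
  with p show "p = 1" by simp
qed

lemma F2_poly_dvd_antisym: "p dvd q \<Longrightarrow> q dvd p \<Longrightarrow> p = (q :: F2_poly)"
proof -
  assume "p dvd q" "q dvd p"
  then obtain r s where rs: "q = p * r" "p = q * s" by (elim dvdE)
  show "p = q"
  proof (cases "p = 0")
    case False
    have "p * (r * s) = p * 1" using rs by (metis mult.assoc mult.right_neutral)
    then have "r * s = 1" using False by (metis mult_left_cancel)
    then have "r dvd 1" by (metis dvd_triv_left)
    then have "r = 1" by (rule F2_poly_unit)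
    then show ?thesis using rs by simp
  qed (use rs(1) in simp)
qed

lemma F2_poly_degree_0: "tail_degree 0 p = 0 \<Longrightarrow> p \<noteq> 0 \<Longrightarrow> p = (1 :: F2_poly)"
  using vars_below_0_unit(1) vars_below_iff F2_poly_unit by blast

lemma F2_poly_two [simp]: "(2 :: F2_poly) = 0"
proof -
  have "(2 :: F2_poly) = Poly_Mapping.single 0 2" by (rule single_numeral[symmetric])
  then show ?thesis unfolding bit_numeral_even single_zero .
qed

lemma F2_poly_double: "p + p = (0 :: F2_poly)"
  by (simp flip: mult_2)

definition swap_index :: "nat \<Rightarrow> nat" where
  "swap_index i = (if even i then Suc i else i - 1)"

text \<open>
  A homomorphism of the form \<open>graded\<close> with all weights zero has constant polynomials as values, so
  taking the constant coefficient loses nothing.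
\<close>

definition swap_vars :: "F2_poly \<Rightarrow> F2_poly" where
  "swap_vars p = coeff (graded (image_mset swap_index) (\<lambda>_. 0) p) 0"

lemma swap_index_swap_index [simp]: "swap_index (swap_index i) = i"
  by (auto simp: swap_index_def)

lemma swap_mset_swap_mset [simp]: "image_mset swap_index (image_mset swap_index m) = m"
  by (induction m) auto

lemma lookup_swap_vars:
  "Poly_Mapping.lookup (swap_vars p) (image_mset swap_index m) = Poly_Mapping.lookup p m"
  unfolding swap_vars_def
  by (rule lookup_coeff_graded[where w = "\<lambda>_. 0"]) (metis (mono_tags, lifting) injI prod.inject swap_mset_swap_mset)

lemma swap_vars_swap_vars [simp]: "swap_vars (swap_vars p) = p"
  by (rule poly_mapping_eqI) (metis lookup_swap_vars swap_mset_swap_mset)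

lemma swap_vars_add: "swap_vars (p + q) = swap_vars p + swap_vars q"
  by (simp add: swap_vars_def graded_add)

lemma swap_vars_mult: "swap_vars (p * q) = swap_vars p * swap_vars q"
  by (simp add: swap_vars_def graded_mult coeff_mult_0)

lemma swap_vars_single:
  "swap_vars (Poly_Mapping.single m c) = Poly_Mapping.single (image_mset swap_index m) c"
  by (simp add: swap_vars_def)

lemma swap_vars_0 [simp]: "swap_vars 0 = 0"
  by (simp add: swap_vars_def)

lemma swap_vars_1 [simp]: "swap_vars 1 = 1"
  using swap_vars_single[of 0 1] by simp

lemma swap_vars_dvd: "p dvd q \<Longrightarrow> swap_vars p dvd swap_vars q"
  by (auto simp: swap_vars_mult elim!: dvdE)

lemma swap_vars_irreducible:
  assumes "irreducible_elem p"
  shows "irreducible_elem (swap_vars p)"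
proof (rule comm_semiring_1_class.irreducibleI)
  show "swap_vars p \<noteq> 0" using assms by (metis not_irreducible_zero swap_vars_0 swap_vars_swap_vars)
  show "\<not> swap_vars p dvd 1"
    using assms swap_vars_dvd[of "swap_vars p" 1] by (auto simp: comm_semiring_1_class.irreducible_def)
  fix a b assume "swap_vars p = a * b"
  then have "p = swap_vars a * swap_vars b" by (metis swap_vars_mult swap_vars_swap_vars)
  then have "swap_vars a dvd 1 \<or> swap_vars b dvd 1"
    using assms by (auto simp: comm_semiring_1_class.irreducible_def)
  then show "a dvd 1 \<or> b dvd 1" by (metis swap_vars_1 swap_vars_dvd swap_vars_swap_vars)
qed

text \<open>
  The invariants of the involution; variables with indices \<open>2 i\<close> and \<open>2 i + 1\<close> are paired.
\<close>

definition invariant_polys :: "F2_poly set" where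
  "invariant_polys = {p. swap_vars p = p}"

lemma invariant_cofactor:
  "p \<in> invariant_polys \<Longrightarrow> p * q \<in> invariant_polys \<Longrightarrow> p \<noteq> 0 \<Longrightarrow> q \<in> invariant_polys"
  by (auto simp: invariant_polys_def swap_vars_mult)

text \<open>
  For an irreducible \<open>p\<close>, this is the prime of the ring of invariants below \<open>p\<close>.
\<close>

definition orbit_product :: "F2_poly \<Rightarrow> F2_poly" where
  "orbit_product p = (if swap_vars p = p then p else p * swap_vars p)"

lemma orbit_product_invariant: "orbit_product p \<in> invariant_polys"
  by (auto simp: orbit_product_def invariant_polys_def swap_vars_mult mult.commute)

lemma dvd_orbit_product: "p dvd orbit_product p"
  by (simp add: orbit_product_def)

text \<open>
  An invariant multiple of \<open>p\<close> is also a multiple of the image of \<open>p\<close>; if the two are different,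
  they are primes that are not associated, so their product divides it.
\<close>

lemma orbit_product_dvd_iff:
  assumes p: "irreducible_elem p" and x: "x \<in> invariant_polys"
  shows "orbit_product p dvd x \<longleftrightarrow> p dvd x"
proof
  assume "p dvd x"
  show "orbit_product p dvd x"
  proof (cases "swap_vars p = p")
    case False
    obtain y where y: "x = p * y" using \<open>p dvd x\<close> by (elim dvdE)
    have irr: "irreducible_elem (swap_vars p)" by (rule swap_vars_irreducible[OF p])
    have "swap_vars p dvd p * y"
      using swap_vars_dvd[OF \<open>p dvd x\<close>] x y by (simp add: invariant_polys_def)
    moreover have "\<not> swap_vars p dvd p"
    proof
      assume "swap_vars p dvd p"
      then have "p dvd swap_vars p" using swap_vars_dvd by fastforce
      then show False using F2_poly_dvd_antisym \<open>swap_vars p dvd p\<close> False by blast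
    qed
    ultimately have "swap_vars p dvd y"
      using irreducible_imp_prime_elem[OF irr] prime_elem_dvd_multD by blast
    then show ?thesis using False y by (simp add: orbit_product_def mult_dvd_mono)
  qed (use \<open>p dvd x\<close> in \<open>simp add: orbit_product_def\<close>)
qed (use dvd_orbit_product dvd_trans in blast)

definition invariant_ring :: "nat set ring" where
  "invariant_ring = image_ring encode invariant_polys"

lemmas invariant_ring_simps [simp] =
  image_ring_simps[of encode invariant_polys, folded invariant_ring_def]

declare invariant_ring_simps(4,5)[OF inj_encode, simp]

lemma domain_invariant_ring: "domain invariant_ring"
  unfolding invariant_ring_def
proof (rule image_ring_domain[OF inj_encode])
  have "- x = (x :: F2_poly)" for x using F2_poly_double[of x] by (metis eq_neg_iff_add_eq_0)
  then show "x \<in> invariant_polys \<Longrightarrow> - x \<in> invariant_polys" for x by metis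
qed (auto simp: invariant_polys_def swap_vars_add swap_vars_mult)

interpretation invariants: domain invariant_ring by (rule domain_invariant_ring)

lemma invariant_ring_divides:
  assumes "x \<in> invariant_polys" "y \<in> invariant_polys" "x \<noteq> 0" "y \<noteq> 0"
  shows "encode x divides\<^bsub>mult_of invariant_ring\<^esub> encode y \<longleftrightarrow> x dvd y"
proof
  assume "encode x divides\<^bsub>mult_of invariant_ring\<^esub> encode y"
  then obtain c where c: "c \<in> carrier (mult_of invariant_ring)" "encode y = encode x \<otimes>\<^bsub>mult_of invariant_ring\<^esub> c"
    unfolding factor_def by blast
  then obtain z where "c = encode z" by auto
  with c(2) have "y = x * z" by simp
  then show "x dvd y" by simp
next
  assume "x dvd y"
  then obtain z where z: "y = x * z" by (elim dvdE)
  have "z \<in> invariant_polys"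
    using invariant_cofactor[OF assms(1) _ assms(3)] assms(2) unfolding z .
  moreover have "z \<noteq> 0" using z assms(4) by auto
  ultimately show "encode x divides\<^bsub>mult_of invariant_ring\<^esub> encode y"
    using z inj_encode by (intro dividesI[of "encode z"]) (auto simp: inj_eq)
qed

lemma invariant_ring_Units:
  assumes "x \<in> invariant_polys" "encode x \<in> Units (mult_of invariant_ring)"
  shows "x = 1"
proof -
  have "encode x \<otimes>\<^bsub>invariant_ring\<^esub> inv\<^bsub>mult_of invariant_ring\<^esub> encode x = encode 1"
    using invariants.mult_of.Units_r_inv[OF assms(2)] by simp
  moreover obtain y where "inv\<^bsub>mult_of invariant_ring\<^esub> encode x = encode y"
    using invariants.mult_of.Units_inv_closed[OF assms(2)] by auto
  ultimately have "x * y = 1" using inj_encode by (simp add: inj_eq)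
  then show ?thesis using F2_poly_unit by (metis dvd_triv_left)
qed

lemma one_invariant: "1 \<in> invariant_polys"
  by (simp add: invariant_polys_def)

text \<open>
  Chains of proper divisors are finite by degree.  An irreducible invariant \<open>f\<close> has a prime factor
  \<open>p\<close> in the polynomial ring, hence is divisible by the orbit product of \<open>p\<close>, hence equals it; and
  an orbit product is prime in the ring of invariants because it divides an invariant as soon as \<open>p\<close>
  does.
\<close>

lemma factorial_invariant_ring: "factorial_domain invariant_ring"
proof -
  let ?M = "mult_of invariant_ring"
  have "wf {(x, y). x \<in> carrier ?M \<and> y \<in> carrier ?M \<and> properfactor ?M x y}"
  proof (rule wf_subset[OF wf_measure[of "\<lambda>x. tail_degree 0 (inv_into UNIV encode x)"]], clarify)
    fix x y assume x: "x \<in> carrier ?M" and y: "y \<in> carrier ?M" and pf: "properfactor ?M x y"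
    obtain p q where pq: "x = encode p" "y = encode q" "p \<in> invariant_polys" "q \<in> invariant_polys" "p \<noteq> 0" "q \<noteq> 0"
      using x y by auto
    have "p dvd q" "\<not> q dvd p" using pf pq by (auto simp: properfactor_def invariant_ring_divides)
    then obtain r where r: "q = p * r" by (elim dvdE)
    have "r \<noteq> 0" "r \<noteq> 1" using pq(6) \<open>\<not> q dvd p\<close> r by auto
    then have "tail_degree 0 p < tail_degree 0 q"
      using tail_degree_mult[of p r 0] F2_poly_degree_0[of r] pq r by auto
    then show "(x, y) \<in> measure (\<lambda>x. tail_degree 0 (inv_into UNIV encode x))"
      using pq inj_encode by simp
  qed
  moreover have "prime ?M a" if a: "a \<in> carrier ?M" and irr: "Divisibility.irreducible ?M a" for a
  proof -
    obtain f where f: "a = encode f" "f \<in> invariant_polys" "f \<noteq> 0" using a by auto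
    have "f \<noteq> 1" using irr f invariants.mult_of.Units_one_closed by (auto simp: Divisibility.irreducible_def)
    obtain A u where Au: "u dvd 1" "\<forall>x\<in>#A. irreducible_elem x" "f = u * prod_mset A"
      using irreducible_factorization f by blast
    have "A \<noteq> {#}" using Au F2_poly_unit \<open>f \<noteq> 1\<close> by auto
    then obtain p where p: "p \<in># A" by blast
    then have irrp: "irreducible_elem p" and pf: "p dvd f"
      using Au by (auto intro: dvd_mult dvd_prod_mset)
    let ?q = "orbit_product p"
    have q: "?q \<in> invariant_polys" by (rule orbit_product_invariant)
    have "?q dvd f" using pf irrp f by (simp add: orbit_product_dvd_iff)
    then have q0: "?q \<noteq> 0" using f by auto
    have "?q \<noteq> 1" using dvd_orbit_product[of p] irrp by (metis comm_semiring_1_class.irreducible_def)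
    then have "encode ?q \<notin> Units ?M" using invariant_ring_Units q by blast
    then have "\<not> properfactor ?M (encode ?q) (encode f)"
      using irr f q q0 inj_encode by (auto simp: Divisibility.irreducible_def inj_eq)
    then have "f dvd ?q"
      using \<open>?q dvd f\<close> q q0 f by (simp add: properfactor_def invariant_ring_divides)
    then have fq: "f = ?q" using \<open>?q dvd f\<close> F2_poly_dvd_antisym by blast
    show ?thesis
    proof (rule primeI)
      show "a \<notin> Units ?M" using irr by (simp add: Divisibility.irreducible_def)
      fix b c assume b: "b \<in> carrier ?M" and c: "c \<in> carrier ?M"
        and dvd: "a divides\<^bsub>?M\<^esub> b \<otimes>\<^bsub>?M\<^esub> c"
      obtain x y where xy: "b = encode x" "c = encode y" "x \<in> invariant_polys" "y \<in> invariant_polys" "x \<noteq> 0" "y \<noteq> 0"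
        using b c by auto
      have xyS: "x * y \<in> invariant_polys" using xy by (simp add: invariant_polys_def swap_vars_mult)
      have "f dvd x * y" using dvd f xy xyS inj_encode by (simp add: invariant_ring_divides)
      then have "p dvd x * y" using fq dvd_orbit_product dvd_trans by metis
      then have "p dvd x \<or> p dvd y"
        using irreducible_imp_prime_elem[OF irrp] prime_elem_dvd_multD by blast
      then have "f dvd x \<or> f dvd y" using fq orbit_product_dvd_iff[OF irrp] xy by metis
      then show "a divides\<^bsub>?M\<^esub> b \<or> a divides\<^bsub>?M\<^esub> c"
        using f xy by (simp add: invariant_ring_divides)
    qed
  qed
  ultimately have "divisor_chain_condition_monoid ?M \<and> primeness_condition_monoid ?M"
    using invariants.mult_of.comm_monoid_cancel_axioms
    by (auto simp: divisor_chain_condition_monoid_def divisor_chain_condition_monoid_axioms_def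
      primeness_condition_monoid_def primeness_condition_monoid_axioms_def)
  then have "factorial_monoid ?M" by (simp add: factorial_condition_one)
  then show ?thesis using domain_invariant_ring by (simp add: factorial_domain_def)
qed

lemma characteristic_invariant_ring: "characteristic invariant_ring = 2"
proof -
  have pow: "[(n::nat)] \<cdot>\<^bsub>invariant_ring\<^esub> encode 1 = encode (of_nat n)" for n
    by (induction n) (use inj_encode in \<open>simp_all add: invariants.add.nat_pow_Suc add.commute\<close>)
  have one: "encode 1 \<in> carrier invariant_ring" using one_invariant by simp
  have "[(n::nat)] \<cdot>\<^bsub>invariant_ring\<^esub> encode 1 = encode 0 \<longleftrightarrow> 2 dvd n" for n
  proof -
    have even: "of_nat (2 * k) = (0 :: F2_poly)" for k
      by (simp add: F2_poly_double mult_2)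
    have "of_nat n = (0 :: F2_poly) \<longleftrightarrow> 2 dvd n"
    proof (cases "2 dvd n")
      case True
      then show ?thesis using even by (auto elim!: dvdE)
    next
      case False
      then obtain k where "n = Suc (2 * k)" by (metis oddE Suc_eq_plus1)
      then show ?thesis using even[of k] False by (simp del: of_nat_mult)
    qed
    then show ?thesis unfolding pow using inj_encode by (simp add: inj_eq)
  qed
  then show ?thesis using invariants.add.ord_unique[OF one, of 2]
    by (simp add: characteristic_def)
qed

section \<open>A colon ideal that is not finitely generated\<close>

lemma lookup_single_mult:
  fixes p :: "'i multiset \<Rightarrow>\<^sub>0 'k::comm_ring_1"
  shows "Poly_Mapping.lookup (Poly_Mapping.single m c * p) n
    = (if m \<subseteq># n then c * Poly_Mapping.lookup p (n - m) else 0)"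
proof (induction p rule: poly_mapping_single_induct)
  case (2 p m' d)
  have "m + m' = n \<longleftrightarrow> m \<subseteq># n \<and> m' = n - m"
    by (metis add_diff_cancel_left' mset_subset_eq_add_left subset_mset.add_diff_inverse)
  then have "Poly_Mapping.lookup (Poly_Mapping.single m c * Poly_Mapping.single m' d) n
      = (if m \<subseteq># n then c * Poly_Mapping.lookup (Poly_Mapping.single m' d) (n - m) else 0)"
    by (auto simp: mult_single lookup_single when_def)
  with 2 show ?case by (simp add: distrib_left lookup_add)
qed simp

lemma lookup_mult_empty:
  fixes p q :: "'i multiset \<Rightarrow>\<^sub>0 'k::comm_ring_1"
  shows "Poly_Mapping.lookup (p * q) {#} = Poly_Mapping.lookup p {#} * Poly_Mapping.lookup q {#}"
proof (induction p rule: poly_mapping_single_induct)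
  case (2 p m c)
  then show ?case
    by (simp add: distrib_right lookup_add lookup_single_mult lookup_single when_def)
qed simp

lemma lookup_mult_single:
  fixes p q :: "'i multiset \<Rightarrow>\<^sub>0 'k::comm_ring_1"
  shows "Poly_Mapping.lookup (p * q) {#i#} = Poly_Mapping.lookup p {#} * Poly_Mapping.lookup q {#i#}
    + Poly_Mapping.lookup p {#i#} * Poly_Mapping.lookup q {#}"
proof (induction p rule: poly_mapping_single_induct)
  case (2 p m c)
  have "m \<subseteq># {#i#} \<longleftrightarrow> m = {#} \<or> m = {#i#}"
    by (cases m) auto
  with 2 show ?case
    by (auto simp: distrib_right lookup_add lookup_single_mult lookup_single when_def add_ac)
qed simp

definition indet :: "nat \<Rightarrow> F2_poly" where
  "indet i = Poly_Mapping.single {#i#} 1"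

text \<open>
  With \<open>u\<^sub>i\<close> and \<open>v\<^sub>i\<close> for the variables of index \<open>2 i\<close> and \<open>2 i + 1\<close>, the invariant \<open>trace k\<close> is
  \<open>u\<^sub>k + v\<^sub>k\<close>, and \<open>minor i j\<close> is the determinant \<open>u\<^sub>i v\<^sub>j - v\<^sub>i u\<^sub>j\<close>, equivalently the trace of
  \<open>u\<^sub>i v\<^sub>j\<close>.
\<close>

definition trace :: "nat \<Rightarrow> F2_poly" where
  "trace k = indet (2 * k) + indet (Suc (2 * k))"

definition minor :: "nat \<Rightarrow> nat \<Rightarrow> F2_poly" where
  "minor i j = indet (2 * i) * indet (Suc (2 * j)) + indet (Suc (2 * i)) * indet (2 * j)"

lemma swap_vars_indet: "swap_vars (indet (2 * k)) = indet (Suc (2 * k))" "swap_vars (indet (Suc (2 * k))) = indet (2 * k)"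
  by (simp_all add: indet_def swap_vars_single swap_index_def)

lemma invariant_trace: "trace k \<in> invariant_polys"
  by (simp add: invariant_polys_def trace_def swap_vars_add swap_vars_indet add.commute)

lemma invariant_minor: "minor i j \<in> invariant_polys"
  by (simp add: invariant_polys_def minor_def swap_vars_add swap_vars_mult swap_vars_indet add.commute)

text \<open>
  Expanding along the first row the determinant with rows \<open>(c\<^sub>i, c\<^sub>j, c\<^sub>k)\<close>, \<open>(u\<^sub>i, u\<^sub>j, u\<^sub>k)\<close> and
  \<open>(v\<^sub>i, v\<^sub>j, v\<^sub>k)\<close>, which vanishes since the first row is the sum of the others; signs do not matter in
  characteristic two.
\<close>

lemma plucker: "minor i j * trace k = trace i * minor j k + trace j * minor i k"
proof -
  have "(u * v' + u' * v) * (w + w') + 2 * (u * v * w' + u' * v' * w)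
      = (u + u') * (v * w' + v' * w) + (v + v') * (u * w' + u' * w)"
    for u v w u' v' w' :: "'a::comm_ring_1"
    by (simp add: algebra_simps)
  from this[of "indet (2 * i)" "indet (Suc (2 * j))" "indet (Suc (2 * i))" "indet (2 * j)" "indet (2 * k)" "indet (Suc (2 * k))"]
  show ?thesis unfolding minor_def trace_def by simp
qed

lemma lookup_indet_mult:
  "Poly_Mapping.lookup (indet i * p) m = (if i \<in># m then Poly_Mapping.lookup p (m - {#i#}) else 0)"
  by (simp add: indet_def lookup_single_mult)

lemma lookup_trace: "Poly_Mapping.lookup (trace k) {#i#} = (if i div 2 = k then 1 else 0)"
  unfolding trace_def indet_def lookup_add lookup_single when_def by auto

lemma lookup_trace_empty: "Poly_Mapping.lookup (trace k) {#} = 0"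
  by (simp add: trace_def indet_def lookup_add lookup_single when_def)

lemma trace_nonzero: "trace k \<noteq> 0"
  using lookup_trace[of k "2 * k"] by auto

lemma tail_degree_trace: "tail_degree 0 (trace k) = 1"
proof -
  have g: "graded id (\<lambda>m. size (filter_mset (\<lambda>i. 0 \<le> i) m)) (trace k) = monom (trace k) 1"
    by (simp add: trace_def indet_def graded_add add_monom)
  show ?thesis unfolding tail_degree_def g by (simp add: degree_monom_eq trace_nonzero)
qed

text \<open>
  The degree is one, so in any factorization one factor is a nonzero constant.
\<close>

lemma prime_trace: "prime_elem (trace k)"
proof (rule irreducible_imp_prime_elem, rule comm_semiring_1_class.irreducibleI)
  show "trace k \<noteq> 0" by (rule trace_nonzero)
  show "\<not> trace k dvd 1"
    using F2_poly_unit[of "trace k"] lookup_trace_empty[of k] by (auto simp: lookup_one)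
  fix a b assume ab: "trace k = a * b"
  then have 0: "a \<noteq> 0" "b \<noteq> 0" using trace_nonzero[of k] by auto
  have "tail_degree 0 a + tail_degree 0 b = 1"
    using tail_degree_mult[OF 0, of 0] ab tail_degree_trace[of k] by simp
  then have "tail_degree 0 a = 0 \<or> tail_degree 0 b = 0" by linarith
  then show "a dvd 1 \<or> b dvd 1" using F2_poly_degree_0[of a] F2_poly_degree_0[of b] 0 by auto
qed

lemma trace_dvd_trace: "trace i dvd trace j \<Longrightarrow> i = j"
proof -
  assume "trace i dvd trace j"
  then obtain t where t: "trace j = trace i * t" by (elim dvdE)
  then have "t \<noteq> 0" using trace_nonzero[of j] by auto
  then have "tail_degree 0 t = 0"
    using tail_degree_mult[OF trace_nonzero[of i] \<open>t \<noteq> 0\<close>, of 0] tail_degree_trace[of i] tail_degree_trace[of j] t by simp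
  then have "t = 1" using F2_poly_degree_0 \<open>t \<noteq> 0\<close> by blast
  then have "trace j = trace i" using t by simp
  then show "i = j" using lookup_trace[of i "2 * i"] lookup_trace[of j "2 * i"] by (simp split: if_splits)
qed

text \<open>
  With \<open>u\<^sub>i\<close>, \<open>v\<^sub>i\<close> as above, the coefficients of \<open>u\<^sub>0 v\<^sub>1\<close> and of \<open>u\<^sub>0 u\<^sub>1\<close> on the left are the
  constant term of \<open>g\<close> and \<open>0\<close>.  On the right they are the sums of the coefficient of \<open>u\<^sub>0\<close> in \<open>w\<close> and
  that of \<open>v\<^sub>1\<close>, respectively \<open>u\<^sub>1\<close>, in \<open>y\<close>; these two agree because \<open>y\<close> is invariant.
\<close>

lemma colon_no_constant_term:
  assumes "y \<in> invariant_polys" "w \<in> invariant_polys" "minor 0 1 * g = trace 0 * y + trace 1 * w"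
  shows "Poly_Mapping.lookup g {#} = 0"
proof -
  have swap23: "swap_index 2 = 3" by (simp add: swap_index_def)
  have "Poly_Mapping.lookup y {#2#} = Poly_Mapping.lookup (swap_vars y) (image_mset swap_index {#2#})"
    by (rule lookup_swap_vars[symmetric])
  then have y: "Poly_Mapping.lookup y {#3#} = Poly_Mapping.lookup y {#2#}"
    using assms(1) by (simp add: invariant_polys_def swap23)
  have "Poly_Mapping.lookup (minor 0 1 * g) {#0, 3#} = Poly_Mapping.lookup g {#}"
    "Poly_Mapping.lookup (minor 0 1 * g) {#0, 2#} = 0"
    by (simp_all add: minor_def distrib_right mult.assoc lookup_add lookup_indet_mult)
  moreover have "Poly_Mapping.lookup (trace 0 * y + trace 1 * w) {#0, 3#}
      = Poly_Mapping.lookup y {#3#} + Poly_Mapping.lookup w {#0#}"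
    "Poly_Mapping.lookup (trace 0 * y + trace 1 * w) {#0, 2#}
      = Poly_Mapping.lookup y {#2#} + Poly_Mapping.lookup w {#0#}"
    by (simp_all add: trace_def distrib_right mult.assoc lookup_add lookup_indet_mult)
  ultimately show ?thesis using y assms(3) by simp
qed

text \<open>
  Given finitely many generators, take a variable that occurs in none of them.  As the generators
  have no constant term, no element of the ideal they generate has a linear term in that variable,
  in contrast to the trace that involves it.
\<close>

theorem colon_not_fin_gen:
  "\<not> fin_gen_ideal invariant_ring {t \<in> carrier invariant_ring. \<exists>y\<in>carrier invariant_ring. \<exists>w\<in>carrier invariant_ring.
     encode (minor 0 1) \<otimes>\<^bsub>invariant_ring\<^esub> t
       = encode (trace 0) \<otimes>\<^bsub>invariant_ring\<^esub> y \<oplus>\<^bsub>invariant_ring\<^esub> encode (trace 1) \<otimes>\<^bsub>invariant_ring\<^esub> w}"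
    (is "\<not> fin_gen_ideal invariant_ring ?J")
proof
  assume "fin_gen_ideal invariant_ring ?J"
  then obtain A where A: "A \<subseteq> carrier invariant_ring" "finite A" "?J = Idl\<^bsub>invariant_ring\<^esub> A"
    unfolding fin_gen_ideal_def by blast
  define B where "B = {p \<in> invariant_polys. encode p \<in> A}"
  have AB: "A = encode ` B" using A(1) by (auto simp: B_def)
  have finB: "finite B" using A(2) finite_imageD[of encode B] inj_on_subset[OF inj_encode] unfolding AB by blast
  have B: "Poly_Mapping.lookup p {#} = 0" if "p \<in> B" for p
  proof -
    have "encode p \<in> ?J" unfolding A(3) using invariants.genideal_self[OF A(1)] that B_def by blast
    then obtain y w where "y \<in> invariant_polys" "w \<in> invariant_polys"
      "minor 0 1 * p = trace 0 * y + trace 1 * w" by auto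
    then show ?thesis by (rule colon_no_constant_term)
  qed
  have "finite (\<Union>p\<in>B. \<Union>m\<in>Poly_Mapping.keys p. set_mset m)" using finB by auto
  then obtain n where n: "\<forall>i\<in>(\<Union>p\<in>B. \<Union>m\<in>Poly_Mapping.keys p. set_mset m). i < n"
    using finite_nat_set_iff_bounded by blast
  have n: "Poly_Mapping.lookup p {#2 * n#} = 0" if "p \<in> B" for p
  proof (rule ccontr)
    assume "Poly_Mapping.lookup p {#2 * n#} \<noteq> 0"
    then have "{#2 * n#} \<in> Poly_Mapping.keys p" by (simp only: in_keys_iff not_False_eq_True)
    then have "2 * n < n" using n that by fastforce
    then show False by simp
  qed
  \<comment> \<open>the invariants without constant term and without a linear term in the fresh variable\<close>
  define K where "K = encode ` {p \<in> invariant_polys. Poly_Mapping.lookup p {#} = 0 \<and> Poly_Mapping.lookup p {#2 * n#} = 0}"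
  have "ideal K invariant_ring"
  proof (rule invariants.ideal_of_closed)
    show "K \<subseteq> carrier invariant_ring" by (auto simp: K_def)
    show "\<zero>\<^bsub>invariant_ring\<^esub> \<in> K" by (auto simp: K_def invariant_polys_def)
    fix x y assume "x \<in> K" "y \<in> K"
    then show "x \<oplus>\<^bsub>invariant_ring\<^esub> y \<in> K"
      by (auto simp: K_def invariant_polys_def swap_vars_add lookup_add)
  next
    fix r x assume "r \<in> carrier invariant_ring" "x \<in> K"
    then show "r \<otimes>\<^bsub>invariant_ring\<^esub> x \<in> K"
      by (auto simp: K_def invariant_polys_def swap_vars_mult lookup_mult_empty lookup_mult_single)
  qed
  moreover have "A \<subseteq> K" unfolding AB using B n by (auto simp: K_def B_def)
  ultimately have "?J \<subseteq> K" unfolding A(3) by (rule invariants.genideal_minimal)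
  moreover have "encode (trace n) \<in> ?J"
  proof -
    have "minor 0 1 * trace n = trace 0 * minor 1 n + trace 1 * minor 0 n" by (rule plucker)
    then show ?thesis
      using invariant_trace invariant_minor
      by (intro CollectI conjI bexI[of _ "encode (minor 1 n)"] bexI[of _ "encode (minor 0 n)"]) auto
  qed
  ultimately have "encode (trace n) \<in> K" by blast
  then have "Poly_Mapping.lookup (trace n) {#2 * n#} = 0" by (auto simp: K_def)
  then show False by (simp add: lookup_trace)
qed

lemma trace_coprime:
  assumes "x \<in> carrier invariant_ring" "z \<in> carrier invariant_ring"
    and "encode (trace 1) \<otimes>\<^bsub>invariant_ring\<^esub> x = encode (trace 0) \<otimes>\<^bsub>invariant_ring\<^esub> z"
  shows "\<exists>u\<in>carrier invariant_ring. x = encode (trace 0) \<otimes>\<^bsub>invariant_ring\<^esub> u"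
proof -
  obtain p q where pq: "p \<in> invariant_polys" "x = encode p" "z = encode q" using assms by auto
  then have "trace 1 * p = trace 0 * q" using assms(3) by simp
  then have "trace 0 dvd trace 1 * p" by simp
  then have "trace 0 dvd p"
    using prime_elem_dvd_multD[OF prime_trace] trace_dvd_trace[of 0 1] by auto
  then obtain r where r: "p = trace 0 * r" by (elim dvdE)
  then have "r \<in> invariant_polys"
    using invariant_cofactor[OF invariant_trace] pq(1) trace_nonzero by blast
  then show ?thesis using r pq by (intro bexI[of _ "encode r"]) auto
qed

theorem theorem3p1:
  shows "(\<exists>(R :: nat set ring) (G :: int monoid).
            cring R \<and> characteristic R = 2 \<and> G_GCD_ring R \<and> factorial_domain R
            \<and> comm_group G \<and> fin_gen_group G
            \<and> \<not> finite_conductor_ring (group_ring R G))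
       \<and> \<not> (\<forall>(R :: nat set ring) (G :: int monoid).
            G_GCD_ring R \<longrightarrow> finite_conductor_ring R \<longrightarrow> comm_group G \<longrightarrow> fin_gen_group G
            \<longrightarrow> finite_conductor_ring (group_ring R G))"
proof -
  have not_fc: "\<not> finite_conductor_ring (group_ring invariant_ring C2)"
  proof
    assume "finite_conductor_ring (group_ring invariant_ring C2)"
    moreover have "\<one>\<^bsub>invariant_ring\<^esub> \<oplus>\<^bsub>invariant_ring\<^esub> \<one>\<^bsub>invariant_ring\<^esub> = \<zero>\<^bsub>invariant_ring\<^esub>" by simp
    ultimately show False
      using colon_not_fin_gen trace_coprime invariant_trace invariant_minor trace_nonzero
        invariants.colon_ideal_fin_gen[of "encode (trace 0)" "encode (trace 1)" "encode (minor 0 1)"]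
      by simp
  qed
  have "cring invariant_ring" "comm_group C2"
    by (rule invariants.is_cring) simp
  moreover note characteristic_invariant_ring factorial_invariant_ring factorial_domain.G_GCD[OF factorial_invariant_ring]
    factorial_domain.finite_conductor[OF factorial_invariant_ring] fin_gen_C2 not_fc
  ultimately show ?thesis by blast
qed

end
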